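(* Let $X$ be a metric space with bounded geometry and let $1\leq p<\infty$. Then the Banach algebras $B^p_u(X)$ and $UB^p(X)$ are Morita equivalent in the sense of Lafforgue.
   Context: A metric space $X$ has bounded geometry if for every $R\geq 0$ there is $N_R\in\mathbb{N}$ such that every ball of radius $R$ in $X$ has at most $N_R$ elements (such $X$ is countable and discrete). For an operator $T$ on $\ell^p(X)$ (or on $\ell^p(X,\ell^p)$), write $T=(T_{xy})_{x,y\in X}$ for its matrix (with $T_{xy}=(Te_y)(x)$ for $\ell^p(X)$, $e_y$ the standard basis vector, and $T_{xy}\in B(\ell^p)$ for $\ell^p(X,\ell^p)$), and define its propagation as $\sup\{d(x,y): T_{xy}\neq 0\}$. $\mathbb{C}^p_u[X]$ is the algebra of bounded finite-propagation operators on $\ell^p(X)$, and the $\ell^p$ uniform Roe algebra $B^p_u(X)$ is its operator-norm closure in $B(\ell^p(X))$. $U\mathbb{C}^p[X]$ is the algebra of bounded finite-propagation operators $T$ on $\ell^p(X,\ell^p)$ for which there is $N\in\mathbb{N}$ with every $T_{xy}$ of rank at most $N$; the $\ell^p$ uniform algebra $UB^p(X)$ is its operator-norm closure in $B(\ell^p(X,\ell^p))$. Morita equivalence (Lafforgue). For a Banach algebra $B$, a Banach $B$-pair is a pair $(E^<,E^>)$ with $E^<$ a left Banach $B$-module, $E^>$ a right Banach $B$-module (module actions contractive), and a bilinear map $\langle\cdot,\cdot\rangle:E^<\times E^>\to B$ with $\langle be^<,e^>\rangle=b\langle e^<,e^>\rangle$, $\langle e^<,e^>b\rangle=\langle e^<,e^>\rangle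 b$, $\|\langle e^<,e^>\rangle\|\leq\|e^<\|\|e^>\|$. It is nondegenerate if $BE^<$ spans a dense subspace of $E^<$ and $E^>B$ spans a dense subspace of $E^>$, and full if the span of $\langle E^<,E^>\rangle$ is dense in $B$. A linear operator $T=(T^<,T^>)$ on the pair consists of a right module map $T^>$ on $E^>$ and a left module map $T^<$ on $E^<$ (both bounded) with $\langle f^<,T^>e^>\rangle=\langle T^<f^<,e^>\rangle$; these form a Banach algebra $\mathcal{L}_B(E)$ with norm $\max(\|T^<\|,\|T^>\|)$ and composition $S\circ T=(T^<S^<,S^>T^>)$. A Banach $A$-$B$-pair is a Banach $B$-pair with a contractive homomorphism $A\to\mathcal{L}_B(E)$, i.e. $E^<$ is a Banach $B$-$A$-bimodule, $E^>$ a Banach $A$-$B$-bimodule and $\langle e^<a,e^>\rangle=\langle e^<,ae^>\rangle$. A Morita equivalence between Banach algebras $A$ and $B$ is a pair $(E^<,E^>)$ with bilinear pairings $\langle\cdot,\cdot\rangle_B:E^<\times E^>\to B$ and ${}_A\langle\cdot,\cdot\rangle:E^>\times E^<\to A$ such that $(E^<,E^>)$ with $\langle\cdot,\cdot\rangle_B$ is a Banach $A$-$B$-pair, $(E^>,E^<)$ with ${}_A\langle\cdot,\cdot\rangle$ is a Banach $B$-$A$-pair, $\langle e^<,e^>\rangle_Bf^<=e^<\,{}_A\langle e^>,f^<\rangle$ and $e^>\langle f^<,f^>\rangle_B={}_A\langle e^>,f^<\rangle f^>$ for all $e^<,f^<\in E^<$, $e^>,f^>\in E^>$, and both pairs $(E^<,E^>)$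 and $(E^>,E^<)$ are full and nondegenerate. $A$ and $B$ are Morita equivalent if such a Morita equivalence exists. *)

theory Defs
  imports "HOL-Analysis.Analysis"
begin

record 'x bspace =
  carr :: "'x set"
  add  :: "'x \<Rightarrow> 'x \<Rightarrow> 'x"
  smul :: "complex \<Rightarrow> 'x \<Rightarrow> 'x"
  zer  :: "'x"
  nrm  :: "'x \<Rightarrow> real"

record 'x balg = "'x bspace" +
  mul  :: "'x \<Rightarrow> 'x \<Rightarrow> 'x"

definition vdiff :: "('x,'m) bspace_scheme \<Rightarrow> 'x \<Rightarrow> 'x \<Rightarrow> 'x" where
  "vdiff V x y = add V x (smul V (-1) y)"

definition banach_space :: "('x,'m) bspace_scheme \<Rightarrow> bool" where
  "banach_space V \<longleftrightarrow>
     zer V \<in> carr V \<and>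
     (\<forall>x\<in>carr V. \<forall>y\<in>carr V. add V x y \<in> carr V) \<and>
     (\<forall>c. \<forall>x\<in>carr V. smul V c x \<in> carr V) \<and>
     (\<forall>x\<in>carr V. \<forall>y\<in>carr V. \<forall>z\<in>carr V. add V (add V x y) z = add V x (add V y z)) \<and>
     (\<forall>x\<in>carr V. \<forall>y\<in>carr V. add V x y = add V y x) \<and>
     (\<forall>x\<in>carr V. add V (zer V) x = x) \<and>
     (\<forall>x\<in>carr V. add V x (smul V (-1) x) = zer V) \<and>
     (\<forall>c. \<forall>x\<in>carr V. \<forall>y\<in>carr V. smul V c (add V x y) = add V (smul V c x) (smul V c y)) \<and>
     (\<forall>c d. \<forall>x\<in>carr V. smul V (c + d) x = add V (smul V c x) (smul V d x)) \<and>
     (\<forall>c d. \<forall>x\<in>carr V. smul V c (smul V d x) = smul V (c * d) x) \<and>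
     (\<forall>x\<in>carr V. smul V 1 x = x) \<and>
     (\<forall>x\<in>carr V. 0 \<le> nrm V x) \<and>
     (\<forall>x\<in>carr V. nrm V x = 0 \<longleftrightarrow> x = zer V) \<and>
     (\<forall>c. \<forall>x\<in>carr V. nrm V (smul V c x) = norm c * nrm V x) \<and>
     (\<forall>x\<in>carr V. \<forall>y\<in>carr V. nrm V (add V x y) \<le> nrm V x + nrm V y) \<and>
     (\<forall>s :: nat \<Rightarrow> 'x. (\<forall>n. s n \<in> carr V) \<longrightarrow>
          (\<forall>e>0. \<exists>N. \<forall>m\<ge>N. \<forall>n\<ge>N. nrm V (vdiff V (s m) (s n)) < e) \<longrightarrow>
          (\<exists>l\<in>carr V. \<forall>e>0. \<exists>N. \<forall>n\<ge>N. nrm V (vdiff V (s n) l) < e))"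

definition banach_algebra :: "('x,'m) balg_scheme \<Rightarrow> bool" where
  "banach_algebra A \<longleftrightarrow> banach_space A \<and>
     (\<forall>x\<in>carr A. \<forall>y\<in>carr A. mul A x y \<in> carr A) \<and>
     (\<forall>x\<in>carr A. \<forall>y\<in>carr A. \<forall>z\<in>carr A. mul A (mul A x y) z = mul A x (mul A y z)) \<and>
     (\<forall>x\<in>carr A. \<forall>y\<in>carr A. \<forall>z\<in>carr A. mul A (add A x y) z = add A (mul A x z) (mul A y z)) \<and>
     (\<forall>x\<in>carr A. \<forall>y\<in>carr A. \<forall>z\<in>carr A. mul A x (add A y z) = add A (mul A x y) (mul A x z)) \<and>
     (\<forall>c. \<forall>x\<in>carr A. \<forall>y\<in>carr A. mul A (smul A c x) y = smul A c (mul A x y)) \<and>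
     (\<forall>c. \<forall>x\<in>carr A. \<forall>y\<in>carr A. mul A x (smul A c y) = smul A c (mul A x y)) \<and>
     (\<forall>x\<in>carr A. \<forall>y\<in>carr A. nrm A (mul A x y) \<le> nrm A x * nrm A y)"

definition left_bmodule ::
  "('b,'m) balg_scheme \<Rightarrow> ('e,'n) bspace_scheme \<Rightarrow> ('b \<Rightarrow> 'e \<Rightarrow> 'e) \<Rightarrow> bool" where
  "left_bmodule B E act \<longleftrightarrow> banach_space E \<and>
     (\<forall>b\<in>carr B. \<forall>e\<in>carr E. act b e \<in> carr E) \<and>
     (\<forall>b\<in>carr B. \<forall>b'\<in>carr B. \<forall>e\<in>carr E. act (add B b b') e = add E (act b e) (act b' e)) \<and>
     (\<forall>b\<in>carr B. \<forall>e\<in>carr E. \<forall>e'\<in>carr E. act b (add E e e') = add E (act b e) (act b e')) \<and>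
     (\<forall>c. \<forall>b\<in>carr B. \<forall>e\<in>carr E. act (smul B c b) e = smul E c (act b e)) \<and>
     (\<forall>c. \<forall>b\<in>carr B. \<forall>e\<in>carr E. act b (smul E c e) = smul E c (act b e)) \<and>
     (\<forall>b\<in>carr B. \<forall>b'\<in>carr B. \<forall>e\<in>carr E. act (mul B b b') e = act b (act b' e)) \<and>
     (\<forall>b\<in>carr B. \<forall>e\<in>carr E. nrm E (act b e) \<le> nrm B b * nrm E e)"

definition right_bmodule ::
  "('b,'m) balg_scheme \<Rightarrow> ('e,'n) bspace_scheme \<Rightarrow> ('e \<Rightarrow> 'b \<Rightarrow> 'e) \<Rightarrow> bool" where
  "right_bmodule B E act \<longleftrightarrow> banach_space E \<and>
     (\<forall>b\<in>carr B. \<forall>e\<in>carr E. act e b \<in> carr E) \<and>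
     (\<forall>b\<in>carr B. \<forall>b'\<in>carr B. \<forall>e\<in>carr E. act e (add B b b') = add E (act e b) (act e b')) \<and>
     (\<forall>b\<in>carr B. \<forall>e\<in>carr E. \<forall>e'\<in>carr E. act (add E e e') b = add E (act e b) (act e' b)) \<and>
     (\<forall>c. \<forall>b\<in>carr B. \<forall>e\<in>carr E. act e (smul B c b) = smul E c (act e b)) \<and>
     (\<forall>c. \<forall>b\<in>carr B. \<forall>e\<in>carr E. act (smul E c e) b = smul E c (act e b)) \<and>
     (\<forall>b\<in>carr B. \<forall>b'\<in>carr B. \<forall>e\<in>carr E. act e (mul B b b') = act (act e b) b') \<and>
     (\<forall>b\<in>carr B. \<forall>e\<in>carr E. nrm E (act e b) \<le> nrm B b * nrm E e)"

definition banach_pair ::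
  "('b,'m) balg_scheme \<Rightarrow> ('l,'n) bspace_scheme \<Rightarrow> ('r,'k) bspace_scheme \<Rightarrow>
   ('b \<Rightarrow> 'l \<Rightarrow> 'l) \<Rightarrow> ('r \<Rightarrow> 'b \<Rightarrow> 'r) \<Rightarrow> ('l \<Rightarrow> 'r \<Rightarrow> 'b) \<Rightarrow> bool" where
  "banach_pair B El Er lB rB pr \<longleftrightarrow>
     left_bmodule B El lB \<and> right_bmodule B Er rB \<and>
     (\<forall>e\<in>carr El. \<forall>f\<in>carr Er. pr e f \<in> carr B) \<and>
     (\<forall>e\<in>carr El. \<forall>e'\<in>carr El. \<forall>f\<in>carr Er. pr (add El e e') f = add B (pr e f) (pr e' f)) \<and>
     (\<forall>e\<in>carr El. \<forall>f\<in>carr Er. \<forall>f'\<in>carr Er. pr e (add Er f f') = add B (pr e f) (pr e f')) \<and>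
     (\<forall>c. \<forall>e\<in>carr El. \<forall>f\<in>carr Er. pr (smul El c e) f = smul B c (pr e f)) \<and>
     (\<forall>c. \<forall>e\<in>carr El. \<forall>f\<in>carr Er. pr e (smul Er c f) = smul B c (pr e f)) \<and>
     (\<forall>b\<in>carr B. \<forall>e\<in>carr El. \<forall>f\<in>carr Er. pr (lB b e) f = mul B b (pr e f)) \<and>
     (\<forall>b\<in>carr B. \<forall>e\<in>carr El. \<forall>f\<in>carr Er. pr e (rB f b) = mul B (pr e f) b) \<and>
     (\<forall>e\<in>carr El. \<forall>f\<in>carr Er. nrm B (pr e f) \<le> nrm El e * nrm Er f)"

text \<open>Banach A-B-pair: a Banach B-pair together with a contractive homomorphism
  A \<rightarrow> L_B(E), i.e. E^< is a Banach B-A-bimodule (right A-action rA), E^> a Banach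
  A-B-bimodule (left A-action lA), and pr (e a) f = pr e (a f).\<close>
definition ab_pair ::
  "('a,'j) balg_scheme \<Rightarrow> ('b,'m) balg_scheme \<Rightarrow> ('l,'n) bspace_scheme \<Rightarrow> ('r,'k) bspace_scheme \<Rightarrow>
   ('b \<Rightarrow> 'l \<Rightarrow> 'l) \<Rightarrow> ('r \<Rightarrow> 'b \<Rightarrow> 'r) \<Rightarrow> ('l \<Rightarrow> 'a \<Rightarrow> 'l) \<Rightarrow> ('a \<Rightarrow> 'r \<Rightarrow> 'r) \<Rightarrow>
   ('l \<Rightarrow> 'r \<Rightarrow> 'b) \<Rightarrow> bool" where
  "ab_pair A B El Er lB rB rA lA pr \<longleftrightarrow>
     banach_pair B El Er lB rB pr \<and>
     right_bmodule A El rA \<and> left_bmodule A Er lA \<and>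
     (\<forall>a\<in>carr A. \<forall>b\<in>carr B. \<forall>e\<in>carr El. lB b (rA e a) = rA (lB b e) a) \<and>
     (\<forall>a\<in>carr A. \<forall>b\<in>carr B. \<forall>f\<in>carr Er. lA a (rB f b) = rB (lA a f) b) \<and>
     (\<forall>a\<in>carr A. \<forall>e\<in>carr El. \<forall>f\<in>carr Er. pr (rA e a) f = pr e (lA a f))"

fun lincomb :: "('x,'m) bspace_scheme \<Rightarrow> (nat \<Rightarrow> complex) \<Rightarrow> (nat \<Rightarrow> 'x) \<Rightarrow> nat \<Rightarrow> 'x" where
  "lincomb V c s 0 = zer V"
| "lincomb V c s (Suc n) = add V (lincomb V c s n) (smul V (c n) (s n))"

definition gspan :: "('x,'m) bspace_scheme \<Rightarrow> 'x set \<Rightarrow> 'x set" where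
  "gspan V S = {lincomb V c s n | c s n. \<forall>i<n. s i \<in> S}"

definition span_dense :: "('x,'m) bspace_scheme \<Rightarrow> 'x set \<Rightarrow> bool" where
  "span_dense V S \<longleftrightarrow> (\<forall>x\<in>carr V. \<forall>e>0. \<exists>y\<in>gspan V S. nrm V (vdiff V x y) < e)"

definition morita_equivalence ::
  "('a,'j) balg_scheme \<Rightarrow> ('b,'m) balg_scheme \<Rightarrow> ('l,'n) bspace_scheme \<Rightarrow> ('r,'k) bspace_scheme \<Rightarrow>
   ('b \<Rightarrow> 'l \<Rightarrow> 'l) \<Rightarrow> ('r \<Rightarrow> 'b \<Rightarrow> 'r) \<Rightarrow> ('l \<Rightarrow> 'a \<Rightarrow> 'l) \<Rightarrow> ('a \<Rightarrow> 'r \<Rightarrow> 'r) \<Rightarrow>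
   ('l \<Rightarrow> 'r \<Rightarrow> 'b) \<Rightarrow> ('r \<Rightarrow> 'l \<Rightarrow> 'a) \<Rightarrow> bool" where
  "morita_equivalence A B El Er lB rB rA lA prB prA \<longleftrightarrow>
     banach_algebra A \<and> banach_algebra B \<and>
     ab_pair A B El Er lB rB rA lA prB \<and>
     ab_pair B A Er El lA rA rB lB prA \<and>
     (\<forall>e\<in>carr El. \<forall>f\<in>carr Er. \<forall>g\<in>carr El. lB (prB e f) g = rA e (prA f g)) \<and>
     (\<forall>f\<in>carr Er. \<forall>g\<in>carr El. \<forall>h\<in>carr Er. rB f (prB g h) = lA (prA f g) h) \<and>
     span_dense El {lB b e | b e. b \<in> carr B \<and> e \<in> carr El} \<and>
     span_dense Er {rB f b | f b. f \<in> carr Er \<and> b \<in> carr B} \<and>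
     span_dense B {prB e f | e f. e \<in> carr El \<and> f \<in> carr Er} \<and>
     span_dense Er {lA a f | a f. a \<in> carr A \<and> f \<in> carr Er} \<and>
     span_dense El {rA e a | e a. e \<in> carr El \<and> a \<in> carr A} \<and>
     span_dense A {prA f e | f e. f \<in> carr Er \<and> e \<in> carr El}"

definition morita_equivalent_via ::
  "'l itself \<Rightarrow> 'r itself \<Rightarrow> ('a,'j) balg_scheme \<Rightarrow> ('b,'m) balg_scheme \<Rightarrow> bool" where
  "morita_equivalent_via _ _ A B \<longleftrightarrow>
     (\<exists>(El :: 'l bspace) (Er :: 'r bspace) lB rB rA lA prB prA.
        morita_equivalence A B El Er lB rB rA lA prB prA)"

definition lp :: "real \<Rightarrow> ('i \<Rightarrow> complex) set" where
  "lp p = {f. (\<lambda>i. norm (f i) powr p) summable_on UNIV}"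

definition lpnorm :: "real \<Rightarrow> ('i \<Rightarrow> complex) \<Rightarrow> real" where
  "lpnorm p f = (\<Sum>\<^sub>\<infinity>i. norm (f i) powr p) powr (1 / p)"

definition lp_space :: "real \<Rightarrow> ('i \<Rightarrow> complex) bspace" where
  "lp_space p = \<lparr> carr = lp p, add = (\<lambda>f g i. f i + g i), smul = (\<lambda>c f i. c * f i),
                  zer = (\<lambda>i. 0), nrm = lpnorm p \<rparr>"

definition lpv :: "real \<Rightarrow> ('a \<Rightarrow> nat \<Rightarrow> complex) set" where
  "lpv p = {f. (\<forall>x. f x \<in> lp p) \<and> (\<lambda>x. lpnorm p (f x) powr p) summable_on UNIV}"

definition lpvnorm :: "real \<Rightarrow> ('a \<Rightarrow> nat \<Rightarrow> complex) \<Rightarrow> real" where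
  "lpvnorm p f = (\<Sum>\<^sub>\<infinity>x. lpnorm p (f x) powr p) powr (1 / p)"

definition lpv_space :: "real \<Rightarrow> ('a \<Rightarrow> nat \<Rightarrow> complex) bspace" where
  "lpv_space p = \<lparr> carr = lpv p, add = (\<lambda>f g x k. f x k + g x k),
                   smul = (\<lambda>c f x k. c * f x k), zer = (\<lambda>x k. 0), nrm = lpvnorm p \<rparr>"

text \<open>Bounded linear operators V \<rightarrow> W, represented canonically as functions that
  vanish (map to the zero vector) outside the carrier of V.\<close>
definition bop :: "'v bspace \<Rightarrow> 'w bspace \<Rightarrow> ('v \<Rightarrow> 'w) set" where
  "bop V W = {T. (\<forall>f\<in>carr V. T f \<in> carr W) \<and>
                 (\<forall>f\<in>carr V. \<forall>g\<in>carr V. T (add V f g) = add W (T f) (T g)) \<and>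
                 (\<forall>c. \<forall>f\<in>carr V. T (smul V c f) = smul W c (T f)) \<and>
                 (\<exists>C. \<forall>f\<in>carr V. nrm W (T f) \<le> C * nrm V f) \<and>
                 (\<forall>f. f \<notin> carr V \<longrightarrow> T f = zer W)}"

definition opnorm :: "'v bspace \<Rightarrow> 'w bspace \<Rightarrow> ('v \<Rightarrow> 'w) \<Rightarrow> real" where
  "opnorm V W T = (SUP f\<in>{f\<in>carr V. nrm V f \<le> 1}. nrm W (T f))"

definition op_alg :: "'v bspace \<Rightarrow> ('v \<Rightarrow> 'v) set \<Rightarrow> ('v \<Rightarrow> 'v) balg" where
  "op_alg V S = \<lparr> carr = S,
     add = (\<lambda>T T' f. if f \<in> carr V then add V (T f) (T' f) else zer V),
     smul = (\<lambda>c T f. if f \<in> carr V then smul V c (T f) else zer V),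
     zer = (\<lambda>f. zer V),
     nrm = opnorm V V,
     mul = (\<lambda>T T'. T \<circ> T') \<rparr>"

definition op_closure :: "'v bspace \<Rightarrow> ('v \<Rightarrow> 'v) set \<Rightarrow> ('v \<Rightarrow> 'v) set" where
  "op_closure V S = {T \<in> bop V V. \<forall>e>0. \<exists>T'\<in>S. opnorm V V (vdiff (op_alg V S) T T') < e}"

definition bounded_geometry :: "'a::metric_space set \<Rightarrow> bool" where
  "bounded_geometry X \<longleftrightarrow>
     (\<forall>R\<ge>0. \<exists>N::nat. \<forall>x\<in>X. finite (cball x R \<inter> X) \<and> card (cball x R \<inter> X) \<le> N)"

definition mat_coeff :: "(('a \<Rightarrow> complex) \<Rightarrow> ('a \<Rightarrow> complex)) \<Rightarrow> 'a \<Rightarrow> 'a \<Rightarrow> complex" where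
  "mat_coeff T x y = T (\<lambda>z. if z = y then 1 else 0) x"

definition mat_coeff_v ::
  "(('a \<Rightarrow> nat \<Rightarrow> complex) \<Rightarrow> ('a \<Rightarrow> nat \<Rightarrow> complex)) \<Rightarrow> 'a \<Rightarrow> 'a \<Rightarrow> (nat \<Rightarrow> complex) \<Rightarrow> (nat \<Rightarrow> complex)" where
  "mat_coeff_v T x y v = T (\<lambda>z. if z = y then v else (\<lambda>k. 0)) x"

definition rank_le :: "real \<Rightarrow> ((nat \<Rightarrow> complex) \<Rightarrow> (nat \<Rightarrow> complex)) \<Rightarrow> nat \<Rightarrow> bool" where
  "rank_le p S N \<longleftrightarrow> (\<exists>s :: nat \<Rightarrow> nat \<Rightarrow> complex. \<forall>v\<in>lp p. \<exists>c :: nat \<Rightarrow> complex.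
                          S v = (\<lambda>k. \<Sum>i<N. c i * s i k))"

definition Cpu :: "real \<Rightarrow> (('a::metric_space \<Rightarrow> complex) \<Rightarrow> ('a \<Rightarrow> complex)) set" where
  "Cpu p = {T \<in> bop (lp_space p) (lp_space p).
              \<exists>R. \<forall>x y. mat_coeff T x y \<noteq> 0 \<longrightarrow> dist x y \<le> R}"

definition Bpu :: "real \<Rightarrow> (('a::metric_space \<Rightarrow> complex) \<Rightarrow> ('a \<Rightarrow> complex)) balg" where
  "Bpu p = op_alg (lp_space p) (op_closure (lp_space p) (Cpu p))"

definition UCp :: "real \<Rightarrow> (('a::metric_space \<Rightarrow> nat \<Rightarrow> complex) \<Rightarrow> ('a \<Rightarrow> nat \<Rightarrow> complex)) set" where
  "UCp p = {T \<in> bop (lpv_space p) (lpv_space p).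
              (\<exists>R. \<forall>x y. (\<exists>v\<in>lp p. mat_coeff_v T x y v \<noteq> (\<lambda>k. 0)) \<longrightarrow> dist x y \<le> R) \<and>
              (\<exists>N::nat. \<forall>x y. rank_le p (mat_coeff_v T x y) N)}"

definition UBp :: "real \<Rightarrow> (('a::metric_space \<Rightarrow> nat \<Rightarrow> complex) \<Rightarrow> ('a \<Rightarrow> nat \<Rightarrow> complex)) balg" where
  "UBp p = op_alg (lpv_space p) (op_closure (lpv_space p) (UCp p))"

end

theory Submission
  imports Defs
begin

text \<open>The equivalence bimodules are the closures of the finite-propagation operators
  \<open>\<ell>\<^sup>p(X) \<rightarrow> \<ell>\<^sup>p(X, \<ell>\<^sup>p)\<close> and \<open>\<ell>\<^sup>p(X, \<ell>\<^sup>p) \<rightarrow> \<ell>\<^sup>p(X)\<close>, and all actions and pairings are composition. Tensoring with a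
  basis vector of \<open>\<ell>\<^sup>p\<close> and evaluating at its coordinate gives \<open>e\<^sub>0\<close>, \<open>f\<^sub>0\<close> with \<open>f\<^sub>0 e\<^sub>0 = 1\<close>, so every
  element factors as needed for nondegeneracy and for fullness over the uniform Roe algebra.
  For fullness over the uniform algebra let \<open>T\<close> have finite propagation and matrix entries of
  bounded rank. By bounded geometry the vectors \<open>(T h)(x)\<close> span a space of dimension at most \<open>M\<close>,
  uniformly in \<open>x\<close>. Such a space has a basis of vectors of norm at most 1 whose coordinate functionals are
  bounded in terms of \<open>M\<close> alone, and expanding \<open>(T h)(x)\<close> in these bases writes \<open>T\<close> as a sum of \<open>M\<close>
  products from the two bimodules.

  Propagation at most \<open>R\<close> is used in the coordinate-free form ``if \<open>f\<close> vanishes on the ball of radius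
  \<open>R\<close> about \<open>x\<close>, then \<open>(T f)(x) = 0\<close>'', which is visibly stable under composition; since \<open>p < \<infinity>\<close>,
  truncation shows that it is equivalent to the condition on matrix entries.\<close>

section \<open>Banach spaces as records\<close>

text \<open>The difficulty is uniformity in \<open>x\<close>. An arbitrary basis of the span of the
  vectors \<open>(T h)(x)\<close> expands each single value, but the norms of its coordinate
  functionals may blow up as \<open>x\<close> varies, and then the resulting operators into
  \<open>\<ell>\<^sup>p(X)\<close> are unbounded. The coordinate bound \<open>2 * 3 ^ N\<close>
  depends on the number of spanning vectors alone, whatever the subspace; together with basis
  vectors of norm at most 1 it makes both factors of each product bounded.

  Both underlying spaces are \<open>lp\<close>-sums of copies of a Banach space, with fibre the
  complex numbers or \<open>lp\<close>, so propagation is treated once for arbitrary fibres.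
  Algebras and bimodules are closures of operator classes under composition; once contractive
  bilinear maps are extended to closures, the algebraic axioms amount to associativity.

  Bounded geometry enters twice, each time to turn ranks of matrix entries into ranks of whole rows:
  in describing the dense subalgebra of the uniform algebra, and in showing that it contains the
  products of operators from the two bimodules.\<close>

context
  fixes V :: "('x,'m) bspace_scheme"
  assumes V: "banach_space V"
begin

lemma bs_axioms:
  "zer V \<in> carr V"
  "\<forall>x\<in>carr V. \<forall>y\<in>carr V. add V x y \<in> carr V"
  "\<forall>c. \<forall>x\<in>carr V. smul V c x \<in> carr V"
  "\<forall>x\<in>carr V. \<forall>y\<in>carr V. \<forall>z\<in>carr V. add V (add V x y) z = add V x (add V y z)"
  "\<forall>x\<in>carr V. \<forall>y\<in>carr V. add V x y = add V y x"
  "\<forall>x\<in>carr V. add V (zer V) x = x"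
  "\<forall>x\<in>carr V. add V x (smul V (-1) x) = zer V"
  "\<forall>c. \<forall>x\<in>carr V. \<forall>y\<in>carr V. smul V c (add V x y) = add V (smul V c x) (smul V c y)"
  "\<forall>c d. \<forall>x\<in>carr V. smul V (c + d) x = add V (smul V c x) (smul V d x)"
  "\<forall>c d. \<forall>x\<in>carr V. smul V c (smul V d x) = smul V (c * d) x"
  "\<forall>x\<in>carr V. smul V 1 x = x"
  "\<forall>x\<in>carr V. 0 \<le> nrm V x"
  "\<forall>x\<in>carr V. nrm V x = 0 \<longleftrightarrow> x = zer V"
  "\<forall>c. \<forall>x\<in>carr V. nrm V (smul V c x) = norm c * nrm V x"
  "\<forall>x\<in>carr V. \<forall>y\<in>carr V. nrm V (add V x y) \<le> nrm V x + nrm V y"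
  "\<forall>s :: nat \<Rightarrow> 'x. (\<forall>n. s n \<in> carr V) \<longrightarrow> (\<forall>e>0. \<exists>N. \<forall>m\<ge>N. \<forall>n\<ge>N. nrm V (vdiff V (s m) (s n)) < e) \<longrightarrow>
     (\<exists>l\<in>carr V. \<forall>e>0. \<exists>N. \<forall>n\<ge>N. nrm V (vdiff V (s n) l) < e)"
  by (insert V[unfolded banach_space_def], (elim conjE, assumption)+)

lemma
  shows bs_zer [simp]: "zer V \<in> carr V"
    and bs_add [simp]: "x \<in> carr V \<Longrightarrow> y \<in> carr V \<Longrightarrow> add V x y \<in> carr V"
    and bs_smul [simp]: "x \<in> carr V \<Longrightarrow> smul V c x \<in> carr V"
    and bs_assoc: "x \<in> carr V \<Longrightarrow> y \<in> carr V \<Longrightarrow> z \<in> carr V \<Longrightarrow> add V (add V x y) z = add V x (add V y z)"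
    and bs_comm: "x \<in> carr V \<Longrightarrow> y \<in> carr V \<Longrightarrow> add V x y = add V y x"
    and bs_zer_add [simp]: "x \<in> carr V \<Longrightarrow> add V (zer V) x = x"
    and bs_add_neg [simp]: "x \<in> carr V \<Longrightarrow> add V x (smul V (-1) x) = zer V"
    and bs_smul_add: "x \<in> carr V \<Longrightarrow> y \<in> carr V \<Longrightarrow> smul V c (add V x y) = add V (smul V c x) (smul V c y)"
    and bs_add_smul: "x \<in> carr V \<Longrightarrow> smul V (c + d) x = add V (smul V c x) (smul V d x)"
    and bs_smul_smul [simp]: "x \<in> carr V \<Longrightarrow> smul V c (smul V d x) = smul V (c * d) x"
    and bs_smul_1 [simp]: "x \<in> carr V \<Longrightarrow> smul V 1 x = x"
    and bs_nrm_nonneg [simp]: "x \<in> carr V \<Longrightarrow> 0 \<le> nrm V x"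
    and bs_nrm_eq_0 [simp]: "x \<in> carr V \<Longrightarrow> nrm V x = 0 \<longleftrightarrow> x = zer V"
    and bs_nrm_smul [simp]: "x \<in> carr V \<Longrightarrow> nrm V (smul V c x) = norm c * nrm V x"
    and bs_nrm_add: "x \<in> carr V \<Longrightarrow> y \<in> carr V \<Longrightarrow> nrm V (add V x y) \<le> nrm V x + nrm V y"
  subgoal using bs_axioms(1) by blast
  subgoal using bs_axioms(2) by blast
  subgoal using bs_axioms(3) by blast
  subgoal using bs_axioms(4) by blast
  subgoal using bs_axioms(5) by blast
  subgoal using bs_axioms(6) by blast
  subgoal using bs_axioms(7) by blast
  subgoal using bs_axioms(8) by blast
  subgoal using bs_axioms(9) by blast
  subgoal using bs_axioms(10) by blast
  subgoal using bs_axioms(11) by blast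
  subgoal using bs_axioms(12) by blast
  subgoal using bs_axioms(13) by blast
  subgoal using bs_axioms(14) by blast
  subgoal using bs_axioms(15) by blast
  done

lemma bs_add_zer [simp]: "x \<in> carr V \<Longrightarrow> add V x (zer V) = x"
  using bs_comm[of x "zer V"] by simp

lemma bs_nrm_zer [simp]: "nrm V (zer V) = 0"
  by simp

lemma bs_smul_0 [simp]: "x \<in> carr V \<Longrightarrow> smul V 0 x = zer V"
  using bs_add_smul[of x 1 "-1"] by simp

lemma bs_smul_zer [simp]: "smul V c (zer V) = zer V"
  using bs_smul_smul[of "zer V" c 0] by simp

lemma bs_vdiff [simp]: "\<lbrakk>x \<in> carr V; y \<in> carr V\<rbrakk> \<Longrightarrow> vdiff V x y \<in> carr V"
  by (simp add: vdiff_def)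

lemma bs_vdiff_zer [simp]: "x \<in> carr V \<Longrightarrow> vdiff V x (zer V) = x"
  by (simp add: vdiff_def)

lemma bs_add_add:
  assumes "a \<in> carr V" "b \<in> carr V" "c \<in> carr V" "d \<in> carr V"
  shows "add V (add V a b) (add V c d) = add V (add V a c) (add V b d)"
proof -
  have "add V b (add V c d) = add V c (add V b d)"
    using assms bs_assoc[of b c d] bs_assoc[of c b d] bs_comm[of b c] by simp
  then show ?thesis
    using assms by (simp add: bs_assoc)
qed

lemma bs_vdiff_add:
  assumes "a \<in> carr V" "b \<in> carr V" "c \<in> carr V" "d \<in> carr V"
  shows "vdiff V (add V a b) (add V c d) = add V (vdiff V a c) (vdiff V b d)"
  using assms by (simp add: vdiff_def bs_smul_add bs_add_add)

lemma bs_vdiff_smul: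
  assumes "a \<in> carr V" "b \<in> carr V"
  shows "vdiff V (smul V c a) (smul V c b) = smul V c (vdiff V a b)"
  using assms by (simp add: vdiff_def bs_smul_add)

lemma bs_vdiff_trans:
  assumes "x \<in> carr V" "y \<in> carr V" "z \<in> carr V"
  shows "vdiff V x z = add V (vdiff V x y) (vdiff V y z)"
proof -
  have "add V (smul V (-1) y) (add V y (smul V (-1) z)) = add V (add V y (smul V (-1) y)) (smul V (-1) z)"
    using assms bs_assoc[of "smul V (-1) y" y] bs_comm[of "smul V (-1) y" y] by simp
  then show ?thesis
    using assms by (simp add: vdiff_def bs_assoc)
qed

lemma bs_vdiff_commute:
  assumes "x \<in> carr V" "y \<in> carr V"
  shows "vdiff V y x = smul V (-1) (vdiff V x y)"
  using assms by (simp add: vdiff_def bs_smul_add bs_comm)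

lemma bs_nrm_vdiff_commute:
  assumes "x \<in> carr V" "y \<in> carr V"
  shows "nrm V (vdiff V y x) = nrm V (vdiff V x y)"
  using assms by (simp add: bs_vdiff_commute[OF assms])

lemma bs_nrm_vdiff_trans:
  assumes "x \<in> carr V" "y \<in> carr V" "z \<in> carr V"
  shows "nrm V (vdiff V x z) \<le> nrm V (vdiff V x y) + nrm V (vdiff V y z)"
  using assms by (simp add: bs_vdiff_trans[OF assms] bs_nrm_add)

lemma bs_nrm_le_vdiff:
  assumes "x \<in> carr V" "y \<in> carr V"
  shows "nrm V x \<le> nrm V (vdiff V x y) + nrm V y"
  using bs_nrm_vdiff_trans[of x y "zer V"] assms by simp

lemma bs_vdiff_cancel:
  assumes "x \<in> carr V" "y \<in> carr V"
  shows "add V (vdiff V x y) y = x"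
  using bs_vdiff_trans[of x y "zer V"] assms by simp

lemma bs_vdiff_self [simp]: "x \<in> carr V \<Longrightarrow> vdiff V x x = zer V"
  by (simp add: vdiff_def)

lemma bs_vdiff_eq_zer:
  assumes "x \<in> carr V" "y \<in> carr V" "vdiff V x y = zer V"
  shows "x = y"
  using bs_vdiff_cancel[of x y] assms by simp

lemma bs_complete:
  assumes "\<And>n. s n \<in> carr V"
    and "\<And>e. e > 0 \<Longrightarrow> \<exists>N. \<forall>m\<ge>N. \<forall>n\<ge>N. nrm V (vdiff V (s m) (s n)) < e"
  obtains l where "l \<in> carr V" "(\<lambda>n. nrm V (vdiff V (s n) l)) \<longlonglongrightarrow> 0"
proof -
  obtain l where l: "l \<in> carr V" "\<forall>e>0. \<exists>N. \<forall>n\<ge>N. nrm V (vdiff V (s n) l) < e"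
    using bs_axioms(16)[rule_format, of s] assms by metis
  then have "(\<lambda>n. nrm V (vdiff V (s n) l)) \<longlonglongrightarrow> 0"
    using assms(1) by (intro LIMSEQ_I) auto
  with l(1) that show ?thesis by blast
qed

lemma bs_lim_unique:
  assumes "\<And>n. s n \<in> carr V" "l \<in> carr V" "l' \<in> carr V"
    and "(\<lambda>n. nrm V (vdiff V (s n) l)) \<longlonglongrightarrow> 0" "(\<lambda>n. nrm V (vdiff V (s n) l')) \<longlonglongrightarrow> 0"
  shows "l = l'"
proof -
  have "(\<lambda>n. nrm V (vdiff V (s n) l) + nrm V (vdiff V (s n) l')) \<longlonglongrightarrow> 0"
    using tendsto_add[OF assms(4,5)] by simp
  moreover have "nrm V (vdiff V l l') \<le> nrm V (vdiff V (s n) l) + nrm V (vdiff V (s n) l')" for n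
    using bs_nrm_vdiff_trans[of l "s n" l'] bs_nrm_vdiff_commute[of "s n" l] assms(1-3) by simp
  ultimately have "nrm V (vdiff V l l') \<le> 0"
    by (meson LIMSEQ_le_const)
  then have "nrm V (vdiff V l l') = 0"
    using assms(2,3) by (meson bs_nrm_nonneg bs_vdiff order_antisym)
  then show ?thesis
    using assms(2,3) bs_vdiff_eq_zer by simp
qed

lemma bs_nrm_lim_le:
  assumes "\<And>n. s n \<in> carr V" "l \<in> carr V" "(\<lambda>n. nrm V (vdiff V (s n) l)) \<longlonglongrightarrow> 0"
    and "\<And>n. n \<ge> N \<Longrightarrow> nrm V (s n) \<le> C"
  shows "nrm V l \<le> C"
proof -
  have "nrm V l - C \<le> nrm V (vdiff V (s n) l)" if "n \<ge> N" for n
    using bs_nrm_le_vdiff[of l "s n"] bs_nrm_vdiff_commute[of l "s n"] assms(1,2) assms(4)[OF that]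
    by simp
  then have "nrm V l - C \<le> 0"
    by (intro LIMSEQ_le_const[OF assms(3)]) blast
  then show ?thesis by simp
qed

text \<open>Lets a Cauchy estimate on \<open>vdiff V (s m) (s n)\<close> pass to the limit in
  \<open>n\<close> with \<open>m\<close> fixed; both completeness proofs below rest on this.\<close>

lemma bs_lim_vdiff_const:
  assumes "\<And>n. s n \<in> carr V" "l \<in> carr V" "x \<in> carr V" "(\<lambda>n. nrm V (vdiff V (s n) l)) \<longlonglongrightarrow> 0"
  shows "(\<lambda>n. nrm V (vdiff V (vdiff V x (s n)) (vdiff V x l))) \<longlonglongrightarrow> 0"
proof -
  have "vdiff V (vdiff V x (s n)) (vdiff V x l) = smul V (-1) (vdiff V (s n) l)" for n
  proof -
    have "vdiff V (vdiff V x (s n)) (vdiff V x l)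
        = add V (vdiff V x x) (vdiff V (smul V (-1) (s n)) (smul V (-1) l))"
      unfolding vdiff_def[of V x "s n"] vdiff_def[of V x l]
      by (rule bs_vdiff_add) (use assms in auto)
    also have "\<dots> = smul V (-1) (vdiff V (s n) l)"
      using assms by (simp add: bs_vdiff_smul)
    finally show ?thesis .
  qed
  then show ?thesis
    using assms by simp
qed

end

section \<open>Closures of subspaces and extension of bilinear maps to them\<close>

definition closure_in :: "('x,'m) bspace_scheme \<Rightarrow> 'x set \<Rightarrow> 'x set" where
  "closure_in V S = {x \<in> carr V. \<forall>e>0. \<exists>y\<in>S. nrm V (vdiff V x y) < e}"

definition subspace_in :: "('x,'m) bspace_scheme \<Rightarrow> 'x set \<Rightarrow> bool" where
  "subspace_in V S \<longleftrightarrow> S \<subseteq> carr V \<and> zer V \<in> S \<and>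
     (\<forall>x\<in>S. \<forall>y\<in>S. add V x y \<in> S) \<and> (\<forall>c. \<forall>x\<in>S. smul V c x \<in> S)"

lemma subset_closure_in:
  assumes "banach_space V" "S \<subseteq> carr V"
  shows "S \<subseteq> closure_in V S"
proof
  fix x assume x: "x \<in> S"
  then have xV: "x \<in> carr V" using assms by blast
  then have "nrm V (vdiff V x x) = 0"
    using assms(1) by (simp add: bs_nrm_zer bs_vdiff_self)
  then have "\<exists>y\<in>S. nrm V (vdiff V x y) < e" if "e > 0" for e
    using x that by (intro bexI[of _ x]) auto
  then show "x \<in> closure_in V S"
    using xV by (simp add: closure_in_def)
qed

lemma banach_space_closure_in:
  assumes V: "banach_space V" and S: "subspace_in V S"
  shows "banach_space (V\<lparr>carr := closure_in V S\<rparr>)"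
proof -
  note [simp] = bs_zer[OF V] bs_add[OF V] bs_smul[OF V] bs_vdiff[OF V] bs_nrm_nonneg[OF V]
  let ?C = "closure_in V S"
  have SV: "S \<subseteq> carr V" using S by (simp add: subspace_in_def)
  then have SC: "S \<subseteq> ?C" by (rule subset_closure_in[OF V])
  have sub: "?C \<subseteq> carr V" by (auto simp: closure_in_def)
  have approx: "\<exists>y\<in>S. nrm V (vdiff V x y) < e" if "x \<in> ?C" "e > 0" for x e
    using that by (auto simp: closure_in_def)
  have zer: "zer V \<in> ?C" using S SC by (auto simp: subspace_in_def)
  have add: "add V x y \<in> ?C" if x: "x \<in> ?C" and y: "y \<in> ?C" for x y
  proof -
    have "\<exists>z\<in>S. nrm V (vdiff V (add V x y) z) < e" if "e > 0" for e
    proof -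
      obtain x' y' where *: "x' \<in> S" "nrm V (vdiff V x x') < e/2" "y' \<in> S" "nrm V (vdiff V y y') < e/2"
        using approx[OF x, of "e/2"] approx[OF y, of "e/2"] \<open>e > 0\<close> by auto
      have c: "x \<in> carr V" "y \<in> carr V" "x' \<in> carr V" "y' \<in> carr V"
        using * x y sub SV by auto
      have "nrm V (vdiff V (add V x y) (add V x' y')) \<le> nrm V (vdiff V x x') + nrm V (vdiff V y y')"
        using c by (simp add: bs_vdiff_add[OF V] bs_nrm_add[OF V])
      with * have "nrm V (vdiff V (add V x y) (add V x' y')) < e" by simp
      then show ?thesis using * S by (auto simp: subspace_in_def)
    qed
    then show ?thesis using x y sub by (auto simp: closure_in_def)
  qed
  have smul: "smul V c x \<in> ?C" if x: "x \<in> ?C" for c x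
  proof -
    have "\<exists>z\<in>S. nrm V (vdiff V (smul V c x) z) < e" if "e > 0" for e
    proof -
      \<comment> \<open>Dividing by \<open>norm c + 1\<close> instead of \<open>norm c\<close>
        covers the case \<open>c = 0\<close>.\<close>
      obtain x' where *: "x' \<in> S" "nrm V (vdiff V x x') < e / (norm c + 1)"
        using approx[OF x, of "e / (norm c + 1)"] \<open>e > 0\<close> by (metis add.commute add_strict_increasing
            divide_pos_pos norm_ge_zero zero_less_one)
      have c: "x \<in> carr V" "x' \<in> carr V"
        using * x sub SV by auto
      have "nrm V (vdiff V (smul V c x) (smul V c x')) = norm c * nrm V (vdiff V x x')"
        using c by (simp add: bs_vdiff_smul[OF V] bs_nrm_smul[OF V])
      also have "\<dots> \<le> (norm c + 1) * nrm V (vdiff V x x')"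
        using c by (intro mult_right_mono) auto
      also have "\<dots> < e"
        using *(2) by (simp add: pos_less_divide_eq add_nonneg_pos mult.commute)
      finally show ?thesis using * S by (auto simp: subspace_in_def)
    qed
    then show ?thesis using x sub by (auto simp: closure_in_def)
  qed
  have complete: "\<exists>l\<in>?C. \<forall>e>0. \<exists>N. \<forall>n\<ge>N. nrm V (vdiff V (s n) l) < e"
    if s: "\<forall>n. s n \<in> ?C" and cau: "\<forall>e>0. \<exists>N. \<forall>m\<ge>N. \<forall>n\<ge>N. nrm V (vdiff V (s m) (s n)) < e"
    for s :: "nat \<Rightarrow> 'a"
  proof -
    have sV: "s n \<in> carr V" for n using s sub by auto
    obtain l where l: "l \<in> carr V" "(\<lambda>n. nrm V (vdiff V (s n) l)) \<longlonglongrightarrow> 0"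
      using bs_complete[OF V, of s] sV cau by metis
    have lim: "\<exists>N. \<forall>n\<ge>N. nrm V (vdiff V (s n) l) < e" if "e > 0" for e
      using LIMSEQ_D[OF l(2) that] sV l(1) by simp
    have "\<exists>y\<in>S. nrm V (vdiff V l y) < e" if "e > 0" for e
    proof -
      obtain n where n: "nrm V (vdiff V (s n) l) < e/2" using lim[of "e/2"] \<open>e > 0\<close> by auto
      obtain y where y: "y \<in> S" "nrm V (vdiff V (s n) y) < e/2"
        using approx[of "s n" "e/2"] s \<open>e > 0\<close> by auto
      have "nrm V (vdiff V l y) \<le> nrm V (vdiff V l (s n)) + nrm V (vdiff V (s n) y)"
        using bs_nrm_vdiff_trans[OF V] l(1) sV y(1) SV by blast
      with n y have "nrm V (vdiff V l y) < e"
        using bs_nrm_vdiff_commute[OF V, of l "s n"] l(1) sV by simp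
      with y show ?thesis by blast
    qed
    with l have "l \<in> ?C" by (simp add: closure_in_def)
    with lim show ?thesis by blast
  qed
  have vd: "vdiff (V\<lparr>carr := ?C\<rparr>) = vdiff V"
    by (intro ext) (simp add: vdiff_def)
  note c = subsetD[OF sub]
  show ?thesis
    unfolding banach_space_def vd
    using zer add smul complete
    by (intro conjI)
      (simp_all add: c bs_assoc[OF V] bs_add_neg[OF V] bs_smul_add[OF V] bs_add_smul[OF V]
        bs_smul_smul[OF V] bs_zer_add[OF V] bs_smul_1[OF V] bs_nrm_eq_0[OF V] bs_nrm_smul[OF V]
        bs_nrm_add[OF V], metis c bs_comm[OF V])
qed

text \<open>Products of the algebras, module actions and pairings are all contractive bilinear maps;
  a common predicate allows their extension to closures to be proved once.\<close>

definition bbil ::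
  "('e,'j) bspace_scheme \<Rightarrow> ('f,'m) bspace_scheme \<Rightarrow> ('g,'n) bspace_scheme \<Rightarrow> ('e \<Rightarrow> 'f \<Rightarrow> 'g) \<Rightarrow> bool" where
  "bbil E F G m \<longleftrightarrow>
     (\<forall>e\<in>carr E. \<forall>f\<in>carr F. m e f \<in> carr G) \<and>
     (\<forall>e\<in>carr E. \<forall>e'\<in>carr E. \<forall>f\<in>carr F. m (add E e e') f = add G (m e f) (m e' f)) \<and>
     (\<forall>e\<in>carr E. \<forall>f\<in>carr F. \<forall>f'\<in>carr F. m e (add F f f') = add G (m e f) (m e f')) \<and>
     (\<forall>c. \<forall>e\<in>carr E. \<forall>f\<in>carr F. m (smul E c e) f = smul G c (m e f)) \<and>
     (\<forall>c. \<forall>e\<in>carr E. \<forall>f\<in>carr F. m e (smul F c f) = smul G c (m e f)) \<and>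
     (\<forall>e\<in>carr E. \<forall>f\<in>carr F. nrm G (m e f) \<le> nrm E e * nrm F f)"

lemma bbil_closure_in:
  assumes m: "bbil E F G m" and E: "banach_space E" and F: "banach_space F" and G: "banach_space G"
    and S: "S \<subseteq> carr E" and T: "T \<subseteq> carr F"
    and ST: "\<And>e f. e \<in> S \<Longrightarrow> f \<in> T \<Longrightarrow> m e f \<in> U"
  shows "bbil (E\<lparr>carr := closure_in E S\<rparr>) (F\<lparr>carr := closure_in F T\<rparr>) (G\<lparr>carr := closure_in G U\<rparr>) m"
proof -
  have mc: "m e f \<in> carr G" and
    ml: "e' \<in> carr E \<Longrightarrow> m (add E e e') f = add G (m e f) (m e' f)" and
    mr: "f' \<in> carr F \<Longrightarrow> m e (add F f f') = add G (m e f) (m e f')" and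
    sl: "m (smul E c e) f = smul G c (m e f)" and
    sr: "m e (smul F c f) = smul G c (m e f)" and
    mn: "nrm G (m e f) \<le> nrm E e * nrm F f"
    if "e \<in> carr E" "f \<in> carr F" for e f e' f' c
    using m that unfolding bbil_def by blast+
  have "m e f \<in> closure_in G U" if e: "e \<in> closure_in E S" and f: "f \<in> closure_in F T" for e f
  proof -
    have c: "e \<in> carr E" "f \<in> carr F" using e f by (auto simp: closure_in_def)
    have "\<exists>y\<in>U. nrm G (vdiff G (m e f) y) < r" if "r > 0" for r
    proof -
      define a where "a = nrm F f + 1"
      have a: "a > 0" unfolding a_def using bs_nrm_nonneg[OF F] c by (simp add: add_nonneg_pos)
      obtain e' where e': "e' \<in> S" "nrm E (vdiff E e e') < r / (2 * a)"
        using e \<open>r > 0\<close> a unfolding closure_in_def by (smt (verit) divide_pos_pos mem_Collect_eq)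
      then have ce': "e' \<in> carr E" using S by auto
      \<comment> \<open>The tolerance for \<open>f'\<close> depends on the \<open>e'\<close> already
        chosen, because the second error term is \<open>m e' (f - f')\<close>.\<close>
      define b where "b = nrm E e' + 1"
      have b: "b > 0" unfolding b_def using bs_nrm_nonneg[OF E] ce' by (simp add: add_nonneg_pos)
      obtain f' where f': "f' \<in> T" "nrm F (vdiff F f f') < r / (2 * b)"
        using f \<open>r > 0\<close> b unfolding closure_in_def by (smt (verit) divide_pos_pos mem_Collect_eq)
      then have cf': "f' \<in> carr F" using T by auto
      have "vdiff G (m e f) (m e' f) = m (vdiff E e e') f"
        using c ce' bs_smul[OF E] by (simp add: vdiff_def ml sl)
      then have "nrm G (vdiff G (m e f) (m e' f)) \<le> nrm E (vdiff E e e') * nrm F f"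
        using mn c ce' bs_vdiff[OF E] by simp
      also have "\<dots> \<le> nrm E (vdiff E e e') * a"
        unfolding a_def using bs_nrm_nonneg[OF E] bs_vdiff[OF E] c ce' by (intro mult_left_mono) auto
      also have "\<dots> < r/2" using e'(2) a by (simp add: field_simps)
      finally have 1: "nrm G (vdiff G (m e f) (m e' f)) < r/2" .
      have "vdiff G (m e' f) (m e' f') = m e' (vdiff F f f')"
        using c ce' cf' bs_smul[OF F] by (simp add: vdiff_def mr sr)
      then have "nrm G (vdiff G (m e' f) (m e' f')) \<le> nrm E e' * nrm F (vdiff F f f')"
        using mn c ce' cf' bs_vdiff[OF F] by simp
      also have "\<dots> \<le> b * nrm F (vdiff F f f')"
        unfolding b_def using bs_nrm_nonneg[OF F] bs_vdiff[OF F] c cf' by (intro mult_right_mono) auto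
      also have "\<dots> < r/2" using f'(2) b by (simp add: field_simps)
      finally have 2: "nrm G (vdiff G (m e' f) (m e' f')) < r/2" .
      have "nrm G (vdiff G (m e f) (m e' f')) < r"
        using bs_nrm_vdiff_trans[OF G, of "m e f" "m e' f" "m e' f'"] 1 2 mc c ce' cf' by fastforce
      then show ?thesis using ST e' f' by blast
    qed
    then show ?thesis using mc c by (simp add: closure_in_def)
  qed
  then show ?thesis
    unfolding bbil_def by (simp add: ml mr sl sr mn closure_in_def)
qed

lemma banach_spaceI:
  fixes V :: "('x,'m) bspace_scheme"
  assumes "zer V \<in> carr V"
    "\<And>x y. \<lbrakk>x \<in> carr V; y \<in> carr V\<rbrakk> \<Longrightarrow> add V x y \<in> carr V"
    "\<And>c x. x \<in> carr V \<Longrightarrow> smul V c x \<in> carr V"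
    "\<And>x y z. \<lbrakk>x \<in> carr V; y \<in> carr V; z \<in> carr V\<rbrakk> \<Longrightarrow> add V (add V x y) z = add V x (add V y z)"
    "\<And>x y. \<lbrakk>x \<in> carr V; y \<in> carr V\<rbrakk> \<Longrightarrow> add V x y = add V y x"
    "\<And>x. x \<in> carr V \<Longrightarrow> add V (zer V) x = x"
    "\<And>x. x \<in> carr V \<Longrightarrow> add V x (smul V (-1) x) = zer V"
    "\<And>c x y. \<lbrakk>x \<in> carr V; y \<in> carr V\<rbrakk> \<Longrightarrow> smul V c (add V x y) = add V (smul V c x) (smul V c y)"
    "\<And>c d x. x \<in> carr V \<Longrightarrow> smul V (c + d) x = add V (smul V c x) (smul V d x)"
    "\<And>c d x. x \<in> carr V \<Longrightarrow> smul V c (smul V d x) = smul V (c * d) x"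
    "\<And>x. x \<in> carr V \<Longrightarrow> smul V 1 x = x"
    "\<And>x. x \<in> carr V \<Longrightarrow> 0 \<le> nrm V x"
    "\<And>x. x \<in> carr V \<Longrightarrow> nrm V x = 0 \<longleftrightarrow> x = zer V"
    "\<And>c x. x \<in> carr V \<Longrightarrow> nrm V (smul V c x) = norm c * nrm V x"
    "\<And>x y. \<lbrakk>x \<in> carr V; y \<in> carr V\<rbrakk> \<Longrightarrow> nrm V (add V x y) \<le> nrm V x + nrm V y"
    and complete: "\<And>s :: nat \<Rightarrow> 'x. \<lbrakk>\<And>n. s n \<in> carr V;
        \<And>e. e > 0 \<Longrightarrow> \<exists>N. \<forall>m\<ge>N. \<forall>n\<ge>N. nrm V (vdiff V (s m) (s n)) < e\<rbrakk>
      \<Longrightarrow> \<exists>l\<in>carr V. (\<lambda>n. nrm V (vdiff V (s n) l)) \<longlonglongrightarrow> 0"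
  shows "banach_space V"
proof -
  have lim: "\<exists>l\<in>carr V. \<forall>e>0. \<exists>N. \<forall>n\<ge>N. nrm V (vdiff V (s n) l) < e"
    if s: "\<forall>n. s n \<in> carr V" and cau: "\<forall>e>0. \<exists>N. \<forall>m\<ge>N. \<forall>n\<ge>N. nrm V (vdiff V (s m) (s n)) < e"
    for s :: "nat \<Rightarrow> 'x"
  proof -
    have "\<exists>l\<in>carr V. (\<lambda>n. nrm V (vdiff V (s n) l)) \<longlonglongrightarrow> 0"
      by (rule complete[OF s[rule_format] cau[rule_format]])
    then obtain l where l: "l \<in> carr V" "(\<lambda>n. nrm V (vdiff V (s n) l)) \<longlonglongrightarrow> 0"
      by blast
    have "nrm V (vdiff V (s n) l) \<ge> 0" for n
      using s l(1) by (simp add: vdiff_def assms(2,3,12))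
    then have "\<forall>e>0. \<exists>N. \<forall>n\<ge>N. nrm V (vdiff V (s n) l) < e"
      using LIMSEQ_D[OF l(2)] by simp
    with l(1) show ?thesis by blast
  qed
  show ?thesis
    unfolding banach_space_def
    by (intro conjI allI ballI; (rule assms; assumption)?) (use assms(1) lim in blast)+
qed

section \<open>Spaces of bounded operators\<close>

lemma bopD:
  assumes "T \<in> bop V W"
  shows bop_carr: "f \<in> carr V \<Longrightarrow> T f \<in> carr W"
    and bop_add: "f \<in> carr V \<Longrightarrow> g \<in> carr V \<Longrightarrow> T (add V f g) = add W (T f) (T g)"
    and bop_smul: "f \<in> carr V \<Longrightarrow> T (smul V c f) = smul W c (T f)"
    and bop_out: "f \<notin> carr V \<Longrightarrow> T f = zer W"
  using assms unfolding bop_def by blast+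

lemma bopI:
  assumes "\<And>f. f \<in> carr V \<Longrightarrow> T f \<in> carr W"
    and "\<And>f g. f \<in> carr V \<Longrightarrow> g \<in> carr V \<Longrightarrow> T (add V f g) = add W (T f) (T g)"
    and "\<And>c f. f \<in> carr V \<Longrightarrow> T (smul V c f) = smul W c (T f)"
    and "\<And>f. f \<in> carr V \<Longrightarrow> nrm W (T f) \<le> C * nrm V f"
    and "\<And>f. f \<notin> carr V \<Longrightarrow> T f = zer W"
  shows "T \<in> bop V W"
  using assms unfolding bop_def by blast

lemma bop_bound:
  assumes V: "banach_space V" and "T \<in> bop V W"
  obtains C where "C \<ge> 0" "\<And>f. f \<in> carr V \<Longrightarrow> nrm W (T f) \<le> C * nrm V f"
proof -
  obtain C where C: "\<forall>f\<in>carr V. nrm W (T f) \<le> C * nrm V f"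
    using assms(2) unfolding bop_def by blast
  have "nrm W (T f) \<le> \<bar>C\<bar> * nrm V f" if "f \<in> carr V" for f
    using C[rule_format, OF that] mult_right_mono[OF abs_ge_self[of C] bs_nrm_nonneg[OF V that]] by simp
  then show ?thesis using that[of "\<bar>C\<bar>"] by simp
qed

lemma opnorm_least:
  assumes "banach_space V" "C \<ge> 0" "\<And>f. f \<in> carr V \<Longrightarrow> nrm W (T f) \<le> C * nrm V f"
  shows "opnorm V W T \<le> C"
  unfolding opnorm_def
proof (rule cSUP_least)
  show "{f \<in> carr V. nrm V f \<le> 1} \<noteq> {}"
    using bs_zer[OF assms(1)] bs_nrm_zer[OF assms(1)] by (metis (mono_tags, lifting) empty_iff mem_Collect_eq zero_le_one)
  show "nrm W (T f) \<le> C" if "f \<in> {f \<in> carr V. nrm V f \<le> 1}" for f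
    using assms(3)[of f] that mult_left_mono[of "nrm V f" 1 C] assms(2) by simp
qed

context
  fixes V :: "'v bspace" and W :: "'w bspace"
  assumes V: "banach_space V" and W: "banach_space W"
begin

lemma bop_zer: "T \<in> bop V W \<Longrightarrow> T (zer V) = zer W"
  using bop_smul[of T V W "zer V" 0] V W by (simp add: bop_carr)

text \<open>\<open>opnorm\<close> is a supremum of reals, so \<open>cSUP_upper\<close> applies only
  once the set is known to be bounded.\<close>

lemma bdd_above_unit_ball:
  assumes T: "T \<in> bop V W"
  shows "bdd_above ((\<lambda>f. nrm W (T f)) ` {f \<in> carr V. nrm V f \<le> 1})"
proof -
  obtain C where C: "C \<ge> 0" "\<And>f. f \<in> carr V \<Longrightarrow> nrm W (T f) \<le> C * nrm V f"
    using bop_bound[OF V T] by blast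
  show ?thesis
  proof (rule bdd_aboveI2)
    show "nrm W (T f) \<le> C" if "f \<in> {f \<in> carr V. nrm V f \<le> 1}" for f
      using C(2)[of f] that mult_left_mono[of "nrm V f" 1 C] C(1) by simp
  qed
qed

lemma opnorm_upper:
  assumes T: "T \<in> bop V W" and f: "f \<in> carr V"
  shows "nrm W (T f) \<le> opnorm V W T * nrm V f"
proof (cases "f = zer V")
  case True
  then show ?thesis using V W by (simp add: bop_zer[OF T])
next
  case False
  then have pos: "nrm V f > 0"
    using f V by (simp add: less_le)
  define g where "g = smul V (of_real (1 / nrm V f)) f"
  have g: "g \<in> carr V" "nrm V g = 1"
    unfolding g_def using f V pos by (auto simp: norm_divide)
  have "nrm W (T g) \<le> opnorm V W T"
    unfolding opnorm_def using g by (intro cSUP_upper bdd_above_unit_ball[OF T]) auto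
  moreover have "nrm W (T g) = nrm W (T f) / nrm V f"
    unfolding g_def using f pos W by (simp add: bop_smul[OF T] bop_carr[OF T] norm_divide)
  ultimately show ?thesis using pos by (simp add: field_simps)
qed

lemma opnorm_nonneg: "T \<in> bop V W \<Longrightarrow> 0 \<le> opnorm V W T"
proof -
  assume T: "T \<in> bop V W"
  have "nrm W (T (zer V)) \<le> opnorm V W T"
    unfolding opnorm_def using V by (intro cSUP_upper bdd_above_unit_ball[OF T]) auto
  then show ?thesis using W by (simp add: bop_zer[OF T])
qed

end

text \<open>The two-space version of \<open>op_alg\<close>, without the product. The carrier is a
  parameter, so that a class of operators, its closure and all of \<open>bop V W\<close> share
  operations and norm.\<close>

definition bops :: "'v bspace \<Rightarrow> 'w bspace \<Rightarrow> ('v \<Rightarrow> 'w) set \<Rightarrow> ('v \<Rightarrow> 'w) bspace" where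
  "bops V W S = \<lparr> carr = S,
     add = (\<lambda>T T' f. if f \<in> carr V then add W (T f) (T' f) else zer W),
     smul = (\<lambda>c T f. if f \<in> carr V then smul W c (T f) else zer W),
     zer = (\<lambda>f. zer W),
     nrm = opnorm V W \<rparr>"

lemma bops_simps [simp]:
  "carr (bops V W S) = S"
  "add (bops V W S) T T' f = (if f \<in> carr V then add W (T f) (T' f) else zer W)"
  "smul (bops V W S) c T f = (if f \<in> carr V then smul W c (T f) else zer W)"
  "zer (bops V W S) f = zer W"
  "nrm (bops V W S) = opnorm V W"
  by (simp_all add: bops_def)

lemma vdiff_bops [simp]:
  "vdiff (bops V W S) T T' f = (if f \<in> carr V then vdiff W (T f) (T' f) else zer W)"
  by (simp add: vdiff_def)

lemma banach_space_bops:
  fixes V :: "'v bspace" and W :: "'w bspace"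
  assumes V: "banach_space V" and W: "banach_space W"
  shows "banach_space (bops V W (bop V W))"
proof (rule banach_spaceI)
  let ?B = "bops V W (bop V W)"
  note [simp] = bs_zer[OF V] bs_add[OF V] bs_smul[OF V] bs_zer[OF W] bs_add[OF W] bs_smul[OF W]
    bs_zer_add[OF W] bs_smul_zer[OF W] bs_smul_smul[OF W] bs_nrm_zer[OF W] bs_nrm_nonneg[OF V]
    bs_nrm_nonneg[OF W] bs_nrm_smul[OF W] bs_vdiff[OF W]
  note upper = opnorm_upper[OF V W]
  have [simp]: "T f \<in> carr W" if "T \<in> bop V W" "f \<in> carr V" for T f
    using that by (rule bop_carr)
  show "zer ?B \<in> carr ?B"
    by (simp, rule bopI[where C = 0]) auto
  show add: "add ?B S T \<in> carr ?B" if "S \<in> carr ?B" "T \<in> carr ?B" for S T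
  proof -
    have ST: "S \<in> bop V W" "T \<in> bop V W" using that by simp_all
    show ?thesis
    proof (simp, rule bopI[where C = "opnorm V W S + opnorm V W T"])
      fix f assume f: "f \<in> carr V"
      show "nrm W (add ?B S T f) \<le> (opnorm V W S + opnorm V W T) * nrm V f"
        using bs_nrm_add[OF W, of "S f" "T f"] upper[of S f] upper[of T f] ST f
        by (simp add: distrib_right)
    qed (use ST in \<open>auto simp: bop_add bop_smul bs_add_add[OF W] bs_smul_add[OF W]\<close>)
  qed
  show smul: "smul ?B c T \<in> carr ?B" if "T \<in> carr ?B" for c T
  proof -
    have T: "T \<in> bop V W" using that by simp
    show ?thesis
    proof (simp, rule bopI[where C = "norm c * opnorm V W T"])
      fix f assume f: "f \<in> carr V"
      show "nrm W (smul ?B c T f) \<le> norm c * opnorm V W T * nrm V f"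
        using upper[of T f] T f by (simp add: mult_left_mono mult.assoc)
    qed (use T in \<open>auto simp: bop_add bop_smul bs_add_add[OF W] bs_smul_add[OF W] mult.commute\<close>)
  qed
  show "add ?B (add ?B x y) z = add ?B x (add ?B y z)"
    if "x \<in> carr ?B" "y \<in> carr ?B" "z \<in> carr ?B" for x y z
    using that by (intro ext) (simp add: bs_assoc[OF W])
  show "add ?B x y = add ?B y x" if "x \<in> carr ?B" "y \<in> carr ?B" for x y
    using that by (intro ext) (simp add: bs_comm[OF W])
  show "add ?B (zer ?B) x = x" if "x \<in> carr ?B" for x
    using that by (intro ext) (simp add: bop_out[OF that[simplified]])
  show "add ?B x (smul ?B (- 1) x) = zer ?B" if "x \<in> carr ?B" for x
    using that by (intro ext) (simp add: bs_add_neg[OF W])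
  show "smul ?B c (add ?B x y) = add ?B (smul ?B c x) (smul ?B c y)"
    if "x \<in> carr ?B" "y \<in> carr ?B" for c x y
    using that by (intro ext) (simp add: bs_smul_add[OF W])
  show "smul ?B (c + d) x = add ?B (smul ?B c x) (smul ?B d x)" if "x \<in> carr ?B" for c d x
    using that by (intro ext) (simp add: bs_add_smul[OF W])
  show "smul ?B c (smul ?B d x) = smul ?B (c * d) x" if "x \<in> carr ?B" for c d x
    using that by (intro ext) simp
  show "smul ?B 1 x = x" if "x \<in> carr ?B" for x
    using that by (intro ext) (simp add: bop_out[OF that[simplified]] bs_smul_1[OF W])
  show "0 \<le> nrm ?B x" if "x \<in> carr ?B" for x
    using that by (simp add: opnorm_nonneg[OF V W])
  show "nrm ?B T = 0 \<longleftrightarrow> T = zer ?B" if "T \<in> carr ?B" for T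
  proof
    assume "nrm ?B T = 0"
    then have "nrm W (T f) = 0" if "f \<in> carr V" for f
      using upper[of T f] that \<open>T \<in> carr ?B\<close> bs_nrm_nonneg[OF W, of "T f"] by (simp add: order_antisym)
    then show "T = zer ?B"
      using that bs_nrm_eq_0[OF W] by (intro ext) (metis bops_simps(1,4) bop_carr bop_out)
  next
    assume T: "T = zer ?B"
    then have "opnorm V W T \<le> 0" by (intro opnorm_least[OF V]) auto
    then show "nrm ?B T = 0" using opnorm_nonneg[OF V W, of T] that by simp
  qed
  show "nrm ?B (smul ?B c T) = cmod c * nrm ?B T" if T: "T \<in> carr ?B" for c T
  proof -
    have le: "opnorm V W (smul ?B c T) \<le> cmod c * opnorm V W T" if T: "T \<in> bop V W" for c T
      using T upper[OF T] opnorm_nonneg[OF V W T]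
      by (intro opnorm_least[OF V]) (auto simp: mult_left_mono mult.assoc)
    have "cmod c * opnorm V W T \<le> opnorm V W (smul ?B c T)"
    proof (cases "c = 0")
      case True
      then show ?thesis using opnorm_nonneg[OF V W, of "smul ?B c T"] smul[OF T, of c] by simp
    next
      case False
      \<comment> \<open>Applying \<open>le\<close> to \<open>smul ?B c T\<close> and the scalar
        \<open>inverse c\<close> gives the reverse inequality.\<close>
      have "smul ?B (inverse c) (smul ?B c T) = T"
        using T False by (intro ext) (auto simp: bs_smul_1[OF W] bop_out[OF T[simplified]])
      then show ?thesis
        using le[of "smul ?B c T" "inverse c"] smul[OF T, of c] False
        by (simp add: norm_inverse norm_divide divide_simps mult.commute)
    qed
    then show ?thesis using le T by simp (metis antisym)
  qed
  show "nrm ?B (add ?B S T) \<le> nrm ?B S + nrm ?B T" if "S \<in> carr ?B" "T \<in> carr ?B" for S T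
  proof -
    have ST: "S \<in> bop V W" "T \<in> bop V W" using that by simp_all
    have "nrm W (add ?B S T f) \<le> (opnorm V W S + opnorm V W T) * nrm V f" if f: "f \<in> carr V" for f
      using bs_nrm_add[OF W, of "S f" "T f"] upper[of S f] upper[of T f] ST f
      by (simp add: distrib_right)
    then show ?thesis
      using opnorm_nonneg[OF V W] ST by (simp, intro opnorm_least[OF V]) auto
  qed
  fix s :: "nat \<Rightarrow> 'v \<Rightarrow> 'w"
  assume s: "\<And>n. s n \<in> carr ?B"
    and cau: "\<And>e. e > 0 \<Longrightarrow> \<exists>N. \<forall>m\<ge>N. \<forall>n\<ge>N. nrm ?B (vdiff ?B (s m) (s n)) < e"
  have sB: "s n \<in> bop V W" for n using s by simp
  note [simp] = bop_carr[OF sB]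
  have dB: "vdiff ?B S T \<in> bop V W" if "S \<in> bop V W" "T \<in> bop V W" for S T
    using add smul that by (simp add: vdiff_def)
  \<comment> \<open>The index \<open>N\<close> serves all \<open>f\<close> at once, with an error
    proportional to \<open>nrm V f\<close>. Pointwise convergence alone would not give convergence
    in operator norm.\<close>
  have cauf: "\<exists>N. \<forall>m\<ge>N. \<forall>n\<ge>N. \<forall>f\<in>carr V. nrm W (vdiff W (s m f) (s n f)) \<le> e * nrm V f" if "e > 0" for e
  proof -
    obtain N where N: "\<And>m n. m \<ge> N \<Longrightarrow> n \<ge> N \<Longrightarrow> opnorm V W (vdiff ?B (s m) (s n)) < e"
      using cau[OF \<open>e > 0\<close>] by auto
    have "nrm W (vdiff W (s m f) (s n f)) \<le> e * nrm V f" if "m \<ge> N" "n \<ge> N" "f \<in> carr V" for m n f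
      using upper[OF dB[OF sB sB], of f m n] mult_right_mono[OF less_imp_le[OF N[OF that(1,2)]], of "nrm V f"] that
      by simp
    then show ?thesis by blast
  qed
  have "\<exists>l\<in>carr W. (\<lambda>n. nrm W (vdiff W (s n f) l)) \<longlonglongrightarrow> 0" if f: "f \<in> carr V" for f
  proof -
    have "\<exists>N. \<forall>m\<ge>N. \<forall>n\<ge>N. nrm W (vdiff W (s m f) (s n f)) < e" if "e > 0" for e
    proof -
      have "e / (nrm V f + 1) > 0" using f that by (simp add: add_nonneg_pos)
      then obtain N where N: "\<And>m n. m \<ge> N \<Longrightarrow> n \<ge> N \<Longrightarrow> nrm W (vdiff W (s m f) (s n f)) \<le> e / (nrm V f + 1) * nrm V f"
        using cauf f by blast
      have "e / (a + 1) * a < e" if "a \<ge> 0" for a :: real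
        using that \<open>e > 0\<close> by (simp add: field_simps)
      then have "e / (nrm V f + 1) * nrm V f < e"
        using f by simp
      then show ?thesis using N by (meson le_less_trans)
    qed
    then show ?thesis using bs_complete[OF W, of "\<lambda>n. s n f"] f by (metis bop_carr sB)
  qed
  then obtain L0 where L0: "\<And>f. f \<in> carr V \<Longrightarrow> L0 f \<in> carr W \<and> (\<lambda>n. nrm W (vdiff W (s n f) (L0 f))) \<longlonglongrightarrow> 0"
    by metis
  \<comment> \<open>Membership in \<open>bop\<close> prescribes the value \<open>zer W\<close> off
    the carrier.\<close>
  define L where "L f = (if f \<in> carr V then L0 f else zer W)" for f
  have Lc [simp]: "L f \<in> carr W" for f using L0 by (simp add: L_def)
  have Llim: "(\<lambda>n. nrm W (vdiff W (s n f) (L f))) \<longlonglongrightarrow> 0" if "f \<in> carr V" for f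
    using L0 that by (simp add: L_def)
  \<comment> \<open>The limit in \<open>n\<close> of \<open>cauf\<close> keeps both \<open>N\<close>
    and \<open>e\<close>. The case \<open>e = 1\<close> shows that \<open>L\<close> is bounded,
    small \<open>e\<close> gives convergence in operator norm.\<close>
  have Lbound: "\<exists>N. \<forall>m\<ge>N. \<forall>f\<in>carr V. nrm W (vdiff W (s m f) (L f)) \<le> e * nrm V f" if "e > 0" for e
  proof -
    obtain N where N: "\<And>m n f. m \<ge> N \<Longrightarrow> n \<ge> N \<Longrightarrow> f \<in> carr V \<Longrightarrow> nrm W (vdiff W (s m f) (s n f)) \<le> e * nrm V f"
      using cauf[OF \<open>e > 0\<close>] by blast
    have "nrm W (vdiff W (s m f) (L f)) \<le> e * nrm V f" if "m \<ge> N" "f \<in> carr V" for m f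
      by (rule bs_nrm_lim_le[OF W _ _ bs_lim_vdiff_const[OF W _ _ _ Llim[OF that(2)]], of _ N])
        (use N[OF that(1) _ that(2)] that in auto)
    then show ?thesis by blast
  qed
  have "L \<in> bop V W"
  proof -
    obtain N where N: "\<And>f. f \<in> carr V \<Longrightarrow> nrm W (vdiff W (s N f) (L f)) \<le> 1 * nrm V f"
      using Lbound[of 1] by (metis order_refl zero_less_one)
    show ?thesis
    proof (rule bopI[where C = "1 + opnorm V W (s N)"])
      fix f assume f: "f \<in> carr V"
      show "nrm W (L f) \<le> (1 + opnorm V W (s N)) * nrm V f"
        using N[OF f] upper[OF sB f, of N] bs_nrm_le_vdiff[OF W, of "L f" "s N f"]
          bs_nrm_vdiff_commute[OF W, of "s N f" "L f"] f by (simp add: distrib_right)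
      show "L (smul V c f) = smul W c (L f)" for c
      proof (rule bs_lim_unique[OF W, of "\<lambda>n. s n (smul V c f)"])
        have "(\<lambda>n. norm c * nrm W (vdiff W (s n f) (L f))) \<longlonglongrightarrow> 0"
          using tendsto_mult_left[OF Llim[OF f], of "norm c"] by simp
        then show "(\<lambda>n. nrm W (vdiff W (s n (smul V c f)) (smul W c (L f)))) \<longlonglongrightarrow> 0"
          using f by (simp add: bop_smul[OF sB] bs_vdiff_smul[OF W])
      qed (use f Llim in auto)
      show "L (add V f g) = add W (L f) (L g)" if g: "g \<in> carr V" for g
      proof (rule bs_lim_unique[OF W, of "\<lambda>n. s n (add V f g)"])
        have 1: "(\<lambda>n. nrm W (vdiff W (s n f) (L f)) + nrm W (vdiff W (s n g) (L g))) \<longlonglongrightarrow> 0"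
          using tendsto_add[OF Llim[OF f] Llim[OF g]] by simp
        show "(\<lambda>n. nrm W (vdiff W (s n (add V f g)) (add W (L f) (L g)))) \<longlonglongrightarrow> 0"
          by (rule real_tendsto_sandwich[OF _ _ tendsto_const 1])
            (use f g in \<open>auto simp: bop_add[OF sB] bs_vdiff_add[OF W] bs_nrm_add[OF W]\<close>)
      qed (use f g Llim in auto)
    qed (simp_all, simp add: L_def)
  qed
  moreover have "(\<lambda>n. nrm ?B (vdiff ?B (s n) L)) \<longlonglongrightarrow> 0"
  proof (rule LIMSEQ_I)
    fix r :: real assume "r > 0"
    then obtain N where N: "\<And>m f. m \<ge> N \<Longrightarrow> f \<in> carr V \<Longrightarrow> nrm W (vdiff W (s m f) (L f)) \<le> r/2 * nrm V f"
      using Lbound[of "r/2"] by (meson half_gt_zero)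
    have "opnorm V W (vdiff ?B (s m) L) \<le> r/2" if "m \<ge> N" for m
      using N[OF that] \<open>r > 0\<close> by (intro opnorm_least[OF V]) auto
    then have "norm (nrm ?B (vdiff ?B (s m) L) - 0) < r" if "m \<ge> N" for m
      using that opnorm_nonneg[OF V W dB[OF sB \<open>L \<in> bop V W\<close>]] \<open>r > 0\<close> by fastforce
    then show "\<exists>N. \<forall>n\<ge>N. norm (nrm ?B (vdiff ?B (s n) L) - 0) < r" by blast
  qed
  ultimately show "\<exists>l\<in>carr ?B. (\<lambda>n. nrm ?B (vdiff ?B (s n) l)) \<longlonglongrightarrow> 0" by auto
qed

lemma bop_comp:
  assumes U: "banach_space U" and V: "banach_space V" and W: "banach_space W"
    and S: "S \<in> bop V W" and T: "T \<in> bop U V"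
  shows "S \<circ> T \<in> bop U W" "opnorm U W (S \<circ> T) \<le> opnorm V W S * opnorm U V T"
proof -
  have le: "nrm W ((S \<circ> T) f) \<le> opnorm V W S * opnorm U V T * nrm U f" if "f \<in> carr U" for f
  proof -
    have "nrm W ((S \<circ> T) f) \<le> opnorm V W S * nrm V (T f)"
      using opnorm_upper[OF V W S] bop_carr[OF T that] by simp
    also have "\<dots> \<le> opnorm V W S * (opnorm U V T * nrm U f)"
      using opnorm_upper[OF U V T that] opnorm_nonneg[OF V W S] by (rule mult_left_mono)
    finally show ?thesis by (simp add: mult.assoc)
  qed
  then show "opnorm U W (S \<circ> T) \<le> opnorm V W S * opnorm U V T"
    using opnorm_nonneg[OF V W S] opnorm_nonneg[OF U V T] by (intro opnorm_least[OF U]) auto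
  show "S \<circ> T \<in> bop U W"
    by (rule bopI[OF _ _ _ le])
      (use S T in \<open>auto simp: bop_carr bop_add[OF S] bop_add[OF T] bop_smul[OF S] bop_smul[OF T]
         bop_out[OF T] bop_zer[OF V W]\<close>)
qed

lemma bbil_comp:
  assumes U: "banach_space U" and V: "banach_space V" and W: "banach_space W"
  shows "bbil (bops V W (bop V W)) (bops U V (bop U V)) (bops U W (bop U W)) (\<circ>)"
  unfolding bbil_def
proof (intro conjI ballI allI; (simp only: bops_simps)?)
  fix S S' T T' and c :: complex
  assume S: "S \<in> bop V W" and T: "T \<in> bop U V"
  note [simp] = bop_carr[OF S] bop_carr[OF T] bop_out[OF T] bop_zer[OF V W S] bs_zer[OF V] bs_zer_add[OF W, OF bs_zer[OF W]]
    bs_smul_zer[OF W]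
  show "S \<circ> T \<in> bop U W" "opnorm U W (S \<circ> T) \<le> opnorm V W S * opnorm U V T"
    by (rule bop_comp[OF U V W S T])+
  show "smul (bops V W (bop V W)) c S \<circ> T = smul (bops U W (bop U W)) c (S \<circ> T)"
    by (simp add: fun_eq_iff)
  show "S \<circ> smul (bops U V (bop U V)) c T = smul (bops U W (bop U W)) c (S \<circ> T)"
    by (simp add: fun_eq_iff bop_smul[OF S])
  show "add (bops V W (bop V W)) S S' \<circ> T = add (bops U W (bop U W)) (S \<circ> T) (S' \<circ> T)"
    if S': "S' \<in> bop V W"
    by (simp add: fun_eq_iff bop_zer[OF V W S'])
  show "S \<circ> add (bops U V (bop U V)) T T' = add (bops U W (bop U W)) (S \<circ> T) (S \<circ> T')"
    if T': "T' \<in> bop U V"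
    by (simp add: fun_eq_iff bop_add[OF S] bop_carr[OF T'] bop_out[OF T'])
qed

section \<open>Direct sums\<close>

text \<open>For positive arguments this is convexity of the power function; if \<open>x\<close> or
  \<open>y\<close> is zero it reduces to \<open>w powr p <= w\<close> for
  \<open>0 <= w <= 1\<close>.\<close>

lemma powr_convex_nonneg:
  fixes x y u v p :: real
  assumes "0 \<le> x" "0 \<le> y" "0 \<le> u" "0 \<le> v" "u + v = 1" "1 \<le> p"
  shows "(u * x + v * y) powr p \<le> u * x powr p + v * y powr p"
proof -
  have scale: "(w * z) powr p \<le> w * z powr p" if "0 \<le> w" "w \<le> 1" "0 \<le> z" for w z :: real
  proof -
    have "w powr p \<le> w powr 1"
      using that \<open>1 \<le> p\<close> by (intro powr_mono') auto
    then show ?thesis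
      using that by (simp add: powr_mult mult_right_mono)
  qed
  consider "x = 0" | "y = 0" | "x > 0" "y > 0" using assms by fastforce
  then show ?thesis
  proof cases
    case 1 then show ?thesis using scale[of v y] assms by simp
  next
    case 2 then show ?thesis using scale[of u x] assms by simp
  next
    case 3
    have u: "u = 1 - v" using assms by simp
    show ?thesis
      using convex_onD[OF powr_convex[OF \<open>1 \<le> p\<close>], of v x y] assms 3
      by (simp add: u)
  qed
qed

text \<open>Minkowski's inequality for finite sums: convexity with weights
  \<open>a / (a + b)\<close> and \<open>b / (a + b)\<close> is applied to \<open>s x / a\<close> and
  \<open>t x / b\<close>. Positive upper bounds \<open>a\<close>, \<open>b\<close> in place of the
  norms avoid division by a zero norm.\<close>

lemma sum_powr_add_le:
  fixes s t :: "'i \<Rightarrow> real"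
  assumes p: "1 \<le> p" and a: "0 < a" and b: "0 < b"
    and s: "\<And>x. x \<in> F \<Longrightarrow> 0 \<le> s x" and t: "\<And>x. x \<in> F \<Longrightarrow> 0 \<le> t x"
    and sa: "(\<Sum>x\<in>F. s x powr p) \<le> a powr p" and tb: "(\<Sum>x\<in>F. t x powr p) \<le> b powr p"
  shows "(\<Sum>x\<in>F. (s x + t x) powr p) \<le> (a + b) powr p"
proof -
  define u where "u = a / (a + b)"
  define v where "v = b / (a + b)"
  have uv: "0 \<le> u" "0 \<le> v" "u + v = 1"
    using a b by (simp_all add: u_def v_def add_divide_distrib[symmetric])
  have "(s x + t x) powr p \<le> (a + b) powr p * (u * (s x powr p / a powr p) + v * (t x powr p / b powr p))"
    if "x \<in> F" for x
  proof -
    have "(a + b) * (u * (s x / a)) = s x" "(a + b) * (v * (t x / b)) = t x"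
      using a b by (simp_all add: u_def v_def)
    then have "s x + t x = (a + b) * (u * (s x / a) + v * (t x / b))"
      by (simp add: distrib_left)
    then have "(s x + t x) powr p = (a + b) powr p * (u * (s x / a) + v * (t x / b)) powr p"
      using a b s t that uv by (simp add: powr_mult)
    also have "\<dots> \<le> (a + b) powr p * (u * (s x / a) powr p + v * (t x / b) powr p)"
      using powr_convex_nonneg[of "s x / a" "t x / b" u v p] a b s t that uv p
      by (intro mult_left_mono) auto
    finally show ?thesis using a b s t that by (simp add: powr_divide)
  qed
  then have "(\<Sum>x\<in>F. (s x + t x) powr p)
      \<le> (\<Sum>x\<in>F. (a + b) powr p * (u * (s x powr p / a powr p) + v * (t x powr p / b powr p)))"
    by (rule sum_mono)
  also have "\<dots> = (a + b) powr p * (u * ((\<Sum>x\<in>F. s x powr p) / a powr p) + v * ((\<Sum>x\<in>F. t x powr p) / b powr p))"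
    by (simp add: sum_distrib_left sum.distrib sum_divide_distrib distrib_left)
  also have "\<dots> \<le> (a + b) powr p * (u * 1 + v * 1)"
    using sa tb a b uv by (intro mult_left_mono add_mono) (auto simp: divide_le_eq)
  finally show ?thesis using uv by simp
qed

text \<open>The \<open>lp\<close>-direct sum of copies of \<open>B\<close>. Fibre
  \<open>cspace\<close> yields \<open>lp_space\<close>, and fibre \<open>lp_space\<close> yields
  \<open>lpv_space\<close>, so both spaces of the theorem are instances.\<close>

definition lpsum :: "real \<Rightarrow> 'b bspace \<Rightarrow> ('i \<Rightarrow> 'b) bspace" where
  "lpsum p B = \<lparr> carr = {f. (\<forall>x. f x \<in> carr B) \<and> (\<lambda>x. nrm B (f x) powr p) summable_on UNIV},
     add = (\<lambda>f g x. add B (f x) (g x)), smul = (\<lambda>c f x. smul B c (f x)), zer = (\<lambda>x. zer B),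
     nrm = (\<lambda>f. (\<Sum>\<^sub>\<infinity>x. nrm B (f x) powr p) powr (1 / p)) \<rparr>"

lemma lpsum_simps [simp]:
  "add (lpsum p B) f g x = add B (f x) (g x)"
  "smul (lpsum p B) c f x = smul B c (f x)"
  "zer (lpsum p B) x = zer B"
  "vdiff (lpsum p B) f g x = vdiff B (f x) (g x)"
  by (simp_all add: lpsum_def vdiff_def)

text \<open>A nonnegative family is summable once its finite partial sums are bounded, and the same
  bound holds for its sum. Later estimates therefore deal with finite sums only.\<close>

lemma lpsumI:
  assumes p: "1 \<le> p" and f: "\<And>x. f x \<in> carr B" and C: "0 \<le> C"
    and le: "\<And>F. finite F \<Longrightarrow> (\<Sum>x\<in>F. nrm B (f x) powr p) \<le> C powr p"
  shows "f \<in> carr (lpsum p B)" "nrm (lpsum p B) f \<le> C"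
proof -
  have s: "(\<lambda>x. nrm B (f x) powr p) summable_on UNIV"
    by (rule nonneg_bdd_above_summable_on) (use le in \<open>auto intro!: bdd_aboveI2\<close>)
  then show "f \<in> carr (lpsum p B)"
    using f by (simp add: lpsum_def)
  have "(\<Sum>\<^sub>\<infinity>x. nrm B (f x) powr p) \<le> C powr p"
    by (rule infsum_le_finite_sums[OF s]) (use le in auto)
  then have "(\<Sum>\<^sub>\<infinity>x. nrm B (f x) powr p) powr (1/p) \<le> (C powr p) powr (1/p)"
    using p by (intro powr_mono2 infsum_nonneg) auto
  then show "nrm (lpsum p B) f \<le> C"
    using p C by (simp add: lpsum_def powr_powr)
qed

lemma lpsum_coord: "f \<in> carr (lpsum p B) \<Longrightarrow> f x \<in> carr B"
  by (simp add: lpsum_def)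

lemma lpsum_nrm_nonneg: "0 \<le> nrm (lpsum p B) f"
  by (simp add: lpsum_def)

lemma lpsum_sum_le:
  assumes p: "1 \<le> p" and f: "f \<in> carr (lpsum p B)" and F: "finite F"
  shows "(\<Sum>x\<in>F. nrm B (f x) powr p) \<le> nrm (lpsum p B) f powr p"
proof -
  have "(\<Sum>x\<in>F. nrm B (f x) powr p) \<le> (\<Sum>\<^sub>\<infinity>x. nrm B (f x) powr p)"
    using f F by (intro finite_sum_le_infsum) (auto simp: lpsum_def)
  also have "\<dots> = nrm (lpsum p B) f powr p"
    using p infsum_nonneg[of UNIV "\<lambda>x. nrm B (f x) powr p"] by (simp add: lpsum_def powr_powr)
  finally show ?thesis .
qed

lemma powr_le_powrD:
  fixes a b p :: real
  assumes "a powr p \<le> b powr p" "0 < p" "0 \<le> b"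
  shows "a \<le> b"
  using assms powr_less_mono2[of p b a] by (meson not_le)

lemma lpsum_nrm_coord:
  assumes p: "1 \<le> p" and f: "f \<in> carr (lpsum p B)"
  shows "nrm B (f x) \<le> nrm (lpsum p B) f"
  by (rule powr_le_powrD[of _ p])
    (use lpsum_sum_le[OF assms, of "{x}"] p lpsum_nrm_nonneg[of p B f] in auto)

text \<open>Bounds restrictions and operators acting fibre by fibre; the fibres \<open>B\<close> and
  \<open>B'\<close> differ when passing between scalar and vector-valued functions.\<close>

lemma lpsum_dominated:
  assumes p: "1 \<le> p" and g: "g \<in> carr (lpsum p B)" and f: "\<And>x. f x \<in> carr B'" and C: "0 \<le> C"
    and g0: "\<And>x. 0 \<le> nrm B (g x)" and f0: "\<And>x. 0 \<le> nrm B' (f x)"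
    and le: "\<And>x. nrm B' (f x) \<le> C * nrm B (g x)"
  shows "f \<in> carr (lpsum p B')" "nrm (lpsum p B') f \<le> C * nrm (lpsum p B) g"
proof -
  have *: "(\<Sum>x\<in>F. nrm B' (f x) powr p) \<le> (C * nrm (lpsum p B) g) powr p" if "finite F" for F
  proof -
    have "(\<Sum>x\<in>F. nrm B' (f x) powr p) \<le> (\<Sum>x\<in>F. C powr p * nrm B (g x) powr p)"
    proof (rule sum_mono)
      show "nrm B' (f x) powr p \<le> C powr p * nrm B (g x) powr p" for x
        using powr_mono2[OF _ f0 le, of p x] p C g0 by (simp add: powr_mult)
    qed
    also have "\<dots> \<le> C powr p * nrm (lpsum p B) g powr p"
      using lpsum_sum_le[OF p g that] by (simp add: sum_distrib_left[symmetric] mult_left_mono)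
    finally show ?thesis using C lpsum_nrm_nonneg by (simp add: powr_mult)
  qed
  have "0 \<le> C * nrm (lpsum p B) g"
    using C lpsum_nrm_nonneg[of p B g] by simp
  from lpsumI[OF p f this *]
  show "f \<in> carr (lpsum p B')" "nrm (lpsum p B') f \<le> C * nrm (lpsum p B) g"
    by blast+
qed

lemma bs_nrm_tendsto:
  assumes V: "banach_space V" and s: "\<And>n. s n \<in> carr V" and l: "l \<in> carr V"
    and lim: "(\<lambda>n. nrm V (vdiff V (s n) l)) \<longlonglongrightarrow> 0"
  shows "(\<lambda>n. nrm V (s n)) \<longlonglongrightarrow> nrm V l"
proof -
  have "\<bar>nrm V (s n) - nrm V l\<bar> \<le> nrm V (vdiff V (s n) l)" for n
    using bs_nrm_le_vdiff[OF V s l, of n] bs_nrm_le_vdiff[OF V l s, of n]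
      bs_nrm_vdiff_commute[OF V l s, of n] by simp
  then have "(\<lambda>n. nrm V (s n) - nrm V l) \<longlonglongrightarrow> 0"
    by (intro Lim_null_comparison[OF _ lim]) simp
  then show ?thesis by (simp add: LIM_zero_iff)
qed

lemma lpsum_add:
  assumes p: "1 \<le> p" and B: "banach_space B"
    and f: "f \<in> carr (lpsum p B)" and g: "g \<in> carr (lpsum p B)"
  shows "add (lpsum p B) f g \<in> carr (lpsum p B)"
    "nrm (lpsum p B) (add (lpsum p B) f g) \<le> nrm (lpsum p B) f + nrm (lpsum p B) g"
proof -
  let ?D = "lpsum p B"
  note [simp] = bs_add[OF B] bs_nrm_nonneg[OF B] lpsum_coord[OF f] lpsum_coord[OF g]
  \<comment> \<open>\<open>sum_powr_add_le\<close> asks for positive bounds, so both norms are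
    enlarged by \<open>e\<close>, which is sent to zero at the end.\<close>
  have *: "add ?D f g \<in> carr ?D \<and> nrm ?D (add ?D f g) \<le> (nrm ?D f + e) + (nrm ?D g + e)" if "e > 0" for e
  proof -
    have pos: "nrm ?D f + e > 0" "nrm ?D g + e > 0"
      using that lpsum_nrm_nonneg[of p B f] lpsum_nrm_nonneg[of p B g] by auto
    have "(\<Sum>x\<in>F. nrm B (add ?D f g x) powr p) \<le> ((nrm ?D f + e) + (nrm ?D g + e)) powr p" if F: "finite F" for F
    proof -
      have "(\<Sum>x\<in>F. nrm B (add ?D f g x) powr p) \<le> (\<Sum>x\<in>F. (nrm B (f x) + nrm B (g x)) powr p)"
        using p by (intro sum_mono powr_mono2) (auto simp: bs_nrm_add[OF B])
      also have "\<dots> \<le> ((nrm ?D f + e) + (nrm ?D g + e)) powr p"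
      proof (rule sum_powr_add_le[OF p pos])
        show "(\<Sum>x\<in>F. nrm B (f x) powr p) \<le> (nrm ?D f + e) powr p"
          using lpsum_sum_le[OF p f F] powr_mono2[of p "nrm ?D f" "nrm ?D f + e"] p \<open>e > 0\<close>
            lpsum_nrm_nonneg[of p B f] by simp
        show "(\<Sum>x\<in>F. nrm B (g x) powr p) \<le> (nrm ?D g + e) powr p"
          using lpsum_sum_le[OF p g F] powr_mono2[of p "nrm ?D g" "nrm ?D g + e"] p \<open>e > 0\<close>
            lpsum_nrm_nonneg[of p B g] by simp
      qed auto
      finally show ?thesis .
    qed
    then show ?thesis
      using lpsumI[OF p, of "add ?D f g" B "(nrm ?D f + e) + (nrm ?D g + e)"] pos by simp
  qed
  show "add ?D f g \<in> carr ?D" using *[of 1] by simp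
  show "nrm ?D (add ?D f g) \<le> nrm ?D f + nrm ?D g"
  proof (rule field_le_epsilon)
    show "nrm ?D (add ?D f g) \<le> nrm ?D f + nrm ?D g + e" if "e > 0" for e
      using *[of "e/2"] that by simp
  qed
qed

lemma lpsum_smul:
  assumes p: "1 \<le> p" and B: "banach_space B" and f: "f \<in> carr (lpsum p B)"
  shows "smul (lpsum p B) c f \<in> carr (lpsum p B)"
    "nrm (lpsum p B) (smul (lpsum p B) c f) = norm c * nrm (lpsum p B) f"
proof -
  have *: "nrm B (smul B c (f x)) powr p = norm c powr p * nrm B (f x) powr p" for x
    using lpsum_coord[OF f] bs_nrm_nonneg[OF B] by (simp add: bs_nrm_smul[OF B] powr_mult)
  show "smul (lpsum p B) c f \<in> carr (lpsum p B)"
    using f by (auto simp: lpsum_def * bs_smul[OF B] intro: summable_on_cmult_right)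
  show "nrm (lpsum p B) (smul (lpsum p B) c f) = norm c * nrm (lpsum p B) f"
    using p by (simp add: lpsum_def * infsum_cmult_right' powr_mult infsum_nonneg powr_powr)
qed

lemma banach_space_lpsum:
  assumes p: "1 \<le> p" and B: "banach_space B"
  shows "banach_space (lpsum p B)"
proof (rule banach_spaceI)
  let ?D = "lpsum p B"
  note [simp] = bs_zer[OF B] bs_add[OF B] bs_smul[OF B] bs_nrm_zer[OF B] bs_nrm_nonneg[OF B] bs_vdiff[OF B]
  show "zer ?D \<in> carr ?D"
    using p by (intro lpsumI[where C = 0]) auto
  show add: "add ?D x y \<in> carr ?D" "nrm ?D (add ?D x y) \<le> nrm ?D x + nrm ?D y"
    if "x \<in> carr ?D" "y \<in> carr ?D" for x y
    using that by (rule lpsum_add[OF p B])+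
  show smul: "smul ?D c x \<in> carr ?D" "nrm ?D (smul ?D c x) = norm c * nrm ?D x"
    if "x \<in> carr ?D" for c x
    using that by (rule lpsum_smul[OF p B])+
  show "add ?D (add ?D x y) z = add ?D x (add ?D y z)"
    if "x \<in> carr ?D" "y \<in> carr ?D" "z \<in> carr ?D" for x y z
    using that by (intro ext) (simp add: bs_assoc[OF B] lpsum_coord)
  show "add ?D x y = add ?D y x" if "x \<in> carr ?D" "y \<in> carr ?D" for x y
    using that by (intro ext) (simp add: bs_comm[OF B] lpsum_coord)
  show "add ?D (zer ?D) x = x" if "x \<in> carr ?D" for x
    using that by (intro ext) (simp add: bs_zer_add[OF B] lpsum_coord)
  show "add ?D x (smul ?D (- 1) x) = zer ?D" if "x \<in> carr ?D" for x
    using that by (intro ext) (simp add: bs_add_neg[OF B] lpsum_coord)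
  show "smul ?D c (add ?D x y) = add ?D (smul ?D c x) (smul ?D c y)"
    if "x \<in> carr ?D" "y \<in> carr ?D" for c x y
    using that by (intro ext) (simp add: bs_smul_add[OF B] lpsum_coord)
  show "smul ?D (c + d) x = add ?D (smul ?D c x) (smul ?D d x)" if "x \<in> carr ?D" for c d x
    using that by (intro ext) (simp add: bs_add_smul[OF B] lpsum_coord)
  show "smul ?D c (smul ?D d x) = smul ?D (c * d) x" if "x \<in> carr ?D" for c d x
    using that by (intro ext) (simp add: bs_smul_smul[OF B] lpsum_coord)
  show "smul ?D 1 x = x" if "x \<in> carr ?D" for x
    using that by (intro ext) (simp add: bs_smul_1[OF B] lpsum_coord)
  show "0 \<le> nrm ?D x" for x
    by (rule lpsum_nrm_nonneg)
  show "nrm ?D f = 0 \<longleftrightarrow> f = zer ?D" if f: "f \<in> carr ?D" for f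
  proof
    assume "nrm ?D f = 0"
    then have "nrm B (f x) = 0" for x
      using lpsum_nrm_coord[OF p f, of x] bs_nrm_nonneg[OF B lpsum_coord[OF f, of x]] by simp
    then show "f = zer ?D"
      using bs_nrm_eq_0[OF B lpsum_coord[OF f]] by (intro ext) simp
  next
    assume "f = zer ?D"
    then show "nrm ?D f = 0" using p by (simp add: lpsum_def)
  qed
  fix s :: "nat \<Rightarrow> 'b \<Rightarrow> 'a"
  assume s: "\<And>n. s n \<in> carr ?D"
    and cau: "\<And>e. e > 0 \<Longrightarrow> \<exists>N. \<forall>m\<ge>N. \<forall>n\<ge>N. nrm ?D (vdiff ?D (s m) (s n)) < e"
  note [simp] = lpsum_coord[OF s]
  have dD: "vdiff ?D f g \<in> carr ?D" if "f \<in> carr ?D" "g \<in> carr ?D" for f g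
    unfolding vdiff_def using that add(1) smul(1) by blast
  have "\<exists>l\<in>carr B. (\<lambda>n. nrm B (vdiff B (s n x) l)) \<longlonglongrightarrow> 0" for x
  proof -
    have "\<exists>N. \<forall>m\<ge>N. \<forall>n\<ge>N. nrm B (vdiff B (s m x) (s n x)) < e" if "e > 0" for e
    proof -
      obtain N where N: "\<And>m n. m \<ge> N \<Longrightarrow> n \<ge> N \<Longrightarrow> nrm ?D (vdiff ?D (s m) (s n)) < e"
        using cau[OF \<open>e > 0\<close>] by blast
      have "nrm B (vdiff B (s m x) (s n x)) < e" if "m \<ge> N" "n \<ge> N" for m n
        using N[OF that] lpsum_nrm_coord[OF p dD[OF s s], of m n x] by simp
      then show ?thesis by blast
    qed
    then obtain l where "l \<in> carr B" "(\<lambda>n. nrm B (vdiff B (s n x) l)) \<longlonglongrightarrow> 0"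
      using bs_complete[OF B, of "\<lambda>n. s n x"] by (metis lpsum_coord s)
    then show ?thesis by blast
  qed
  then obtain L where L [simp]: "\<And>x. L x \<in> carr B"
    and Llim: "\<And>x. (\<lambda>n. nrm B (vdiff B (s n x) (L x))) \<longlonglongrightarrow> 0"
    by metis
  \<comment> \<open>A Fatou argument: the bound on each finite partial sum survives the limit in
    \<open>n\<close>, and \<open>lpsumI\<close> carries it over to the full sum.\<close>
  have key: "\<exists>N. \<forall>m\<ge>N. vdiff ?D (s m) L \<in> carr ?D \<and> nrm ?D (vdiff ?D (s m) L) \<le> e" if "e > 0" for e
  proof -
    obtain N where N: "\<And>m n. m \<ge> N \<Longrightarrow> n \<ge> N \<Longrightarrow> nrm ?D (vdiff ?D (s m) (s n)) < e"
      using cau[OF \<open>e > 0\<close>] by blast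
    have "(\<Sum>x\<in>F. nrm B (vdiff ?D (s m) L x) powr p) \<le> e powr p" if m: "m \<ge> N" and F: "finite F" for m F
    proof (rule LIMSEQ_le_const2)
      show "(\<lambda>n. \<Sum>x\<in>F. nrm B (vdiff B (s m x) (s n x)) powr p) \<longlonglongrightarrow> (\<Sum>x\<in>F. nrm B (vdiff ?D (s m) L x) powr p)"
      proof (rule tendsto_sum)
        fix x
        have "(\<lambda>n. nrm B (vdiff B (s m x) (s n x))) \<longlonglongrightarrow> nrm B (vdiff ?D (s m) L x)"
          using bs_nrm_tendsto[OF B _ _ bs_lim_vdiff_const[OF B _ _ _ Llim[of x]], of "s m x"] by simp
        then show "(\<lambda>n. nrm B (vdiff B (s m x) (s n x)) powr p) \<longlonglongrightarrow> nrm B (vdiff ?D (s m) L x) powr p"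
          using p by (intro tendsto_powr' tendsto_const) auto
      qed
      have "(\<Sum>x\<in>F. nrm B (vdiff B (s m x) (s n x)) powr p) \<le> e powr p" if "n \<ge> N" for n
      proof -
        have "(\<Sum>x\<in>F. nrm B (vdiff B (s m x) (s n x)) powr p) \<le> nrm ?D (vdiff ?D (s m) (s n)) powr p"
          using lpsum_sum_le[OF p dD[OF s s] F, of m n] by simp
        also have "\<dots> \<le> e powr p"
          using N[OF m that] p lpsum_nrm_nonneg by (intro powr_mono2) auto
        finally show ?thesis .
      qed
      then show "\<exists>N. \<forall>n\<ge>N. (\<Sum>x\<in>F. nrm B (vdiff B (s m x) (s n x)) powr p) \<le> e powr p" by blast
    qed
    then have "vdiff ?D (s m) L \<in> carr ?D \<and> nrm ?D (vdiff ?D (s m) L) \<le> e" if "m \<ge> N" for m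
      using lpsumI[OF p, of "vdiff ?D (s m) L" B e] that \<open>e > 0\<close> by simp
    then show ?thesis by blast
  qed
  obtain N where N: "vdiff ?D (s N) L \<in> carr ?D"
    using key[of 1] by (meson order_refl zero_less_one)
  \<comment> \<open>The limit is known only coordinatewise so far; writing it as \<open>s N\<close>
    minus the difference \<open>s N - L\<close> puts it into the space.\<close>
  have "L = add ?D (smul ?D (-1) (vdiff ?D (s N) L)) (s N)"
    by (intro ext) (simp add: bs_vdiff_commute[OF B, symmetric] bs_vdiff_cancel[OF B])
  then have "L \<in> carr ?D"
    using add(1)[OF smul(1)[OF N] s] by metis
  moreover have "(\<lambda>n. nrm ?D (vdiff ?D (s n) L)) \<longlonglongrightarrow> 0"
  proof (rule LIMSEQ_I)
    fix r :: real assume "r > 0"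
    then obtain N where N: "\<And>m. m \<ge> N \<Longrightarrow> nrm ?D (vdiff ?D (s m) L) \<le> r/2"
      using key[of "r/2"] by (meson half_gt_zero)
    then show "\<exists>N. \<forall>n\<ge>N. norm (nrm ?D (vdiff ?D (s n) L) - 0) < r"
      using \<open>r > 0\<close> le_less_trans[OF N, of _ r] by (intro exI[of _ N]) (auto simp: abs_of_nonneg[OF lpsum_nrm_nonneg])
  qed
  ultimately show "\<exists>l\<in>carr ?D. (\<lambda>n. nrm ?D (vdiff ?D (s n) l)) \<longlonglongrightarrow> 0" by blast
qed

definition cspace :: "complex bspace" where
  "cspace = \<lparr> carr = UNIV, add = (+), smul = (*), zer = 0, nrm = norm \<rparr>"

lemma cspace_simps [simp]:
  "carr cspace = UNIV" "add cspace = (+)" "smul cspace = (*)" "zer cspace = 0" "nrm cspace = norm"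
  "vdiff cspace x y = x - y"
  by (simp_all add: cspace_def vdiff_def)

lemma banach_space_cspace: "banach_space cspace"
proof (rule banach_spaceI)
  fix s :: "nat \<Rightarrow> complex"
  assume "\<And>e. e > 0 \<Longrightarrow> \<exists>N. \<forall>m\<ge>N. \<forall>n\<ge>N. nrm cspace (vdiff cspace (s m) (s n)) < e"
  then have "Cauchy s" by (simp add: Cauchy_iff)
  then obtain l where "s \<longlonglongrightarrow> l" using Cauchy_convergent convergent_def by blast
  then have "(\<lambda>n. norm (s n - l)) \<longlonglongrightarrow> 0"
    by (metis LIM_zero tendsto_norm_zero)
  then show "\<exists>l\<in>carr cspace. (\<lambda>n. nrm cspace (vdiff cspace (s n) l)) \<longlonglongrightarrow> 0" by auto
qed (auto simp: algebra_simps norm_mult norm_triangle_ineq)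

lemma lp_space_lpsum: "lp_space p = lpsum p cspace"
  by (simp add: lp_space_def lpsum_def lp_def lpnorm_def fun_eq_iff)

lemma lpv_space_lpsum: "lpv_space p = lpsum p (lp_space p)"
  by (simp add: lpv_space_def lpsum_def lpv_def lpvnorm_def lp_space_def fun_eq_iff)

section \<open>Finite propagation\<close>

lemma bop_vdiff:
  assumes "banach_space V" "T \<in> bop V W" "f \<in> carr V" "g \<in> carr V"
  shows "T (vdiff V f g) = vdiff W (T f) (T g)"
  using assms by (simp add: vdiff_def bop_add[OF assms(2)] bop_smul[OF assms(2)] bs_smul[OF assms(1)])

section \<open>Point masses, restrictions and truncation\<close>

definition single :: "'b bspace \<Rightarrow> 'i \<Rightarrow> 'b \<Rightarrow> 'i \<Rightarrow> 'b" where
  "single B y v = (\<lambda>z. if z = y then v else zer B)"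

definition restr :: "'b bspace \<Rightarrow> 'i set \<Rightarrow> ('i \<Rightarrow> 'b) \<Rightarrow> 'i \<Rightarrow> 'b" where
  "restr B F f = (\<lambda>z. if z \<in> F then f z else zer B)"

lemma restr_empty: "restr B {} f = zer (lpsum p B)"
  by (simp add: restr_def fun_eq_iff)

context
  fixes p :: real and B :: "'b bspace"
  assumes p: "1 \<le> p" and B: "banach_space B"
begin

lemma lpsum_single: "v \<in> carr B \<Longrightarrow> single B y v \<in> carr (lpsum p B)"
proof -
  assume v: "v \<in> carr B"
  have "(\<Sum>x\<in>F. nrm B (single B y v x) powr p) \<le> nrm B v powr p" if F: "finite F" for F
  proof -
    have "(\<Sum>x\<in>F. nrm B (single B y v x) powr p) = (\<Sum>x\<in>F. if x = y then nrm B v powr p else 0)"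
      using B p by (intro sum.cong) (auto simp: single_def bs_nrm_zer[OF B])
    then show ?thesis using F by simp
  qed
  then show ?thesis
    using lpsumI[OF p, of "single B y v" B "nrm B v"] v B by (simp add: single_def)
qed

lemma lpsum_restr:
  assumes f: "f \<in> carr (lpsum p B)"
  shows "restr B F f \<in> carr (lpsum p B)"
proof (rule lpsum_dominated(1)[OF p f, where C = 1])
  note [simp] = lpsum_coord[OF f] B
  show "restr B F f x \<in> carr B" "0 \<le> nrm B (f x)" "0 \<le> nrm B (restr B F f x)"
    "nrm B (restr B F f x) \<le> 1 * nrm B (f x)" for x
    by (simp_all add: restr_def bs_nrm_zer[OF B])
qed simp

lemma restr_insert:
  assumes f: "f \<in> carr (lpsum p B)" and "y \<notin> F"
  shows "restr B (insert y F) f = add (lpsum p B) (single B y (f y)) (restr B F f)"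
  using assms lpsum_coord[OF f] B by (auto simp: fun_eq_iff restr_def single_def)

text \<open>\<open>F\<close> is chosen so that its partial sum misses the total by less than
  \<open>e powr p\<close>; the remainder vanishes on \<open>F\<close>, so its finite partial sums
  are bounded by what \<open>F\<close> misses.\<close>

lemma lpsum_truncate:
  fixes f :: "'i \<Rightarrow> 'b"
  assumes f: "f \<in> carr (lpsum p B)" and "e > 0"
  obtains F where "finite F" "nrm (lpsum p B) (vdiff (lpsum p B) f (restr B F f)) \<le> e"
proof -
  let ?g = "\<lambda>x. nrm B (f x) powr p"
  note [simp] = lpsum_coord[OF f] B bs_nrm_zer[OF B] bs_vdiff[OF B]
  have summ: "?g summable_on UNIV" using f by (simp add: lpsum_def)
  obtain F where F: "finite F" "infsum ?g UNIV - e powr p < sum ?g F"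
  proof (rule ccontr)
    assume "\<not> thesis"
    then have "sum ?g F \<le> infsum ?g UNIV - e powr p" if "finite F" for F
      using that \<open>\<And>F. finite F \<Longrightarrow> infsum ?g UNIV - e powr p < sum ?g F \<Longrightarrow> thesis\<close> by force
    then have "infsum ?g UNIV \<le> infsum ?g UNIV - e powr p"
      by (intro infsum_le_finite_sums[OF summ])
    then show False using \<open>e > 0\<close> by simp
  qed
  have "(\<Sum>x\<in>G. nrm B (vdiff (lpsum p B) f (restr B F f) x) powr p) \<le> e powr p" if G: "finite G" for G
  proof -
    have "(\<Sum>x\<in>G. nrm B (vdiff (lpsum p B) f (restr B F f) x) powr p) = (\<Sum>x\<in>G - F. ?g x)"
      using p G by (intro sum.mono_neutral_cong_right) (auto simp: restr_def bs_vdiff_self[OF B])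
    also have "\<dots> = sum ?g (G \<union> F) - sum ?g F"
      using sum.subset_diff[of F "G \<union> F" ?g] G F(1) by (simp add: Un_Diff)
    also have "\<dots> \<le> infsum ?g UNIV - sum ?g F"
      using G F finite_sum_le_infsum[OF summ, of "G \<union> F"] by simp
    finally show ?thesis using F by simp
  qed
  then have "nrm (lpsum p B) (vdiff (lpsum p B) f (restr B F f)) \<le> e"
    using \<open>e > 0\<close> by (intro lpsumI(2)[OF p]) (auto simp: restr_def)
  with F that show ?thesis by blast
qed

end

section \<open>Finite propagation without matrix entries\<close>

definition fprop ::
  "real \<Rightarrow> 'b bspace \<Rightarrow> 'c bspace \<Rightarrow> real \<Rightarrow> (('a::metric_space \<Rightarrow> 'b) \<Rightarrow> ('a \<Rightarrow> 'c)) \<Rightarrow> bool" where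
  "fprop p B C R T \<longleftrightarrow>
     (\<forall>f\<in>carr (lpsum p B). \<forall>x. (\<forall>y. dist x y \<le> R \<longrightarrow> f y = zer B) \<longrightarrow> T f x = zer C)"

definition fpops ::
  "real \<Rightarrow> 'b bspace \<Rightarrow> 'c bspace \<Rightarrow> (('a::metric_space \<Rightarrow> 'b) \<Rightarrow> ('a \<Rightarrow> 'c)) set" where
  "fpops p B C = {T \<in> bop (lpsum p B) (lpsum p C). \<exists>R. fprop p B C R T}"

lemma fpropD:
  assumes "fprop p B C R T" "f \<in> carr (lpsum p B)" "\<And>y. dist x y \<le> R \<Longrightarrow> f y = zer B"
  shows "T f x = zer C"
  using assms unfolding fprop_def by simp

lemma fprop_mono: "fprop p B C R T \<Longrightarrow> R \<le> R' \<Longrightarrow> fprop p B C R' T"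
  unfolding fprop_def by (meson order_trans)

context
  fixes p :: real and B :: "'b bspace" and C :: "'c bspace"
  assumes p: "1 \<le> p" and B: "banach_space B" and C: "banach_space C"
begin

text \<open>Linear expansion over a finite support. The set \<open>S\<close> is left open because it
  is used with \<open>{zer C}\<close> for propagation and with a span of few vectors for
  ranks.\<close>

lemma bop_restr_induct:
  fixes T :: "('i \<Rightarrow> 'b) \<Rightarrow> ('i \<Rightarrow> 'c)"
  assumes T: "T \<in> bop (lpsum p B) (lpsum p C)" and f: "f \<in> carr (lpsum p B)"
    and F: "finite F" and zer: "zer C \<in> S" and add: "\<And>v w. v \<in> S \<Longrightarrow> w \<in> S \<Longrightarrow> add C v w \<in> S"
    and single: "\<And>y. y \<in> F \<Longrightarrow> T (single B y (f y)) x \<in> S"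
  shows "T (restr B F f) x \<in> S"
  using F single
proof (induction F rule: finite_induct)
  case empty
  have "T (restr B {} f) = zer (lpsum p C)"
    unfolding restr_empty[of B f p]
    by (rule bop_zer[OF banach_space_lpsum[OF p B] banach_space_lpsum[OF p C] T])
  then show ?case using zer by simp
next
  case (insert y F)
  have "T (restr B (insert y F) f) = add (lpsum p C) (T (single B y (f y))) (T (restr B F f))"
    unfolding restr_insert[OF p B f insert.hyps(2)]
    by (intro bop_add[OF T] lpsum_single[OF p B] lpsum_coord[OF f] lpsum_restr[OF p B f])
  then show ?case
    using add[of "T (single B y (f y)) x" "T (restr B F f) x"] insert by simp
qed

text \<open>Matrix entries control \<open>T\<close> on finitely supported functions only. For
  general \<open>f\<close> the truncations are mapped to zero at \<open>x\<close>, and boundedness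
  of \<open>T\<close> makes \<open>T f x\<close> a limit of these zeros.\<close>

lemma fpropI_single:
  fixes T :: "('a::metric_space \<Rightarrow> 'b) \<Rightarrow> ('a \<Rightarrow> 'c)"
  assumes T: "T \<in> bop (lpsum p B) (lpsum p C)"
    and single: "\<And>x y v. v \<in> carr B \<Longrightarrow> T (single B y v) x \<noteq> zer C \<Longrightarrow> dist x y \<le> R"
  shows "fprop p B C R T"
  unfolding fprop_def
proof (intro ballI allI impI)
  let ?D = "lpsum p B" and ?E = "lpsum p C"
  fix f :: "'a \<Rightarrow> 'b" and x
  assume f: "f \<in> carr ?D" and zero: "\<forall>y. dist x y \<le> R \<longrightarrow> f y = zer B"
  note D = banach_space_lpsum[OF p B] and E = banach_space_lpsum[OF p C]
  note Tzer = bop_zer[OF D E T]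
  have fin: "T (restr B F f) x = zer C" if "finite F" for F
  proof -
    have "T (single B y (f y)) x = zer C" for y
    proof (cases "dist x y \<le> R")
      case True
      then have "single B y (f y) = zer ?D" using zero by (auto simp: single_def)
      then show ?thesis using Tzer by simp
    next
      case False
      then show ?thesis using single[OF lpsum_coord[OF f]] by blast
    qed
    then have "T (restr B F f) x \<in> {zer C}"
      by (intro bop_restr_induct[OF T f that]) (auto simp: bs_zer_add[OF C] bs_zer[OF C])
    then show ?thesis by simp
  qed
  have Tf: "T f x \<in> carr C" using lpsum_coord[OF bop_carr[OF T f]] .
  have "nrm C (T f x) \<le> opnorm ?D ?E T * e" if "e > 0" for e
  proof -
    obtain F where F: "finite F" "nrm ?D (vdiff ?D f (restr B F f)) \<le> e"
      using lpsum_truncate[OF p B f \<open>e > 0\<close>] by blast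
    have fr: "restr B F f \<in> carr ?D" by (rule lpsum_restr[OF p B f])
    have d: "vdiff ?D f (restr B F f) \<in> carr ?D" by (rule bs_vdiff[OF D f fr])
    have "nrm C (T f x) = nrm C (T (vdiff ?D f (restr B F f)) x)"
      using fin[OF F(1)] Tf by (simp add: bop_vdiff[OF D T f fr] bs_vdiff_zer[OF C])
    also have "\<dots> \<le> nrm ?E (T (vdiff ?D f (restr B F f)))"
      by (rule lpsum_nrm_coord[OF p bop_carr[OF T d]])
    also have "\<dots> \<le> opnorm ?D ?E T * nrm ?D (vdiff ?D f (restr B F f))"
      by (rule opnorm_upper[OF D E T d])
    also have "\<dots> \<le> opnorm ?D ?E T * e"
      using F(2) opnorm_nonneg[OF D E T] by (rule mult_left_mono)
    finally show ?thesis .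
  qed
  note le = this
  have "nrm C (T f x) \<le> 0"
  proof (rule field_le_epsilon)
    fix e :: real assume "e > 0"
    \<comment> \<open>The \<open>+ 1\<close> keeps the divisor positive when the operator norm is
      zero.\<close>
    define k where "k = opnorm ?D ?E T + 1"
    have k: "k > 0" using opnorm_nonneg[OF D E T] by (simp add: k_def)
    have "nrm C (T f x) \<le> opnorm ?D ?E T * (e / k)" using le[of "e / k"] \<open>e > 0\<close> k by simp
    also have "\<dots> \<le> k * (e / k)"
      using \<open>e > 0\<close> k by (intro mult_right_mono) (auto simp: k_def)
    finally show "nrm C (T f x) \<le> 0 + e" using k by simp
  qed
  then show "T f x = zer C"
    using bs_nrm_nonneg[OF C Tf] bs_nrm_eq_0[OF C Tf] by simp
qed

lemma fprop_single:
  assumes "fprop p B C R T" "v \<in> carr B" "T (single B y v) x \<noteq> zer C"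
  shows "dist x y \<le> R"
proof (rule ccontr)
  assume "\<not> dist x y \<le> R"
  then have "T (single B y v) x = zer C"
    by (intro fpropD[OF assms(1) lpsum_single[OF p B assms(2)]]) (auto simp: single_def)
  then show False using assms(3) by blast
qed

text \<open>\<open>f\<close> minus its restriction vanishes on the ball. If balls are finite,
  \<open>T f x\<close> thus becomes a finite sum of matrix entries, to which
  \<open>bop_restr_induct\<close> applies.\<close>

lemma fprop_restr:
  fixes T :: "('a::metric_space \<Rightarrow> 'b) \<Rightarrow> ('a \<Rightarrow> 'c)"
  assumes T: "T \<in> bop (lpsum p B) (lpsum p C)" and R: "fprop p B C R T" and f: "f \<in> carr (lpsum p B)"
  shows "T f x = T (restr B (cball x R) f) x"
proof -
  let ?D = "lpsum p B"
  note D = banach_space_lpsum[OF p B]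
  have fr: "restr B (cball x R) f \<in> carr ?D" by (rule lpsum_restr[OF p B f])
  have "T (vdiff ?D f (restr B (cball x R) f)) x = zer C"
    using R bs_vdiff[OF D f fr] lpsum_coord[OF f] unfolding fprop_def
    by (simp add: restr_def bs_vdiff_self[OF B])
  then have "vdiff C (T f x) (T (restr B (cball x R) f) x) = zer C"
    by (simp add: bop_vdiff[OF D T f fr])
  then show ?thesis
    using bs_vdiff_eq_zer[OF C] lpsum_coord[OF bop_carr[OF T f]] lpsum_coord[OF bop_carr[OF T fr]] by blast
qed

lemma subspace_in_fpops:
  "subspace_in (bops (lpsum p B) (lpsum p C) (bop (lpsum p B) (lpsum p C)))
     (fpops p B C :: (('a::metric_space \<Rightarrow> 'b) \<Rightarrow> ('a \<Rightarrow> 'c)) set)"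
proof -
  let ?O = "bops (lpsum p B) (lpsum p C) (bop (lpsum p B) (lpsum p C)) :: (('a \<Rightarrow> 'b) \<Rightarrow> ('a \<Rightarrow> 'c)) bspace"
  have O: "banach_space ?O" by (intro banach_space_bops banach_space_lpsum p B C)
  have zc: "add C (zer C) (zer C) = zer C" using bs_zer_add[OF C bs_zer[OF C]] .
  have "zer ?O \<in> fpops p B C"
    using bs_zer[OF O] by (auto simp: fpops_def fprop_def)
  moreover have "add ?O S T \<in> fpops p B C" if ST: "S \<in> fpops p B C" "T \<in> fpops p B C" for S T
  proof -
    obtain R R' where R: "fprop p B C R S" "fprop p B C R' T" and STc: "S \<in> carr ?O" "T \<in> carr ?O"
      using ST by (auto simp: fpops_def)
    then have "fprop p B C (max R R') S" "fprop p B C (max R R') T"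
      by (auto intro: fprop_mono)
    then have "fprop p B C (max R R') (add ?O S T)"
      unfolding fprop_def by (auto simp: zc)
    then show ?thesis using bs_add[OF O STc] by (auto simp: fpops_def)
  qed
  moreover have "smul ?O c T \<in> fpops p B C" if T: "T \<in> fpops p B C" for c T
  proof -
    obtain R where R: "fprop p B C R T" and Tc: "T \<in> carr ?O"
      using T by (auto simp: fpops_def)
    then have "fprop p B C R (smul ?O c T)"
      unfolding fprop_def by (auto simp: bs_smul_zer[OF C])
    then show ?thesis using bs_smul[OF O Tc] by (auto simp: fpops_def)
  qed
  ultimately show ?thesis
    unfolding subspace_in_def by (auto simp: fpops_def)
qed

end

lemma fpops_comp:
  assumes p: "1 \<le> p" and B: "banach_space B" and C: "banach_space C" and E: "banach_space E"
    and S: "(S :: ('a::metric_space \<Rightarrow> 'c) \<Rightarrow> ('a \<Rightarrow> 'd)) \<in> fpops p C E" and T: "T \<in> fpops p B C"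
  shows "S \<circ> T \<in> fpops p B E"
proof -
  obtain R R' where R: "fprop p C E R S" "fprop p B C R' T"
    and bop: "S \<in> bop (lpsum p C) (lpsum p E)" "T \<in> bop (lpsum p B) (lpsum p C)"
    using S T by (auto simp: fpops_def)
  have "S \<circ> T \<in> bop (lpsum p B) (lpsum p E)"
    by (rule bop_comp(1)[OF banach_space_lpsum[OF p B] banach_space_lpsum[OF p C] banach_space_lpsum[OF p E] bop])
  moreover have "fprop p B E (R + R') (S \<circ> T)"
    unfolding fprop_def
  proof (intro ballI allI impI)
    fix f :: "'a \<Rightarrow> 'b" and x
    assume f: "f \<in> carr (lpsum p B)" and zero: "\<forall>y. dist x y \<le> R + R' \<longrightarrow> f y = zer B"
    have "T f y = zer C" if "dist x y \<le> R" for y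
    proof -
      have "f z = zer B" if "dist y z \<le> R'" for z
        using zero that \<open>dist x y \<le> R\<close> dist_triangle[of x z y] by simp
      then show ?thesis by (rule fpropD[OF R(2) f])
    qed
    then show "(S \<circ> T) f x = zer E"
      using fpropD[OF R(1) bop_carr[OF bop(2) f]] by simp
  qed
  ultimately show ?thesis by (auto simp: fpops_def)
qed

section \<open>Bounded coordinates on finite-dimensional subspaces\<close>

text \<open>Dimension at most \<open>N\<close> is expressed as containment in some
  \<open>lspan s N\<close>. The vectors \<open>s i\<close> may be dependent and may lie outside the
  space being measured, as the vectors in \<open>rank_le\<close> do.\<close>

definition lspan :: "(nat \<Rightarrow> 'k \<Rightarrow> complex) \<Rightarrow> nat \<Rightarrow> ('k \<Rightarrow> complex) set" where
  "lspan s N = range (\<lambda>c k. \<Sum>i<N. c i * s i k)"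

lemma lspanI: "(\<lambda>k. \<Sum>i<N. c i * s i k) \<in> lspan s N"
  by (auto simp: lspan_def)

lemma lspanE:
  assumes "w \<in> lspan s N"
  obtains c where "w = (\<lambda>k. \<Sum>i<N. c i * s i k)"
  using assms by (auto simp: lspan_def)

lemma lspan_zero [simp]: "(\<lambda>k. 0) \<in> lspan s N"
  using lspanI[of "\<lambda>_. 0" s N] by simp

lemma lspan_lincomb:
  assumes "v \<in> lspan s N" "w \<in> lspan s N"
  shows "(\<lambda>k. v k + a * w k) \<in> lspan s N"
proof -
  obtain c where "v = (\<lambda>k. \<Sum>i<N. c i * s i k)" using assms(1) by (rule lspanE)
  moreover obtain d where "w = (\<lambda>k. \<Sum>i<N. d i * s i k)" using assms(2) by (rule lspanE)
  ultimately show ?thesis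
    using lspanI[of "\<lambda>i. c i + a * d i" s N] by (simp add: sum.distrib sum_distrib_left algebra_simps)
qed

lemma lspan_sum:
  fixes M :: nat
  assumes "\<And>i. i < M \<Longrightarrow> u i \<in> lspan s N"
  shows "(\<lambda>k. \<Sum>i<M. c i * u i k) \<in> lspan s N"
  using assms
proof (induction M)
  case (Suc M)
  then show ?case using lspan_lincomb[of "\<lambda>k. \<Sum>i<M. c i * u i k" s N "u M" "c M"] by simp
qed simp

lemma lspan_pad:
  assumes "N \<le> M"
  shows "lspan s N \<subseteq> lspan s M"
proof
  fix w assume "w \<in> lspan s N"
  then obtain c where "w = (\<lambda>k. \<Sum>i<N. c i * s i k)" by (rule lspanE)
  moreover have "(\<Sum>i<N. c i * s i k) = (\<Sum>i<M. (if i < N then c i else 0) * s i k)" for k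
    using assms by (intro sum.mono_neutral_cong_left) auto
  ultimately show "w \<in> lspan s M"
    using lspanI[of "\<lambda>i. if i < N then c i else 0" s M] by simp
qed

lemma lspan_union: "\<exists>u. lspan s N \<union> lspan t M \<subseteq> lspan u (N + M)"
proof -
  define u where "u i = (if i < N then s i else t (i - N))" for i
  have "lspan s N \<subseteq> lspan u N"
    by (auto simp: lspan_def u_def)
  then have 1: "lspan s N \<subseteq> lspan u (N + M)"
    using lspan_pad[of N "N + M" u] by simp
  have 2: "t i = u (N + i)" for i by (simp add: u_def)
  have "t i \<in> lspan u (N + M)" if "i < M" for i
  proof -
    have "(\<Sum>j<N + M. of_bool (j = N + i) * u j k) = (\<Sum>j<N + M. if j = N + i then t i k else 0)" for k
      by (intro sum.cong) (auto simp: 2)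
    then have "(\<Sum>j<N + M. of_bool (j = N + i) * u j k) = t i k" for k
      using that by simp
    then show ?thesis
      using lspanI[of "\<lambda>j. of_bool (j = N + i)" u "N + M"] by simp
  qed
  then have "lspan t M \<subseteq> lspan u (N + M)"
    by (auto elim!: lspanE intro: lspan_sum)
  with 1 show ?thesis by blast
qed

text \<open>The spanning lists are concatenated. Applied to the entries of one row, this multiplies
  the rank of an entry by the number of points in a ball.\<close>

lemma lspan_UN:
  assumes "finite F"
  shows "\<exists>u. \<forall>y\<in>F. lspan (s y) N \<subseteq> lspan u (card F * N)"
  using assms
proof (induction F rule: finite_induct)
  case (insert y F)
  then obtain u where u: "\<forall>y\<in>F. lspan (s y) N \<subseteq> lspan u (card F * N)" by blast
  obtain v where "lspan (s y) N \<union> lspan u (card F * N) \<subseteq> lspan v (N + card F * N)"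
    using lspan_union by blast
  then have "\<forall>z\<in>insert y F. lspan (s z) N \<subseteq> lspan v (N + card F * N)" using u by blast
  then show ?case using insert.hyps by auto
qed simp

definition lin_on :: "('k \<Rightarrow> complex) set \<Rightarrow> (('k \<Rightarrow> complex) \<Rightarrow> complex) \<Rightarrow> bool" where
  "lin_on W c \<longleftrightarrow> (\<forall>v\<in>W. \<forall>w\<in>W. \<forall>a. c (\<lambda>k. v k + a * w k) = c v + a * c w)"

text \<open>The last clause makes \<open>\<nu>\<close> dominate every evaluation: it yields
  nonnegativity and definiteness, and convergence in \<open>\<nu>\<close> implies pointwise
  convergence.\<close>

definition normed_subspace :: "('k \<Rightarrow> complex) set \<Rightarrow> (('k \<Rightarrow> complex) \<Rightarrow> real) \<Rightarrow> bool" where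
  "normed_subspace W \<nu> \<longleftrightarrow> (\<lambda>k. 0) \<in> W \<and>
     (\<forall>v\<in>W. \<forall>w\<in>W. \<forall>a. (\<lambda>k. v k + a * w k) \<in> W \<and> \<nu> (\<lambda>k. v k + a * w k) \<le> \<nu> v + norm a * \<nu> w) \<and>
     (\<forall>w\<in>W. \<forall>a. \<nu> (\<lambda>k. a * w k) = norm a * \<nu> w) \<and>
     (\<forall>w\<in>W. \<forall>k. norm (w k) \<le> \<nu> w)"

lemma normed_subspaceD:
  assumes "normed_subspace W \<nu>"
  shows "(\<lambda>k. 0) \<in> W"
    "\<And>v w a. v \<in> W \<Longrightarrow> w \<in> W \<Longrightarrow> (\<lambda>k. v k + a * w k) \<in> W"
    "\<And>v w a. v \<in> W \<Longrightarrow> w \<in> W \<Longrightarrow> \<nu> (\<lambda>k. v k + a * w k) \<le> \<nu> v + norm a * \<nu> w"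
    "\<And>w a. w \<in> W \<Longrightarrow> (\<lambda>k. a * w k) \<in> W"
    "\<And>w a. w \<in> W \<Longrightarrow> \<nu> (\<lambda>k. a * w k) = norm a * \<nu> w"
    "\<And>w k. w \<in> W \<Longrightarrow> norm (w k) \<le> \<nu> w"
    "\<And>w. w \<in> W \<Longrightarrow> 0 \<le> \<nu> w"
proof -
  show *: "(\<lambda>k. 0) \<in> W" "v \<in> W \<Longrightarrow> w \<in> W \<Longrightarrow> (\<lambda>k. v k + a * w k) \<in> W" for v w a
    using assms unfolding normed_subspace_def by blast+
  show "w \<in> W \<Longrightarrow> (\<lambda>k. a * w k) \<in> W" for a w
    using *(2)[OF *(1), of w a] by simp
  show le: "\<And>w k. w \<in> W \<Longrightarrow> norm (w k) \<le> \<nu> w"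
    and "\<And>v w a. v \<in> W \<Longrightarrow> w \<in> W \<Longrightarrow> \<nu> (\<lambda>k. v k + a * w k) \<le> \<nu> v + norm a * \<nu> w"
    and "\<And>w a. w \<in> W \<Longrightarrow> \<nu> (\<lambda>k. a * w k) = norm a * \<nu> w"
    using assms unfolding normed_subspace_def by blast+
  show "w \<in> W \<Longrightarrow> 0 \<le> \<nu> w" for w
    using le by (meson norm_ge_zero order_trans)
qed

text \<open>A subspace with uniformly bounded coordinate functionals is closed in the ambient normed space;
  only pointwise convergence is needed to identify the limit.\<close>
lemma dist_finite_dim_pos:
  fixes W :: "('k \<Rightarrow> complex) set"
  assumes W: "normed_subspace W \<nu>" and W': "normed_subspace W' \<nu>" "W' \<subseteq> W"
    and w0: "w0 \<in> W" "w0 \<notin> lspan u N"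
    and c: "\<And>i. i < N \<Longrightarrow> lin_on W' (c i)"
    and K: "\<And>i w. i < N \<Longrightarrow> w \<in> W' \<Longrightarrow> norm (c i w) \<le> K * \<nu> w"
    and rep: "\<And>w. w \<in> W' \<Longrightarrow> w = (\<lambda>k. \<Sum>i<N. c i w * u i k)"
  shows "\<exists>\<delta>>0. \<forall>w\<in>W'. \<delta> \<le> \<nu> (\<lambda>k. w0 k + (-1) * w k)"
proof (rule ccontr)
  assume neg: "\<not> ?thesis"
  note ns = normed_subspaceD[OF W] and ns' = normed_subspaceD[OF W'(1)]
  have "\<exists>w\<in>W'. \<nu> (\<lambda>k. w0 k + (-1) * w k) < inverse (real (Suc n))" for n
    using neg by (metis inverse_positive_iff_positive not_le of_nat_0_less_iff zero_less_Suc)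
  then obtain w where w: "\<And>n. w n \<in> W'"
    and close: "\<And>n. \<nu> (\<lambda>k. w0 k + (-1) * w n k) < inverse (real (Suc n))"
    by metis
  have wW: "w n \<in> W" for n using w W'(2) by blast
  have lim0: "(\<lambda>n. \<nu> (\<lambda>k. w0 k + (-1) * w n k)) \<longlonglongrightarrow> 0"
    by (rule real_tendsto_sandwich[OF _ _ tendsto_const LIMSEQ_inverse_real_of_nat])
      (use less_imp_le[OF close] ns(7)[OF ns(2)[OF w0(1) wW, of "-1"]] in simp_all)
  have pt: "(\<lambda>n. w n k) \<longlonglongrightarrow> w0 k" for k
  proof -
    have "norm (w n k - w0 k) \<le> \<nu> (\<lambda>k. w0 k + (-1) * w n k)" for n
      using ns(6)[OF ns(2)[OF w0(1) wW[of n], of "-1"], of k] by (simp add: norm_minus_commute)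
    then have "(\<lambda>n. w n k - w0 k) \<longlonglongrightarrow> 0"
      by (intro Lim_null_comparison[OF _ lim0]) simp
    then show ?thesis by (simp add: LIM_zero_iff)
  qed
  have "convergent (\<lambda>n. c i (w n))" if i: "i < N" for i
  proof (rule Cauchy_convergent, rule CauchyI)
    fix e :: real assume "e > 0"
    \<comment> \<open>The factor 2 comes from comparing \<open>w m\<close> and \<open>w n\<close>
      with each other through \<open>w0\<close>; \<open>\<bar>K\<bar> + 1\<close> replaces
      \<open>K\<close> to have a positive divisor.\<close>
    define L where "L = 2 * (\<bar>K\<bar> + 1)"
    have L: "L > 0" by (simp add: L_def)
    then obtain M where M: "\<And>n. n \<ge> M \<Longrightarrow> norm (\<nu> (\<lambda>k. w0 k + (-1) * w n k) - 0) < e / L"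
      using LIMSEQ_D[OF lim0, of "e / L"] \<open>e > 0\<close> by auto
    have "norm (c i (w m) - c i (w n)) < e" if "m \<ge> M" "n \<ge> M" for m n
    proof -
      have eq: "(\<lambda>k. w m k + (-1) * w n k) = (\<lambda>k. (w0 k + (-1) * w n k) + (-1) * (w0 k + (-1) * w m k))"
        by (simp add: fun_eq_iff)
      have small: "\<nu> (\<lambda>k. w m k + (-1) * w n k) < 2 * (e / L)"
        unfolding eq
        using ns(3)[OF ns(2)[OF w0(1) wW[of n], of "-1"] ns(2)[OF w0(1) wW[of m], of "-1"], of "-1"] M[OF that(1)] M[OF that(2)]
        by simp
      have "c i (w m) - c i (w n) = c i (\<lambda>k. w m k + (-1) * w n k)"
        using c[OF i, unfolded lin_on_def, rule_format, OF w[of m] w[of n], of "-1"] by simp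
      then have "norm (c i (w m) - c i (w n)) \<le> K * \<nu> (\<lambda>k. w m k + (-1) * w n k)"
        using K[OF i ns'(2)[OF w[of m] w[of n], of "-1"]] by simp
      also have "\<dots> \<le> (\<bar>K\<bar> + 1) * \<nu> (\<lambda>k. w m k + (-1) * w n k)"
        using ns'(7)[OF ns'(2)[OF w[of m] w[of n], of "-1"]] by (intro mult_right_mono) auto
      also have "\<dots> < (\<bar>K\<bar> + 1) * (2 * (e / L))"
        using small by (intro mult_strict_left_mono) auto
      also have "\<dots> = e" using L by (simp add: L_def field_simps)
      finally show ?thesis .
    qed
    then show "\<exists>M. \<forall>m\<ge>M. \<forall>n\<ge>M. norm (c i (w m) - c i (w n)) < e" by blast
  qed
  then obtain d where d: "\<And>i. i < N \<Longrightarrow> (\<lambda>n. c i (w n)) \<longlonglongrightarrow> d i"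
    unfolding convergent_def by metis
  have "w0 k = (\<Sum>i<N. d i * u i k)" for k
  proof (rule LIMSEQ_unique[OF pt])
    have "(\<lambda>n. \<Sum>i<N. c i (w n) * u i k) \<longlonglongrightarrow> (\<Sum>i<N. d i * u i k)"
      using d by (intro tendsto_sum tendsto_mult tendsto_const) auto
    moreover have "w n k = (\<Sum>i<N. c i (w n) * u i k)" for n
      using rep[OF w, of n] by metis
    ultimately show "(\<lambda>n. w n k) \<longlonglongrightarrow> (\<Sum>i<N. d i * u i k)" by presburger
  qed
  then have "w0 = (\<lambda>k. \<Sum>i<N. d i * u i k)" by blast
  then show False using w0(2) lspanI by metis
qed

text \<open>A basis is chosen by Riesz' lemma: the new unit vector keeps distance at least 1/2 from
  the span of the previous ones, so its coordinate functional has norm at most 2 and removing the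
  corresponding component costs a factor 3.\<close>
lemma bounded_coordinates:
  fixes W :: "('k \<Rightarrow> complex) set"
  assumes "normed_subspace W \<nu>" "W \<subseteq> lspan s N"
  shows "\<exists>u c. (\<forall>i<N. u i \<in> W \<and> \<nu> (u i) \<le> 1 \<and> lin_on W (c i) \<and>
    (\<forall>w\<in>W. norm (c i w) \<le> 2 * 3 ^ N * \<nu> w)) \<and> (\<forall>w\<in>W. w = (\<lambda>k. \<Sum>i<N. c i w * u i k))"
  using assms
proof (induction N arbitrary: W)
  case 0
  then show ?case by (auto simp: lspan_def)
next
  case (Suc N)
  note ns = normed_subspaceD[OF Suc.prems(1)]
  \<comment> \<open>Dropping the last spanning vector leaves a subspace of codimension at most one
    in \<open>W\<close>, to which the induction hypothesis applies.\<close>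
  define W' where "W' = W \<inter> lspan s N"
  have W'W: "W' \<subseteq> W" by (simp add: W'_def)
  have W': "normed_subspace W' \<nu>"
    unfolding normed_subspace_def
    by (intro conjI ballI allI) (auto simp: W'_def ns(1-6) lspan_lincomb)
  note ns' = normed_subspaceD[OF W']
  have nu0: "\<nu> (\<lambda>k. 0) = 0" using ns(5)[OF ns(1), of 0] by simp
  obtain u c where u: "\<And>i. i < N \<Longrightarrow> u i \<in> W'" "\<And>i. i < N \<Longrightarrow> \<nu> (u i) \<le> 1"
    and c: "\<And>i. i < N \<Longrightarrow> lin_on W' (c i)"
    and K: "\<And>i w. i < N \<Longrightarrow> w \<in> W' \<Longrightarrow> norm (c i w) \<le> 2 * 3 ^ N * \<nu> w"
    and rep: "\<And>w. w \<in> W' \<Longrightarrow> w = (\<lambda>k. \<Sum>i<N. c i w * u i k)"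
    using Suc.IH[OF W'] unfolding W'_def by blast
  show ?case
  proof (cases "W \<subseteq> lspan s N")
    case True
    then have eq: "W' = W" by (auto simp: W'_def)
    have "norm (c i w) \<le> 2 * 3 ^ Suc N * \<nu> w" if "i < N" "w \<in> W" for i w
    proof -
      have "2 * 3 ^ N * \<nu> w \<le> 2 * 3 ^ Suc N * \<nu> w"
        using ns(7)[OF that(2)] by (intro mult_right_mono) auto
      then show ?thesis using K[OF that(1)] that(2) eq by (meson order_trans)
    qed
    \<comment> \<open>The basis of \<open>W'\<close> already serves \<open>W\<close>; the zero
      vector and the zero functional only pad the list to length \<open>Suc N\<close>.\<close>
    moreover have "w = (\<lambda>k. \<Sum>i<Suc N. (c(N := (\<lambda>_. 0))) i w * (u(N := (\<lambda>_. 0))) i k)" if "w \<in> W" for w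
      using rep[of w] that eq by simp
    ultimately show ?thesis
      using u c eq ns(1,7) nu0
      by (intro exI[of _ "u(N := (\<lambda>_. 0))"] exI[of _ "c(N := (\<lambda>_. 0))"]) (auto simp: less_Suc_eq lin_on_def)
  next
    case False
    then obtain w0 where w0: "w0 \<in> W" "w0 \<notin> lspan s N" by blast
    have "u i \<in> lspan s N" if "i < N" for i
      using u(1)[OF that] by (simp add: W'_def)
    then have "lspan u N \<subseteq> lspan s N"
      by (auto elim!: lspanE intro: lspan_sum)
    with w0 have "w0 \<notin> lspan u N" by blast
    then obtain \<delta> where \<delta>: "\<delta> > 0" "\<And>w. w \<in> W' \<Longrightarrow> \<delta> \<le> \<nu> (\<lambda>k. w0 k + (-1) * w k)"
      using dist_finite_dim_pos[OF Suc.prems(1) W' W'W w0(1) _ c K rep] by blast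
    define D where "D = (INF w\<in>W'. \<nu> (\<lambda>k. w0 k + (-1) * w k))"
    have ne: "W' \<noteq> {}" using ns'(1) by blast
    have "D \<ge> \<delta>" unfolding D_def using \<delta>(2) ne by (intro cINF_greatest) auto
    then have D: "D > 0" using \<delta>(1) by simp
    have D_le: "D \<le> \<nu> (\<lambda>k. w0 k + (-1) * w k)" if "w \<in> W'" for w
      unfolding D_def using \<delta> that by (intro cINF_lower bdd_belowI2[of _ \<delta>]) auto
    \<comment> \<open>The distance \<open>D\<close> need not be attained. A point within
      \<open>2 * D\<close> suffices, and after normalisation this factor becomes the
      \<open>1 / 2\<close> of \<open>far_e\<close>.\<close>
    have "\<exists>w1\<in>W'. \<nu> (\<lambda>k. w0 k + (-1) * w1 k) < 2 * D"
    proof (rule ccontr)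
      assume "\<not> ?thesis"
      then have "2 * D \<le> D"
        unfolding D_def[symmetric] by (subst (2) D_def) (intro cINF_greatest ne, force)
      then show False using D by simp
    qed
    then obtain w1 where w1: "w1 \<in> W'" "\<nu> (\<lambda>k. w0 k + (-1) * w1 k) < 2 * D" by blast
    define v where "v = (\<lambda>k. w0 k + (-1) * w1 k)"
    have vW: "v \<in> W" unfolding v_def using w0(1) w1(1) W'W by (intro ns(2)) auto
    have vD: "D \<le> \<nu> v" "\<nu> v < 2 * D" using D_le[OF w1(1)] w1(2) by (simp_all add: v_def)
    have far: "D \<le> \<nu> (\<lambda>k. v k + (-1) * w k)" if "w \<in> W'" for w
    proof -
      have "(\<lambda>k. v k + (-1) * w k) = (\<lambda>k. w0 k + (-1) * (w1 k + 1 * w k))"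
        by (simp add: v_def fun_eq_iff)
      then show ?thesis using D_le[OF ns'(2)[OF w1(1) that, of 1]] by simp
    qed
    define e where "e = (\<lambda>k. of_real (1 / \<nu> v) * v k)"
    have eW: "e \<in> W" unfolding e_def by (rule ns(4)[OF vW])
    have "\<nu> e = norm (of_real (1 / \<nu> v) :: complex) * \<nu> v" unfolding e_def by (rule ns(5)[OF vW])
    then have e1: "\<nu> e = 1" using vD D by (simp add: norm_divide)
    have far_e: "1 / 2 \<le> \<nu> (\<lambda>k. e k + (-1) * w k)" if "w \<in> W'" for w
    proof -
      have eq: "(\<lambda>k. e k + (-1) * w k) = (\<lambda>k. of_real (1 / \<nu> v) * (v k + (-1) * (of_real (\<nu> v) * w k)))"
        using vD D by (simp add: e_def fun_eq_iff field_simps)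
      have w': "(\<lambda>k. of_real (\<nu> v) * w k) \<in> W'" by (rule ns'(4)[OF that])
      then have "\<nu> (\<lambda>k. e k + (-1) * w k)
          = norm (of_real (1 / \<nu> v) :: complex) * \<nu> (\<lambda>k. v k + (-1) * (of_real (\<nu> v) * w k))"
        unfolding eq using W'W by (intro ns(5) ns(2)[OF vW]) auto
      also have "\<dots> = \<nu> (\<lambda>k. v k + (-1) * (of_real (\<nu> v) * w k)) / \<nu> v"
        using vD D by (simp add: norm_divide)
      also have "\<dots> \<ge> D / \<nu> v"
        using far[OF w'] vD D by (intro divide_right_mono) auto
      moreover have "D / \<nu> v \<ge> 1 / 2" using vD D by (simp add: field_simps)
      ultimately show ?thesis by linarith
    qed
    \<comment> \<open>Dividing by \<open>b\<close> reduces this to \<open>far_e\<close>. It says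
      that the coefficient of \<open>e\<close> in \<open>w + b e\<close> is at most twice the norm
      of the sum.\<close>
    have far_scaled: "norm b / 2 \<le> \<nu> (\<lambda>k. w k + b * e k)" if "w \<in> W'" for w b
    proof (cases "b = 0")
      case True
      then show ?thesis using ns'(7)[OF that] by simp
    next
      case b: False
      have w': "(\<lambda>k. (- 1 / b) * w k) \<in> W'" by (rule ns'(4)[OF that])
      have eq: "(\<lambda>k. w k + b * e k) = (\<lambda>k. b * (e k + (-1) * ((- 1 / b) * w k)))"
        using b by (simp add: fun_eq_iff field_simps)
      have "\<nu> (\<lambda>k. w k + b * e k) = norm b * \<nu> (\<lambda>k. e k + (-1) * ((- 1 / b) * w k))"
        unfolding eq using w' W'W by (intro ns(5) ns(2)[OF eW]) auto
      then show ?thesis using mult_left_mono[OF far_e[OF w'], of "norm b"] by simp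
    qed
    have e_notin: "e \<notin> lspan s N"
    proof
      assume "e \<in> lspan s N"
      then have "e \<in> W'" using eW by (simp add: W'_def)
      then show False using far_e[of e] nu0 by simp
    qed
    \<comment> \<open>Elimination of \<open>s N\<close>: its coefficient \<open>y N\<close> in
      \<open>e\<close> is nonzero since \<open>e\<close> is outside \<open>lspan s N\<close>, so
      subtracting \<open>x N / y N\<close> times \<open>e\<close> from \<open>w\<close> removes
      \<open>s N\<close>.\<close>
    have "\<exists>b. (\<lambda>k. w k + (- b) * e k) \<in> W'" if wW: "w \<in> W" for w
    proof -
      obtain x where x: "w = (\<lambda>k. \<Sum>i<Suc N. x i * s i k)" 
        using subsetD[OF Suc.prems(2) wW] by (rule lspanE)
      obtain y where y: "e = (\<lambda>k. \<Sum>i<Suc N. y i * s i k)" 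
        using subsetD[OF Suc.prems(2) eW] by (rule lspanE)
      have "y N \<noteq> 0"
      proof
        assume "y N = 0"
        then have "e \<in> lspan s N" using y lspanI[of y s N] by simp
        then show False using e_notin by simp
      qed
      then have "(\<lambda>k. w k + (- (x N / y N)) * e k) = (\<lambda>k. (\<Sum>i<N. x i * s i k) + (- (x N / y N)) * (\<Sum>i<N. y i * s i k))"
        unfolding x y by (simp add: fun_eq_iff field_simps)
      then have "(\<lambda>k. w k + (- (x N / y N)) * e k) \<in> lspan s N"
        by (simp only: lspan_lincomb[OF lspanI lspanI])
      moreover have "(\<lambda>k. w k + (- (x N / y N)) * e k) \<in> W" by (rule ns(2)[OF wW eW])
      ultimately show ?thesis unfolding W'_def by blast
    qed
    then obtain b where b: "\<And>w. w \<in> W \<Longrightarrow> (\<lambda>k. w k + (- b w) * e k) \<in> W'" by metis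
    define P where "P w = (\<lambda>k. w k + (- b w) * e k)" for w
    have P: "P w \<in> W'" if "w \<in> W" for w using b[OF that] by (simp add: P_def)
    \<comment> \<open>So far \<open>b w\<close> is an arbitrary choice; linearity comes from
      uniqueness. Two candidates differ by a multiple of \<open>e\<close> lying in
      \<open>W'\<close>, and \<open>far_scaled\<close> forces that multiple to vanish.\<close>
    have b_unique: "b w = \<beta>" if "w \<in> W" "(\<lambda>k. w k + (- \<beta>) * e k) \<in> W'" for w \<beta>
    proof -
      have "(\<lambda>k. (w k + (- b w) * e k) + (- 1) * (w k + (- \<beta>) * e k)) \<in> W'"
        by (rule ns'(2)[OF b[OF that(1)] that(2)])
      from far_scaled[OF this, of "b w - \<beta>"] have "norm (b w - \<beta>) \<le> 0"
        using nu0 by (simp add: algebra_simps)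
      then show ?thesis by simp
    qed
    have b_lin: "b (\<lambda>k. x k + a * y k) = b x + a * b y" if "x \<in> W" "y \<in> W" for x y a
    proof (rule b_unique)
      show "(\<lambda>k. x k + a * y k) \<in> W" by (rule ns(2)[OF that])
      have "(\<lambda>k. x k + a * y k + - (b x + a * b y) * e k) = (\<lambda>k. P x k + a * P y k)"
        by (simp add: P_def fun_eq_iff algebra_simps)
      then show "(\<lambda>k. x k + a * y k + - (b x + a * b y) * e k) \<in> W'"
        using ns'(2)[OF P P, OF that, of a] by simp
    qed
    have b_bound: "norm (b w) \<le> 2 * \<nu> w" if "w \<in> W" for w
      using far_scaled[OF P[OF that], of "b w"] by (simp add: P_def)
    have P_lin: "P (\<lambda>k. x k + a * y k) = (\<lambda>k. P x k + a * P y k)" if "x \<in> W" "y \<in> W" for x y a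
      by (simp add: P_def b_lin[OF that] fun_eq_iff algebra_simps)
    \<comment> \<open>The 3 is \<open>1 + 2\<close>, from \<open>w\<close> itself and the component
      \<open>b w\<close> along the unit vector \<open>e\<close>. Each induction step composes the
      old functionals with \<open>P\<close>, whence \<open>3 ^ N\<close>.\<close>
    have P_bound: "\<nu> (P w) \<le> 3 * \<nu> w" if "w \<in> W" for w
      using ns(3)[OF that eW, of "- b w"] b_bound[OF that] e1 by (simp add: P_def)
    define u' where "u' = u(N := e)"
    define c' where "c' i = (if i = N then b else (\<lambda>w. c i (P w)))" for i
    have "u' i \<in> W \<and> \<nu> (u' i) \<le> 1 \<and> lin_on W (c' i) \<and> (\<forall>w\<in>W. norm (c' i w) \<le> 2 * 3 ^ Suc N * \<nu> w)"
      if "i < Suc N" for i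
    proof (cases "i = N")
      case True
      have "norm (b w) \<le> 2 * 3 ^ Suc N * \<nu> w" if "w \<in> W" for w
      proof -
        have "2 * 1 * \<nu> w \<le> 2 * 3 ^ Suc N * \<nu> w"
          using ns(7)[OF that] by (intro mult_right_mono mult_left_mono one_le_power) auto
        then show ?thesis using b_bound[OF that] by linarith
      qed
      then show ?thesis using True eW e1 b_lin by (auto simp: u'_def c'_def lin_on_def)
    next
      case False
      then have i: "i < N" using that by simp
      have "norm (c i (P w)) \<le> 2 * 3 ^ Suc N * \<nu> w" if "w \<in> W" for w
      proof -
        have "norm (c i (P w)) \<le> 2 * 3 ^ N * \<nu> (P w)" by (rule K[OF i P[OF that]])
        also have "\<dots> \<le> 2 * 3 ^ N * (3 * \<nu> w)"
          using P_bound[OF that] by (intro mult_left_mono) auto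
        finally show ?thesis by simp
      qed
      moreover have "lin_on W (\<lambda>w. c i (P w))"
        using c[OF i] P by (auto simp: lin_on_def P_lin)
      ultimately show ?thesis using False u[OF i] W'W by (auto simp: u'_def c'_def)
    qed
    moreover have "w = (\<lambda>k. \<Sum>i<Suc N. c' i w * u' i k)" if "w \<in> W" for w
    proof -
      have "(\<Sum>i<N. c' i w * u' i k) = P w k" for k
      proof -
        have "(\<Sum>i<N. c' i w * u' i k) = (\<Sum>i<N. c i (P w) * u i k)"
          by (intro sum.cong) (auto simp: c'_def u'_def)
        then show ?thesis using rep[OF P[OF that]] by metis
      qed
      then show ?thesis by (simp add: c'_def u'_def P_def fun_eq_iff)
    qed
    ultimately show ?thesis by blast
  qed
qed

section \<open>The operator classes of the theorem\<close>

lemma single_simps: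
  "single cspace y v = (\<lambda>z. if z = y then v else 0)"
  "single (lp_space p) y w = (\<lambda>z. if z = y then w else (\<lambda>k. 0))"
  by (simp_all add: single_def lp_space_def fun_eq_iff)

lemma lp_space_simps [simp]:
  "carr (lp_space p) = lp p" "nrm (lp_space p) = lpnorm p" "zer (lp_space p) = (\<lambda>k. 0)"
  by (simp_all add: lp_space_def)

lemma lp_space_ops:
  "add (lp_space p) v w = (\<lambda>k. v k + w k)" "smul (lp_space p) a w = (\<lambda>k. a * w k)"
  by (simp_all add: lp_space_def)

lemma banach_space_lp_space: "1 \<le> p \<Longrightarrow> banach_space (lp_space p)"
  unfolding lp_space_lpsum by (intro banach_space_lpsum banach_space_cspace)

lemma Cpu_eq:
  assumes p: "1 \<le> p"
  shows "Cpu p = (fpops p cspace cspace :: (('a::metric_space \<Rightarrow> complex) \<Rightarrow> ('a \<Rightarrow> complex)) set)"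
proof -
  have "(\<exists>R. \<forall>x y. mat_coeff T x y \<noteq> 0 \<longrightarrow> dist x y \<le> R) \<longleftrightarrow> (\<exists>R. fprop p cspace cspace R T)"
    if T: "T \<in> bop (lpsum p cspace) (lpsum p cspace)" for T :: "('a \<Rightarrow> complex) \<Rightarrow> ('a \<Rightarrow> complex)"
  proof -
    have coeff: "mat_coeff T x y = T (single cspace y 1) x" for x y
      by (simp add: mat_coeff_def single_simps)
    \<comment> \<open>The fibre is one-dimensional, so the scalar entry, tested at
      \<open>v = 1\<close>, determines \<open>T\<close> on all point masses at
      \<open>y\<close>.\<close>
    have scaled: "T (single cspace y v) x = v * T (single cspace y 1) x" for x y v
    proof -
      have "single cspace y v = smul (lpsum p cspace) v (single cspace y 1)"
        by (auto simp: single_def fun_eq_iff)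
      then show ?thesis
        using bop_smul[OF T lpsum_single[OF p banach_space_cspace, of 1 y], of v] by simp
    qed
    have "fprop p cspace cspace R T" if R: "\<forall>x y. mat_coeff T x y \<noteq> 0 \<longrightarrow> dist x y \<le> R" for R
    proof (rule fpropI_single[OF p banach_space_cspace banach_space_cspace T])
      fix x y v assume "T (single cspace y v) x \<noteq> zer cspace"
      then have "T (single cspace y 1) x \<noteq> 0"
        using scaled[where v = v and x = x and y = y] by auto
      then show "dist x y \<le> R" using R by (simp add: coeff)
    qed
    moreover have "\<forall>x y. mat_coeff T x y \<noteq> 0 \<longrightarrow> dist x y \<le> R" if "fprop p cspace cspace R T" for R
      using fprop_single[OF p banach_space_cspace banach_space_cspace that, of 1] by (simp add: coeff)
    ultimately show ?thesis by blast
  qed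
  then show ?thesis
    unfolding Cpu_def fpops_def lp_space_lpsum by blast
qed

section \<open>Ranks of matrix entries and ranks of rows\<close>

definition row_rank :: "real \<Rightarrow> 'b bspace \<Rightarrow> nat \<Rightarrow> (('a \<Rightarrow> 'b) \<Rightarrow> ('a \<Rightarrow> nat \<Rightarrow> complex)) \<Rightarrow> bool" where
  "row_rank p B N T \<longleftrightarrow> (\<forall>x. \<exists>s. \<forall>h\<in>carr (lpsum p B). T h x \<in> lspan s N)"

definition urops :: "real \<Rightarrow> (('a::metric_space \<Rightarrow> nat \<Rightarrow> complex) \<Rightarrow> ('a \<Rightarrow> nat \<Rightarrow> complex)) set" where
  "urops p = {T \<in> fpops p (lp_space p) (lp_space p). \<exists>N. row_rank p (lp_space p) N T}"

lemma bounded_geometryD: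
  assumes "bounded_geometry (UNIV :: 'a::metric_space set)"
  obtains M where "\<And>x :: 'a. finite (cball x R)" "\<And>x :: 'a. card (cball x R) \<le> M"
proof -
  \<comment> \<open>The propagation bound \<open>R\<close> carries no sign condition, while bounded
    geometry speaks of nonnegative radii.\<close>
  obtain M where M: "\<forall>x\<in>(UNIV :: 'a set). finite (cball x (max R 0) \<inter> UNIV) \<and> card (cball x (max R 0) \<inter> UNIV) \<le> M"
    using assms unfolding bounded_geometry_def by (meson max.cobounded2)
  have "cball x R \<subseteq> cball x (max R 0)" for x :: 'a by auto
  then show ?thesis
    using M that[of M] by (metis Int_UNIV_right UNIV_I card_mono finite_subset le_trans)
qed

text \<open>By finite propagation the row at \<open>x\<close> involves only columns in the ball
  about \<open>x\<close>. There are at most \<open>M\<close> of them, each contributing at most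
  \<open>N\<close> dimensions, which gives row rank \<open>M * N\<close>.\<close>

lemma row_rank_if_matrix:
  fixes T :: "('a::metric_space \<Rightarrow> 'b) \<Rightarrow> ('a \<Rightarrow> nat \<Rightarrow> complex)"
  assumes bg: "bounded_geometry (UNIV :: 'a set)" and p: "1 \<le> p" and B: "banach_space B"
    and T: "T \<in> fpops p B (lp_space p)"
    and N: "\<And>x y. \<exists>s. \<forall>v\<in>carr B. T (single B y v) x \<in> lspan s N"
  shows "\<exists>M. row_rank p B M T"
proof -
  note lp = banach_space_lp_space[OF p]
  obtain R where R: "fprop p B (lp_space p) R T" and Tb: "T \<in> bop (lpsum p B) (lpsum p (lp_space p))"
    using T by (auto simp: fpops_def)
  obtain M where M: "\<And>x :: 'a. finite (cball x R)" "\<And>x :: 'a. card (cball x R) \<le> M"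
    using bounded_geometryD[OF bg] by blast
  have "\<exists>u. \<forall>h\<in>carr (lpsum p B). T h x \<in> lspan u (M * N)" for x
  proof -
    obtain s where s: "\<And>y v. v \<in> carr B \<Longrightarrow> T (single B y v) x \<in> lspan (s y) N"
      using N[of _ x] by metis
    obtain u where u: "\<forall>y\<in>cball x R. lspan (s y) N \<subseteq> lspan u (card (cball x R) * N)"
      using lspan_UN[OF M(1)] by blast
    have "T h x \<in> lspan u (M * N)" if h: "h \<in> carr (lpsum p B)" for h
    proof -
      have "T (restr B (cball x R) h) x \<in> lspan u (M * N)"
      proof (rule bop_restr_induct[OF p B lp Tb h M(1)])
        show "add (lp_space p) v w \<in> lspan u (M * N)" if "v \<in> lspan u (M * N)" "w \<in> lspan u (M * N)" for v w
          using lspan_lincomb[OF that, of 1] by (simp add: lp_space_ops)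
        show "T (single B y (h y)) x \<in> lspan u (M * N)" if "y \<in> cball x R" for y
          using s[OF lpsum_coord[OF h]] u that lspan_pad[OF mult_le_mono1[OF M(2)]] by blast
      qed simp
      then show ?thesis using fprop_restr[OF p B lp Tb R h] by simp
    qed
    then show ?thesis by blast
  qed
  then show ?thesis unfolding row_rank_def by blast
qed

lemma rank_le_iff: "rank_le p S N \<longleftrightarrow> (\<exists>s. \<forall>v\<in>lp p. S v \<in> lspan s N)"
  unfolding rank_le_def lspan_def by (simp add: image_iff)

text \<open>From entries to rows the rank grows by the size of balls; conversely an entry is its row
  restricted to point masses, so the bound is kept.\<close>

lemma UCp_eq:
  assumes bg: "bounded_geometry (UNIV :: 'a::metric_space set)" and p: "1 \<le> p"
  shows "UCp p = (urops p :: (('a \<Rightarrow> nat \<Rightarrow> complex) \<Rightarrow> ('a \<Rightarrow> nat \<Rightarrow> complex)) set)"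
proof -
  note lp = banach_space_lp_space[OF p]
  have coeff: "mat_coeff_v T x y v = T (single (lp_space p) y v) x"
    for T :: "('a \<Rightarrow> nat \<Rightarrow> complex) \<Rightarrow> ('a \<Rightarrow> nat \<Rightarrow> complex)" and x y v
    by (simp add: mat_coeff_v_def single_simps)
  have fprop: "(\<exists>R. \<forall>x y. (\<exists>v\<in>lp p. mat_coeff_v T x y v \<noteq> (\<lambda>k. 0)) \<longrightarrow> dist x y \<le> R)
      \<longleftrightarrow> (\<exists>R. fprop p (lp_space p) (lp_space p) R T)"
    if T: "T \<in> bop (lpsum p (lp_space p)) (lpsum p (lp_space p))"
    for T :: "('a \<Rightarrow> nat \<Rightarrow> complex) \<Rightarrow> ('a \<Rightarrow> nat \<Rightarrow> complex)"
  proof -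
    have "fprop p (lp_space p) (lp_space p) R T"
      if R: "\<forall>x y. (\<exists>v\<in>lp p. mat_coeff_v T x y v \<noteq> (\<lambda>k. 0)) \<longrightarrow> dist x y \<le> R" for R
      by (rule fpropI_single[OF p lp lp T]) (use R in \<open>auto simp: coeff\<close>)
    moreover have "\<forall>x y. (\<exists>v\<in>lp p. mat_coeff_v T x y v \<noteq> (\<lambda>k. 0)) \<longrightarrow> dist x y \<le> R"
      if "fprop p (lp_space p) (lp_space p) R T" for R
      using fprop_single[OF p lp lp that] by (auto simp: coeff)
    ultimately show ?thesis by blast
  qed
  have rank: "(\<exists>N. \<forall>x y. rank_le p (mat_coeff_v T x y) N) \<longleftrightarrow> (\<exists>N. row_rank p (lp_space p) N T)"
    if T: "T \<in> fpops p (lp_space p) (lp_space p)"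
    for T :: "('a \<Rightarrow> nat \<Rightarrow> complex) \<Rightarrow> ('a \<Rightarrow> nat \<Rightarrow> complex)"
  proof
    assume "\<exists>N. \<forall>x y. rank_le p (mat_coeff_v T x y) N"
    then show "\<exists>N. row_rank p (lp_space p) N T"
      using row_rank_if_matrix[OF bg p lp T] by (auto simp: rank_le_iff coeff)
  next
    assume "\<exists>N. row_rank p (lp_space p) N T"
    then obtain N where N: "row_rank p (lp_space p) N T" by blast
    have "rank_le p (mat_coeff_v T x y) N" for x y
    proof -
      obtain s where "\<forall>h\<in>carr (lpsum p (lp_space p)). T h x \<in> lspan s N"
        using N unfolding row_rank_def by blast
      then show ?thesis
        unfolding rank_le_iff coeff by (intro exI[of _ s]) (simp add: lpsum_single[OF p lp])
    qed
    then show "\<exists>N. \<forall>x y. rank_le p (mat_coeff_v T x y) N" by blast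
  qed
  show ?thesis
    unfolding UCp_def urops_def lpv_space_lpsum
    using fprop rank unfolding fpops_def by blast
qed

text \<open>Entries with scalar domain have rank at most 1, so bounded geometry supplies the row
  bound automatically. This is why a product through \<open>\<ell>\<^sup>p(X)\<close> lands in
  \<open>urops\<close>.\<close>

lemma row_rank_column:
  fixes T :: "('a::metric_space \<Rightarrow> complex) \<Rightarrow> ('a \<Rightarrow> nat \<Rightarrow> complex)"
  assumes bg: "bounded_geometry (UNIV :: 'a set)" and p: "1 \<le> p"
    and T: "T \<in> fpops p cspace (lp_space p)"
  shows "\<exists>N. row_rank p cspace N T"
proof (rule row_rank_if_matrix[OF bg p banach_space_cspace T])
  fix x y :: 'a
  have Tb: "T \<in> bop (lpsum p cspace) (lpsum p (lp_space p))" using T by (simp add: fpops_def)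
  have "T (single cspace y v) x \<in> lspan (\<lambda>_. T (single cspace y 1) x) 1" for v
  proof -
    have "single cspace y v = smul (lpsum p cspace) v (single cspace y 1)"
      by (auto simp: single_def fun_eq_iff)
    then have "T (single cspace y v) x = (\<lambda>k. v * T (single cspace y 1) x k)"
      using bop_smul[OF Tb lpsum_single[OF p banach_space_cspace, of 1 y], of v] by (simp add: lp_space_ops)
    then show ?thesis
      using lspanI[of "\<lambda>_. v" "\<lambda>_. T (single cspace y 1) x" 1] by simp
  qed
  then show "\<exists>s. \<forall>v\<in>carr cspace. T (single cspace y v) x \<in> lspan s 1" by blast
qed

lemma subspace_in_urops:
  assumes p: "1 \<le> p"
  shows "subspace_in (bops (lpsum p (lp_space p)) (lpsum p (lp_space p)) (bop (lpsum p (lp_space p)) (lpsum p (lp_space p))))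
    (urops p :: (('a::metric_space \<Rightarrow> nat \<Rightarrow> complex) \<Rightarrow> ('a \<Rightarrow> nat \<Rightarrow> complex)) set)"
proof -
  note lp = banach_space_lp_space[OF p]
  let ?D = "lpsum p (lp_space p) :: ('a \<Rightarrow> nat \<Rightarrow> complex) bspace"
  let ?O = "bops ?D ?D (bop ?D ?D)"
  have "subspace_in ?O (fpops p (lp_space p) (lp_space p))" by (rule subspace_in_fpops[OF p lp lp])
  note sub = this[unfolded subspace_in_def]
  have "zer ?O \<in> urops p"
    using sub by (auto simp: urops_def row_rank_def)
  moreover have "add ?O S T \<in> urops p" if S: "S \<in> urops p" and T: "T \<in> urops p" for S T
  proof -
    obtain N M where N: "row_rank p (lp_space p) N S" and M: "row_rank p (lp_space p) M T"
      using S T unfolding urops_def by blast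
    have "\<exists>u. \<forall>h\<in>carr ?D. add ?O S T h x \<in> lspan u (N + M)" for x
    proof -
      obtain s t where st: "\<forall>h\<in>carr ?D. S h x \<in> lspan s N" "\<forall>h\<in>carr ?D. T h x \<in> lspan t M"
        using N M unfolding row_rank_def by blast
      obtain u where u: "lspan s N \<union> lspan t M \<subseteq> lspan u (N + M)"
        using lspan_union by blast
      have "add ?O S T h x \<in> lspan u (N + M)" if h: "h \<in> carr ?D" for h
        using lspan_lincomb[of "S h x" u "N + M" "T h x" 1] st u h by (auto simp: lp_space_ops)
      then show ?thesis by blast
    qed
    then have "row_rank p (lp_space p) (N + M) (add ?O S T)" unfolding row_rank_def by blast
    moreover have "add ?O S T \<in> fpops p (lp_space p) (lp_space p)" using S T sub by (simp add: urops_def)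
    ultimately show ?thesis by (auto simp: urops_def)
  qed
  moreover have "smul ?O c T \<in> urops p" if T: "T \<in> urops p" for c T
  proof -
    obtain N where N: "row_rank p (lp_space p) N T" using T unfolding urops_def by blast
    have "\<exists>u. \<forall>h\<in>carr ?D. smul ?O c T h x \<in> lspan u N" for x
    proof -
      obtain s where s: "\<forall>h\<in>carr ?D. T h x \<in> lspan s N"
        using N unfolding row_rank_def by blast
      have "smul ?O c T h x \<in> lspan s N" if h: "h \<in> carr ?D" for h
        using lspan_lincomb[OF lspan_zero, of "T h x" s N c] s h by (auto simp: lp_space_ops)
      then show ?thesis by blast
    qed
    then have "row_rank p (lp_space p) N (smul ?O c T)" unfolding row_rank_def by blast
    moreover have "smul ?O c T \<in> fpops p (lp_space p) (lp_space p)" using T sub by (simp add: urops_def)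
    ultimately show ?thesis by (auto simp: urops_def)
  qed
  ultimately show ?thesis
    unfolding subspace_in_def by (auto simp: urops_def fpops_def)
qed

text \<open>The row of a composite has its range inside that of the left factor, so the rank of
  \<open>S\<close> alone decides. This serves both the products within \<open>urops\<close> and the
  pairing with values in it.\<close>

lemma urops_comp:
  assumes p: "1 \<le> p" and B: "banach_space B"
    and S: "S \<in> fpops p B (lp_space p)" and N: "\<exists>N. row_rank p B N S"
    and T: "(T :: ('a::metric_space \<Rightarrow> nat \<Rightarrow> complex) \<Rightarrow> ('a \<Rightarrow> 'b)) \<in> fpops p (lp_space p) B"
  shows "S \<circ> T \<in> urops p"
proof -
  note lp = banach_space_lp_space[OF p]
  obtain N where N: "row_rank p B N S" using N by blast
  have "row_rank p (lp_space p) N (S \<circ> T)"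
    unfolding row_rank_def
  proof
    fix x
    obtain s where s: "\<forall>h\<in>carr (lpsum p B). S h x \<in> lspan s N"
      using N unfolding row_rank_def by blast
    have "T h \<in> carr (lpsum p B)" if "h \<in> carr (lpsum p (lp_space p))" for h
      using T that by (auto simp: fpops_def intro: bop_carr[of T])
    then show "\<exists>s. \<forall>h\<in>carr (lpsum p (lp_space p)). (S \<circ> T) h x \<in> lspan s N"
      using s by auto
  qed
  then show ?thesis
    using fpops_comp[OF p lp B lp S T] by (auto simp: urops_def)
qed

text \<open>The block diagonal operator whose entry at \<open>x\<close> sends 1 to
  \<open>u x\<close>, cut off outside the carrier as \<open>bop\<close> demands.\<close>

definition colop :: "real \<Rightarrow> ('a \<Rightarrow> nat \<Rightarrow> complex) \<Rightarrow> ('a \<Rightarrow> complex) \<Rightarrow> ('a \<Rightarrow> nat \<Rightarrow> complex)" where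
  "colop p u g = (if g \<in> carr (lpsum p cspace) then (\<lambda>x k. g x * u x k) else (\<lambda>x k. 0))"

lemma colop_fpops:
  fixes u :: "'a::metric_space \<Rightarrow> nat \<Rightarrow> complex"
  assumes p: "1 \<le> p" and u: "\<And>x. u x \<in> lp p" "\<And>x. lpnorm p (u x) \<le> 1"
  shows "colop p u \<in> fpops p cspace (lp_space p)"
proof -
  note lp = banach_space_lp_space[OF p]
  let ?D = "lpsum p cspace :: ('a \<Rightarrow> complex) bspace"
  have D: "banach_space ?D" by (rule banach_space_lpsum[OF p banach_space_cspace])
  have carr: "(\<lambda>k. a * u x k) \<in> lp p" for a x
    using bs_smul[OF lp, of "u x" a] u(1) by (simp add: lp_space_ops)
  have nrm: "lpnorm p (\<lambda>k. a * u x k) \<le> 1 * norm a" for a x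
    using bs_nrm_smul[OF lp, of "u x" a] u(1) mult_left_mono[OF u(2), of "norm a" x]
    by (simp add: lp_space_ops)
  have dom: "colop p u g \<in> carr (lpsum p (lp_space p))" "nrm (lpsum p (lp_space p)) (colop p u g) \<le> 1 * nrm ?D g"
    if g: "g \<in> carr ?D" for g
    using lpsum_dominated[OF p g, of "colop p u g" "lp_space p" 1] g carr nrm
    by (simp_all add: colop_def bs_nrm_nonneg[OF lp, simplified])
  have "colop p u \<in> bop ?D (lpsum p (lp_space p))"
  proof (rule bopI[where C = 1])
    fix f g :: "'a \<Rightarrow> complex" and c assume f: "f \<in> carr ?D"
    show "colop p u f \<in> carr (lpsum p (lp_space p))" by (rule dom(1)[OF f])
    show "nrm (lpsum p (lp_space p)) (colop p u f) \<le> 1 * nrm ?D f" by (rule dom(2)[OF f])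
    have "smul ?D c f \<in> carr ?D" by (rule bs_smul[OF D f])
    then show "colop p u (smul ?D c f) = smul (lpsum p (lp_space p)) c (colop p u f)"
      unfolding colop_def if_P[OF f] by (auto simp: lp_space_ops fun_eq_iff)
    assume g: "g \<in> carr ?D"
    have "add ?D f g \<in> carr ?D" by (rule bs_add[OF D f g])
    then show "colop p u (add ?D f g) = add (lpsum p (lp_space p)) (colop p u f) (colop p u g)"
      unfolding colop_def if_P[OF f] if_P[OF g] by (auto simp: lp_space_ops fun_eq_iff algebra_simps)
  qed (auto simp: colop_def fun_eq_iff)
  moreover have "fprop p cspace (lp_space p) 0 (colop p u)"
    unfolding fprop_def by (auto simp: colop_def)
  ultimately show ?thesis by (auto simp: fpops_def)
qed

text \<open>The functionals \<open>\<phi> x\<close> are available only on the values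
  \<open>T h x\<close>, which is why they are composed with \<open>T\<close> instead of being made
  into a block diagonal operator of their own.\<close>

definition rowop ::
  "real \<Rightarrow> ('a \<Rightarrow> (nat \<Rightarrow> complex) \<Rightarrow> complex) \<Rightarrow> (('a \<Rightarrow> nat \<Rightarrow> complex) \<Rightarrow> ('a \<Rightarrow> nat \<Rightarrow> complex)) \<Rightarrow>
   ('a \<Rightarrow> nat \<Rightarrow> complex) \<Rightarrow> 'a \<Rightarrow> complex" where
  "rowop p \<phi> T h = (if h \<in> carr (lpsum p (lp_space p)) then (\<lambda>x. \<phi> x (T h x)) else (\<lambda>x. 0))"

lemma rowop_fpops:
  fixes T :: "('a::metric_space \<Rightarrow> nat \<Rightarrow> complex) \<Rightarrow> ('a \<Rightarrow> nat \<Rightarrow> complex)"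
  assumes p: "1 \<le> p" and T: "T \<in> fpops p (lp_space p) (lp_space p)" and K: "0 \<le> K"
    and lin: "\<And>x. lin_on {T h x |h. h \<in> carr (lpsum p (lp_space p))} (\<phi> x)"
    and bound: "\<And>x h. h \<in> carr (lpsum p (lp_space p)) \<Longrightarrow> norm (\<phi> x (T h x)) \<le> K * lpnorm p (T h x)"
  shows "rowop p \<phi> T \<in> fpops p (lp_space p) cspace"
proof -
  note lp = banach_space_lp_space[OF p]
  let ?D = "lpsum p (lp_space p) :: ('a \<Rightarrow> nat \<Rightarrow> complex) bspace"
  let ?E = "lpsum p cspace :: ('a \<Rightarrow> complex) bspace"
  have D: "banach_space ?D" by (rule banach_space_lpsum[OF p lp])
  obtain R where R: "fprop p (lp_space p) (lp_space p) R T" and Tb: "T \<in> bop ?D ?D"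
    using T by (auto simp: fpops_def)
  have nrm0: "lpnorm p (\<lambda>k. 0) = 0" using bs_nrm_zer[OF lp] by simp
  have T0: "T (zer ?D) x = (\<lambda>k. 0)" for x
    using bop_zer[OF D D Tb] by simp
  have lin': "\<phi> x (\<lambda>k. T f x k + a * T g x k) = \<phi> x (T f x) + a * \<phi> x (T g x)"
    if "f \<in> carr ?D" "g \<in> carr ?D" for x f g a
    using lin[of x] that unfolding lin_on_def by blast
  \<comment> \<open>The bound at the zero function forces this value. Homogeneity below then writes
    \<open>T (c f)\<close> as \<open>T 0 + c T f\<close>, to fit the affine shape of
    \<open>lin_on\<close>.\<close>
  have phi0: "\<phi> x (\<lambda>k. 0) = 0" for x
    using bound[OF bs_zer[OF D], of x] by (simp only: T0 nrm0) simp
  have dom: "(\<lambda>x. \<phi> x (T h x)) \<in> carr ?E" "nrm ?E (\<lambda>x. \<phi> x (T h x)) \<le> K * nrm ?D (T h)"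
    if h: "h \<in> carr ?D" for h
    using lpsum_dominated[OF p bop_carr[OF Tb h], of "\<lambda>x. \<phi> x (T h x)" cspace K]
      K bound[OF h] lpsum_coord[OF bop_carr[OF Tb h]]
    by (simp_all add: bs_nrm_nonneg[OF lp, simplified])
  have "rowop p \<phi> T \<in> bop ?D ?E"
  proof (rule bopI[where C = "K * opnorm ?D ?D T"])
    fix f g :: "'a \<Rightarrow> nat \<Rightarrow> complex" and c assume f: "f \<in> carr ?D"
    show "rowop p \<phi> T f \<in> carr ?E" using dom(1)[OF f] f by (simp add: rowop_def)
    have "nrm ?E (rowop p \<phi> T f) \<le> K * nrm ?D (T f)" using dom(2)[OF f] f by (simp add: rowop_def)
    also have "\<dots> \<le> K * (opnorm ?D ?D T * nrm ?D f)"
      by (rule mult_left_mono[OF opnorm_upper[OF D D Tb f] K])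
    finally show "nrm ?E (rowop p \<phi> T f) \<le> K * opnorm ?D ?D T * nrm ?D f" by (simp add: mult.assoc)
    have c: "smul ?D c f \<in> carr ?D" by (rule bs_smul[OF D f])
    have "T (smul ?D c f) x = (\<lambda>k. T (zer ?D) x k + c * T f x k)" for x
      unfolding T0 bop_smul[OF Tb f] by (simp add: lp_space_ops)
    then have "\<phi> x (T (smul ?D c f) x) = c * \<phi> x (T f x)" for x
      using lin'[OF bs_zer[OF D] f, of x c] phi0[of x] unfolding T0 by simp
    then show "rowop p \<phi> T (smul ?D c f) = smul ?E c (rowop p \<phi> T f)"
      unfolding rowop_def if_P[OF f] if_P[OF c] by (simp add: fun_eq_iff)
    assume g: "g \<in> carr ?D"
    have fg: "add ?D f g \<in> carr ?D" by (rule bs_add[OF D f g])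
    have "T (add ?D f g) x = (\<lambda>k. T f x k + 1 * T g x k)" for x
      unfolding bop_add[OF Tb f g] by (simp add: lp_space_ops)
    then have "\<phi> x (T (add ?D f g) x) = \<phi> x (T f x) + \<phi> x (T g x)" for x
      using lin'[OF f g, of x 1] by simp
    then show "rowop p \<phi> T (add ?D f g) = add ?E (rowop p \<phi> T f) (rowop p \<phi> T g)"
      unfolding rowop_def if_P[OF f] if_P[OF g] if_P[OF fg] by (simp add: fun_eq_iff)
  qed (auto simp: rowop_def fun_eq_iff)
  moreover have "fprop p (lp_space p) cspace R (rowop p \<phi> T)"
    unfolding fprop_def
  proof (intro ballI allI impI)
    fix f :: "'a \<Rightarrow> nat \<Rightarrow> complex" and x
    assume f: "f \<in> carr ?D" and z: "\<forall>y. dist x y \<le> R \<longrightarrow> f y = zer (lp_space p)"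
    have "T f x = zer (lp_space p)" by (rule fpropD[OF R f]) (use z in blast)
    then show "rowop p \<phi> T f x = zer cspace" using f phi0 by (simp add: rowop_def)
  qed
  ultimately show ?thesis by (auto simp: fpops_def)
qed

text \<open>Bounding the rank of whole rows instead of single matrix entries makes the factorisation
  global: no decomposition of the operator into partial translations is needed.\<close>
lemma urops_factor:
  fixes T :: "('a::metric_space \<Rightarrow> nat \<Rightarrow> complex) \<Rightarrow> ('a \<Rightarrow> nat \<Rightarrow> complex)"
  assumes p: "1 \<le> p" and T: "T \<in> urops p"
  obtains N :: nat and e f where
    "\<And>i. i < N \<Longrightarrow> e i \<in> fpops p cspace (lp_space p)"
    "\<And>i. i < N \<Longrightarrow> f i \<in> fpops p (lp_space p) cspace"
    "\<And>h x k. h \<in> carr (lpsum p (lp_space p)) \<Longrightarrow> T h x k = (\<Sum>i<N. e i (f i h) x k)"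
proof -
  note lp = banach_space_lp_space[OF p]
  let ?D = "lpsum p (lp_space p) :: ('a \<Rightarrow> nat \<Rightarrow> complex) bspace"
  have D: "banach_space ?D" by (rule banach_space_lpsum[OF p lp])
  have Tf: "T \<in> fpops p (lp_space p) (lp_space p)" using T by (simp add: urops_def)
  then have Tb: "T \<in> bop ?D ?D" by (simp add: fpops_def)
  obtain N where N: "row_rank p (lp_space p) N T" using T by (auto simp: urops_def)
  define W where "W x = {T h x |h. h \<in> carr ?D}" for x
  have W: "normed_subspace (W x) (lpnorm p)" for x
    unfolding normed_subspace_def
  proof (intro conjI ballI allI)
    have "T (zer ?D) x = (\<lambda>k. 0)" unfolding bop_zer[OF D D Tb] by simp
    then show "(\<lambda>k. 0) \<in> W x" using bs_zer[OF D] unfolding W_def by (metis (mono_tags, lifting) mem_Collect_eq)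
    fix v w a assume v: "v \<in> W x" and w: "w \<in> W x"
    obtain f g where f: "f \<in> carr ?D" "v = T f x" and g: "g \<in> carr ?D" "w = T g x"
      using v w by (auto simp: W_def)
    have vw: "v \<in> lp p" "w \<in> lp p"
      using lpsum_coord[OF bop_carr[OF Tb f(1)], of x] lpsum_coord[OF bop_carr[OF Tb g(1)], of x] f g by auto
    have "T (add ?D f (smul ?D a g)) x = (\<lambda>k. v k + a * w k)"
      unfolding bop_add[OF Tb f(1) bs_smul[OF D g(1)]] bop_smul[OF Tb g(1)]
      by (simp add: lp_space_ops f g)
    then show "(\<lambda>k. v k + a * w k) \<in> W x"
      using bs_add[OF D f(1) bs_smul[OF D g(1)]] unfolding W_def by (metis (mono_tags, lifting) mem_Collect_eq)
    show "lpnorm p (\<lambda>k. v k + a * w k) \<le> lpnorm p v + norm a * lpnorm p w"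
      using bs_nrm_add[OF lp, of v "smul (lp_space p) a w"] bs_smul[OF lp, of w a] bs_nrm_smul[OF lp, of w a] vw
      by (simp add: lp_space_ops)
  next
    fix w a k assume "w \<in> W x"
    then have w: "w \<in> lp p" using lpsum_coord[OF bop_carr[OF Tb]] by (auto simp: W_def)
    then show "lpnorm p (\<lambda>k. a * w k) = norm a * lpnorm p w"
      using bs_nrm_smul[OF lp, of w a] by (simp add: lp_space_ops)
    show "norm (w k) \<le> lpnorm p w"
      using lpsum_nrm_coord[OF p, of w cspace k] w
      by (simp add: lp_space_lpsum[symmetric])
  qed
  define coords where "coords x u c \<longleftrightarrow> (\<forall>i<N. u i \<in> W x \<and> lpnorm p (u i) \<le> 1 \<and> lin_on (W x) (c i) \<and>
      (\<forall>w\<in>W x. norm (c i w) \<le> 2 * 3 ^ N * lpnorm p w)) \<and> (\<forall>w\<in>W x. w = (\<lambda>k. \<Sum>i<N. c i w * u i k))"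
    for x u c
  have "\<exists>u c. coords x u c" for x
  proof -
    obtain s where "W x \<subseteq> lspan s N" using N unfolding row_rank_def W_def by blast
    then show ?thesis unfolding coords_def by (rule bounded_coordinates[OF W])
  qed
  then obtain u c where coords: "\<And>x. coords x (u x) (c x)" by metis
  have u: "u x i \<in> W x" "lpnorm p (u x i) \<le> 1" and c: "lin_on (W x) (c x i)"
    and K: "\<And>w. w \<in> W x \<Longrightarrow> norm (c x i w) \<le> 2 * 3 ^ N * lpnorm p w" if "i < N" for x i
    using coords[of x] that unfolding coords_def by blast+
  have rep: "w = (\<lambda>k. \<Sum>i<N. c x i w * u x i k)" if "w \<in> W x" for x w
    using coords[of x] that unfolding coords_def by blast
  show ?thesis
  proof (rule that)
    show "colop p (\<lambda>x. u x i) \<in> fpops p cspace (lp_space p)" if "i < N" for i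
    proof (rule colop_fpops[OF p _ u(2)[OF that]])
      show "u x i \<in> lp p" for x
      proof -
        obtain h where "h \<in> carr ?D" "u x i = T h x"
          using u(1)[OF \<open>i < N\<close>, of x] unfolding W_def by blast
        then show ?thesis using lpsum_coord[OF bop_carr[OF Tb], of h x] by simp
      qed
    qed
    \<comment> \<open>The constant is the same for all \<open>x\<close>, as
      \<open>rowop_fpops\<close> requires of \<open>K\<close>.\<close>
    show row: "rowop p (\<lambda>x. c x i) T \<in> fpops p (lp_space p) cspace" if "i < N" for i
      using c[OF that] K[OF that] by (intro rowop_fpops[OF p Tf, of "2 * 3 ^ N"]) (auto simp: W_def)
    fix h :: "'a \<Rightarrow> nat \<Rightarrow> complex" and x k
    assume h: "h \<in> carr ?D"
    have "T h x \<in> W x" using h unfolding W_def by blast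
    then have "T h x k = (\<Sum>i<N. c x i (T h x) * u x i k)" by (rule fun_cong[OF rep])
    also have "\<dots> = (\<Sum>i<N. colop p (\<lambda>x. u x i) (rowop p (\<lambda>x. c x i) T h) x k)"
    proof (rule sum.cong)
      fix i assume "i \<in> {..<N}"
      then have "rowop p (\<lambda>x. c x i) T h \<in> carr (lpsum p cspace)"
        using bop_carr[OF _ h] row by (auto simp: fpops_def)
      then show "c x i (T h x) * u x i k = colop p (\<lambda>x. u x i) (rowop p (\<lambda>x. c x i) T h) x k"
        using h by (simp add: colop_def rowop_def)
    qed simp
    finally show "T h x k = (\<Sum>i<N. colop p (\<lambda>x. u x i) (rowop p (\<lambda>x. c x i) T h) x k)" .
  qed
qed

section \<open>Morita equivalence\<close>

text \<open>\<open>op_alg\<close> lives in the record type extended by \<open>mul\<close>, so it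
  cannot be equated with \<open>bops V V S\<close>. The predicates see only selectors, and these
  agree.\<close>

lemma op_alg_sel:
  "carr (op_alg V S) = carr (bops V V S)" "add (op_alg V S) = add (bops V V S)"
  "smul (op_alg V S) = smul (bops V V S)" "zer (op_alg V S) = zer (bops V V S)"
  "nrm (op_alg V S) = nrm (bops V V S)" "vdiff (op_alg V S) = vdiff (bops V V S)"
  "mul (op_alg V S) = (\<circ>)"
  by (simp_all add: op_alg_def bops_def fun_eq_iff vdiff_def)

lemma banach_space_op_alg: "banach_space (op_alg V S) \<longleftrightarrow> banach_space (bops V V S)"
  unfolding banach_space_def op_alg_sel ..

lemma bbil_op_alg_left: "bbil (op_alg V S) F G m \<longleftrightarrow> bbil (bops V V S) F G m"
  unfolding bbil_def op_alg_sel ..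

lemma bbil_op_alg_right: "bbil E (op_alg V S) G m \<longleftrightarrow> bbil E (bops V V S) G m"
  unfolding bbil_def op_alg_sel ..

lemma bbil_op_alg_target: "bbil E F (op_alg V S) m \<longleftrightarrow> bbil E F (bops V V S) m"
  unfolding bbil_def op_alg_sel ..

section \<open>Closures of operator classes as algebras and bimodules\<close>

definition opcl :: "'v bspace \<Rightarrow> 'w bspace \<Rightarrow> ('v \<Rightarrow> 'w) set \<Rightarrow> ('v \<Rightarrow> 'w) bspace" where
  "opcl V W S = bops V W (closure_in (bops V W (bop V W)) S)"

lemma opcl_update: "opcl V W S = (bops V W (bop V W))\<lparr>carr := closure_in (bops V W (bop V W)) S\<rparr>"
  by (simp add: opcl_def bops_def)

lemma op_closure_eq: "op_closure V S = closure_in (bops V V (bop V V)) S"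
proof -
  have "vdiff (bops V V S) = vdiff (bops V V (bop V V))" by (intro ext) simp
  then show ?thesis unfolding op_closure_def closure_in_def op_alg_sel by simp
qed

lemma bbil_opcl:
  assumes "banach_space U" "banach_space V" "banach_space W"
    and "S \<subseteq> bop V W" "T \<subseteq> bop U V" "\<And>s t. s \<in> S \<Longrightarrow> t \<in> T \<Longrightarrow> s \<circ> t \<in> Q"
  shows "bbil (opcl V W S) (opcl U V T) (opcl U W Q) (\<circ>)"
  unfolding opcl_update
  by (rule bbil_closure_in[OF bbil_comp]) (use assms banach_space_bops in auto)

lemma bbil_carr: "bbil E F G m \<Longrightarrow> e \<in> carr E \<Longrightarrow> f \<in> carr F \<Longrightarrow> m e f \<in> carr G"
  by (simp add: bbil_def)

lemma left_bmoduleI: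
  assumes "banach_space E" "bbil B E E act"
    and "\<And>b b' e. b \<in> carr B \<Longrightarrow> b' \<in> carr B \<Longrightarrow> e \<in> carr E \<Longrightarrow> act (mul B b b') e = act b (act b' e)"
  shows "left_bmodule B E act"
  using assms unfolding left_bmodule_def bbil_def by simp

lemma right_bmoduleI:
  assumes "banach_space E" "bbil E B E act"
    and "\<And>b b' e. b \<in> carr B \<Longrightarrow> b' \<in> carr B \<Longrightarrow> e \<in> carr E \<Longrightarrow> act e (mul B b b') = act (act e b) b'"
  shows "right_bmodule B E act"
  using assms unfolding right_bmodule_def bbil_def by (simp add: mult.commute)

lemma banach_algebraI:
  assumes "banach_space A" "bbil A A A (mul A)"
    and "\<And>x y z. x \<in> carr A \<Longrightarrow> y \<in> carr A \<Longrightarrow> z \<in> carr A \<Longrightarrow> mul A (mul A x y) z = mul A x (mul A y z)"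
  shows "banach_algebra A"
  using assms unfolding banach_algebra_def bbil_def by simp

lemma banach_pairI:
  assumes "left_bmodule B El lB" "right_bmodule B Er rB" "bbil El Er B pr"
    and "\<And>b e f. b \<in> carr B \<Longrightarrow> e \<in> carr El \<Longrightarrow> f \<in> carr Er \<Longrightarrow> pr (lB b e) f = mul B b (pr e f)"
    and "\<And>b e f. b \<in> carr B \<Longrightarrow> e \<in> carr El \<Longrightarrow> f \<in> carr Er \<Longrightarrow> pr e (rB f b) = mul B (pr e f) b"
  shows "banach_pair B El Er lB rB pr"
  using assms unfolding banach_pair_def bbil_def by simp

lemma gspan_superset:
  assumes "banach_space V" "x \<in> carr V" "x \<in> S"
  shows "x \<in> gspan V S"
proof -
  have "lincomb V (\<lambda>_. 1) (\<lambda>_. x) (Suc 0) = x"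
    using assms by (simp add: bs_smul_1 bs_zer_add)
  from this[symmetric] show ?thesis
    unfolding gspan_def using assms(3) by blast
qed

lemma span_denseI:
  assumes V: "banach_space V" and S: "\<And>x. x \<in> carr V \<Longrightarrow> x \<in> S"
  shows "span_dense V S"
  unfolding span_dense_def
proof (intro ballI allI impI)
  fix x and e :: real assume x: "x \<in> carr V" and "0 < e"
  then have "nrm V (vdiff V x x) < e" by (simp add: bs_vdiff_self[OF V] bs_nrm_zer[OF V])
  then show "\<exists>y\<in>gspan V S. nrm V (vdiff V x y) < e"
    using gspan_superset[OF V x S[OF x]] by blast
qed

text \<open>Associativity of composition settles all algebraic identities, and \<open>f0\<close>,
  \<open>e0\<close> make elements of the closures exact products. Fullness over the second algebra
  is the one analytic input; it is assumed for \<open>S\<close> only and reaches the closure by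
  density.\<close>

lemma morita_equivalence_opcl:
  fixes V :: "'v bspace" and W :: "'w bspace"
  assumes V: "banach_space V" and W: "banach_space W"
    and VV: "subspace_in (bops V V (bop V V)) P" and VW: "subspace_in (bops V W (bop V W)) Q"
    and WV: "subspace_in (bops W V (bop W V)) R" and WW: "subspace_in (bops W W (bop W W)) S"
    and comp: "\<And>a a'. a \<in> P \<Longrightarrow> a' \<in> P \<Longrightarrow> a \<circ> a' \<in> P" "\<And>b b'. b \<in> S \<Longrightarrow> b' \<in> S \<Longrightarrow> b \<circ> b' \<in> S"
      "\<And>e a. e \<in> Q \<Longrightarrow> a \<in> P \<Longrightarrow> e \<circ> a \<in> Q" "\<And>b e. b \<in> S \<Longrightarrow> e \<in> Q \<Longrightarrow> b \<circ> e \<in> Q"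
      "\<And>a f. a \<in> P \<Longrightarrow> f \<in> R \<Longrightarrow> a \<circ> f \<in> R" "\<And>f b. f \<in> R \<Longrightarrow> b \<in> S \<Longrightarrow> f \<circ> b \<in> R"
      "\<And>e f. e \<in> Q \<Longrightarrow> f \<in> R \<Longrightarrow> e \<circ> f \<in> S" "\<And>f e. f \<in> R \<Longrightarrow> e \<in> Q \<Longrightarrow> f \<circ> e \<in> P"
    and e0: "e0 \<in> Q" and f0: "f0 \<in> R" and unit: "\<And>h. h \<in> carr V \<Longrightarrow> f0 (e0 h) = h"
    and full: "\<And>T. T \<in> S \<Longrightarrow> T \<in> gspan (op_alg W (op_closure W S)) {e \<circ> f |e f. e \<in> Q \<and> f \<in> R}"
  shows "morita_equivalence (op_alg V (op_closure V P)) (op_alg W (op_closure W S))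
    (opcl V W Q) (opcl W V R) (\<circ>) (\<circ>) (\<circ>) (\<circ>) (\<circ>) (\<circ>)"
proof -
  let ?A = "op_alg V (op_closure V P)" and ?B = "op_alg W (op_closure W S)"
  let ?El = "opcl V W Q" and ?Er = "opcl W V R"
  have sub: "P \<subseteq> bop V V" "Q \<subseteq> bop V W" "R \<subseteq> bop W V" "S \<subseteq> bop W W"
    using VV VW WV WW by (simp_all add: subspace_in_def)
  have A_eq: "bops V V (op_closure V P) = opcl V V P" and B_eq: "bops W W (op_closure W S) = opcl W W S"
    by (simp_all add: op_closure_eq opcl_def)
  note alg = bbil_op_alg_left bbil_op_alg_right bbil_op_alg_target banach_space_op_alg op_alg_sel A_eq B_eq
  have A: "banach_space ?A" and B: "banach_space ?B" and El: "banach_space ?El" and Er: "banach_space ?Er"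
    unfolding alg opcl_update
    using V W VV VW WV WW by (simp_all add: banach_space_closure_in banach_space_bops)
  have bb: "bbil ?A ?A ?A (\<circ>)" "bbil ?B ?B ?B (\<circ>)" "bbil ?B ?El ?El (\<circ>)" "bbil ?El ?A ?El (\<circ>)"
    "bbil ?A ?Er ?Er (\<circ>)" "bbil ?Er ?B ?Er (\<circ>)" "bbil ?El ?Er ?B (\<circ>)" "bbil ?Er ?El ?A (\<circ>)"
    unfolding alg by (rule bbil_opcl; (rule V W sub | erule (1) comp))+
  have mul: "mul ?A = (\<circ>)" "mul ?B = (\<circ>)" by (simp_all add: op_alg_sel)
  have algs: "banach_algebra ?A" "banach_algebra ?B"
    by (rule banach_algebraI; use A B bb in \<open>simp add: mul comp_assoc\<close>)+
  have mods: "left_bmodule ?B ?El (\<circ>)" "right_bmodule ?B ?Er (\<circ>)" "right_bmodule ?A ?El (\<circ>)" "left_bmodule ?A ?Er (\<circ>)"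
    by (rule left_bmoduleI right_bmoduleI; use El Er bb in \<open>simp add: mul comp_assoc\<close>)+
  have pairs: "banach_pair ?B ?El ?Er (\<circ>) (\<circ>) (\<circ>)" "banach_pair ?A ?Er ?El (\<circ>) (\<circ>) (\<circ>)"
    by (rule banach_pairI; use mods bb in \<open>simp add: mul comp_assoc\<close>)+
  have ab: "ab_pair ?A ?B ?El ?Er (\<circ>) (\<circ>) (\<circ>) (\<circ>) (\<circ>)" "ab_pair ?B ?A ?Er ?El (\<circ>) (\<circ>) (\<circ>) (\<circ>) (\<circ>)"
    unfolding ab_pair_def using pairs mods by (simp_all add: comp_assoc)
  have carr_sub: "carr ?A \<subseteq> bop V V" "carr ?El \<subseteq> bop V W" "carr ?Er \<subseteq> bop W V"
    by (auto simp: alg opcl_def closure_in_def)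
  have cl: "P \<subseteq> carr ?A" "Q \<subseteq> carr ?El" "R \<subseteq> carr ?Er" "S \<subseteq> carr ?B"
    unfolding alg opcl_def bops_simps
    using sub V W by (auto intro!: subset_closure_in[THEN subsetD] banach_space_bops)
  have e0c: "e0 \<in> carr ?El" and f0c: "f0 \<in> carr ?Er" using e0 f0 cl by blast+
  have unit_left: "f0 \<circ> (e0 \<circ> T) = T" if "T \<in> bop U V" "banach_space U" for T :: "'u \<Rightarrow> 'v" and U
  proof
    fix h
    have "T h \<in> carr V"
      using bop_carr[OF that(1), of h] bop_out[OF that(1), of h] bs_zer[OF V] by (cases "h \<in> carr U") auto
    then show "(f0 \<circ> (e0 \<circ> T)) h = T h" using unit by simp
  qed
  \<comment> \<open>Off \<open>carr V\<close> the map \<open>f0 \<circ> e0\<close> returns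
    \<open>zer V\<close> instead of \<open>h\<close>, so this case is separate; both sides equal
    \<open>zer U\<close> there.\<close>
  have unit_right: "(T \<circ> f0) \<circ> e0 = T" if T: "T \<in> bop V U" "banach_space U" for T :: "'v \<Rightarrow> 'u" and U
  proof
    fix h
    show "((T \<circ> f0) \<circ> e0) h = T h"
    proof (cases "h \<in> carr V")
      case False
      have "e0 h = zer W" "f0 (zer W) = zer V" "T (zer V) = zer U"
        using False e0 f0 sub bop_out[of e0 V W h] bop_zer[OF W V, of f0] bop_zer[OF V T(2,1)] by auto
      then show ?thesis using bop_out[OF T(1) False] by simp
    qed (simp add: unit)
  qed
  have dens: "span_dense ?El {b \<circ> e |b e. b \<in> carr ?B \<and> e \<in> carr ?El}"
  proof (rule span_denseI[OF El])
    fix T assume T: "T \<in> carr ?El"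
    then have "T = (T \<circ> f0) \<circ> e0" using unit_right[OF _ W, of T] carr_sub by auto
    \<comment> \<open>\<open>T\<close> may be a limit of elements of \<open>Q\<close>; the pairing
      has already been extended to closures, so \<open>T \<circ> f0\<close> still lies in the
      algebra.\<close>
    moreover have "T \<circ> f0 \<in> carr ?B" by (rule bbil_carr[OF bb(7) T f0c])
    ultimately show "T \<in> {b \<circ> e |b e. b \<in> carr ?B \<and> e \<in> carr ?El}" using e0c by blast
  qed
  moreover have "span_dense ?Er {f \<circ> b |f b. f \<in> carr ?Er \<and> b \<in> carr ?B}"
  proof (rule span_denseI[OF Er])
    fix T assume T: "T \<in> carr ?Er"
    then have "T = f0 \<circ> (e0 \<circ> T)" using unit_left[OF _ W, of T] carr_sub by auto
    moreover have "e0 \<circ> T \<in> carr ?B" by (rule bbil_carr[OF bb(7) e0c T])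
    ultimately show "T \<in> {f \<circ> b |f b. f \<in> carr ?Er \<and> b \<in> carr ?B}" using f0c by blast
  qed
  moreover have "span_dense ?Er {a \<circ> f |a f. a \<in> carr ?A \<and> f \<in> carr ?Er}"
  proof (rule span_denseI[OF Er])
    fix T assume T: "T \<in> carr ?Er"
    then have "T = (f0 \<circ> e0) \<circ> T" using unit_left[OF _ W, of T] carr_sub by (auto simp: comp_assoc)
    moreover have "f0 \<circ> e0 \<in> carr ?A" by (rule bbil_carr[OF bb(8) f0c e0c])
    ultimately show "T \<in> {a \<circ> f |a f. a \<in> carr ?A \<and> f \<in> carr ?Er}" using T by blast
  qed
  moreover have "span_dense ?El {e \<circ> a |e a. e \<in> carr ?El \<and> a \<in> carr ?A}"
  proof (rule span_denseI[OF El])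
    fix T assume T: "T \<in> carr ?El"
    then have "T = T \<circ> (f0 \<circ> e0)" using unit_right[OF _ W, of T] carr_sub by (auto simp: comp_assoc)
    moreover have "f0 \<circ> e0 \<in> carr ?A" by (rule bbil_carr[OF bb(8) f0c e0c])
    ultimately show "T \<in> {e \<circ> a |e a. e \<in> carr ?El \<and> a \<in> carr ?A}" using T by blast
  qed
  moreover have "span_dense ?A {f \<circ> e |f e. f \<in> carr ?Er \<and> e \<in> carr ?El}"
  proof (rule span_denseI[OF A])
    fix T assume T: "T \<in> carr ?A"
    then have "T = f0 \<circ> (e0 \<circ> T)" using unit_left[OF _ V, of T] carr_sub by auto
    moreover have "e0 \<circ> T \<in> carr ?El" by (rule bbil_carr[OF bb(4) e0c T])
    ultimately show "T \<in> {f \<circ> e |f e. f \<in> carr ?Er \<and> e \<in> carr ?El}" using f0c by blast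
  qed
  moreover have "span_dense ?B {e \<circ> f |e f. e \<in> carr ?El \<and> f \<in> carr ?Er}"
    unfolding span_dense_def
  proof (intro ballI allI impI)
    fix T and r :: real assume T: "T \<in> carr ?B" and "0 < r"
    \<comment> \<open>Differences do not depend on the carrier stored in the record, so the
      approximant obtained in all of \<open>bop W W\<close> is also one in
      \<open>?B\<close>.\<close>
    have "vdiff ?B = vdiff (bops W W (bop W W))"
      unfolding op_alg_sel by (intro ext) simp
    then obtain T' where T': "T' \<in> S" "nrm ?B (vdiff ?B T T') < r"
      using T \<open>0 < r\<close> by (auto simp: op_alg_sel op_closure_eq closure_in_def)
    have "{e \<circ> f |e f. e \<in> Q \<and> f \<in> R} \<subseteq> {e \<circ> f |e f. e \<in> carr ?El \<and> f \<in> carr ?Er}"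
      using cl by blast
    then have "gspan ?B {e \<circ> f |e f. e \<in> Q \<and> f \<in> R} \<subseteq> gspan ?B {e \<circ> f |e f. e \<in> carr ?El \<and> f \<in> carr ?Er}"
      unfolding gspan_def by blast
    then show "\<exists>y\<in>gspan ?B {e \<circ> f |e f. e \<in> carr ?El \<and> f \<in> carr ?Er}. nrm ?B (vdiff ?B T y) < r"
      using full[OF T'(1)] T'(2) by blast
  qed
  ultimately show ?thesis
    unfolding morita_equivalence_def using algs ab by (simp add: comp_assoc)
qed

lemma lincomb_op_alg:
  "lincomb (op_alg V S) c T n h = (if h \<in> carr V then lincomb V c (\<lambda>i. T i h) n else zer V)"
  by (induction n) (simp_all add: op_alg_def)

lemma lincomb_lpsum_lp_space:
  "lincomb (lpsum p (lp_space p)) c v n x k = (\<Sum>i<n. c i * v i x k)"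
  by (induction n) (simp_all add: lp_space_ops)

section \<open>The case of the uniform Roe algebra and the uniform algebra\<close>

theorem theorem3p1:
  fixes p :: real
  assumes "bounded_geometry (UNIV :: 'a::metric_space set)"
    and "1 \<le> p"
  shows "morita_equivalent_via
           TYPE(('a \<Rightarrow> complex) \<Rightarrow> ('a \<Rightarrow> nat \<Rightarrow> complex))
           TYPE(('a \<Rightarrow> nat \<Rightarrow> complex) \<Rightarrow> ('a \<Rightarrow> complex))
           (Bpu p :: (('a \<Rightarrow> complex) \<Rightarrow> ('a \<Rightarrow> complex)) balg)
           (UBp p :: (('a \<Rightarrow> nat \<Rightarrow> complex) \<Rightarrow> ('a \<Rightarrow> nat \<Rightarrow> complex)) balg)"
proof -
  note bg = assms(1) and p = assms(2)
  note c = banach_space_cspace and lp = banach_space_lp_space[OF p]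
  let ?V = "lpsum p cspace :: ('a \<Rightarrow> complex) bspace"
  let ?W = "lpsum p (lp_space p) :: ('a \<Rightarrow> nat \<Rightarrow> complex) bspace"
  let ?P = "fpops p cspace cspace :: (('a \<Rightarrow> complex) \<Rightarrow> ('a \<Rightarrow> complex)) set"
  let ?Q = "fpops p cspace (lp_space p) :: (('a \<Rightarrow> complex) \<Rightarrow> ('a \<Rightarrow> nat \<Rightarrow> complex)) set"
  let ?R = "fpops p (lp_space p) cspace :: (('a \<Rightarrow> nat \<Rightarrow> complex) \<Rightarrow> ('a \<Rightarrow> complex)) set"
  let ?S = "urops p :: (('a \<Rightarrow> nat \<Rightarrow> complex) \<Rightarrow> ('a \<Rightarrow> nat \<Rightarrow> complex)) set"
  have V: "banach_space ?V" and W: "banach_space ?W"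
    by (intro banach_space_lpsum p c lp)+
  have S_sub: "\<And>b. b \<in> ?S \<Longrightarrow> b \<in> fpops p (lp_space p) (lp_space p)" by (simp add: urops_def)
  define \<delta> :: "nat \<Rightarrow> complex" where "\<delta> = single cspace 0 1"
  have delta: "\<delta> \<in> lp p" "lpnorm p \<delta> \<le> 1"
  proof -
    show "\<delta> \<in> lp p"
      using lpsum_single[OF p c, of 1 "0 :: nat"] by (simp add: \<delta>_def lp_space_lpsum[symmetric])
    have "nrm (lpsum p cspace) \<delta> \<le> 1"
    proof (rule lpsumI(2)[OF p])
      show "(\<Sum>x\<in>F. nrm cspace (\<delta> x) powr p) \<le> 1 powr p" if "finite F" for F
      proof -
        have "(\<Sum>x\<in>F. nrm cspace (\<delta> x) powr p) = (\<Sum>x\<in>F. if x = 0 then 1 else 0)"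
          by (intro sum.cong) (auto simp: \<delta>_def single_def)
        then show ?thesis using that by simp
      qed
    qed auto
    then show "lpnorm p \<delta> \<le> 1" by (simp add: lp_space_lpsum[symmetric])
  qed
  \<comment> \<open>The identity in the canonical form of \<open>bop\<close>, zero off the carrier.
    It makes evaluation at a coordinate an instance of \<open>rowop\<close>.\<close>
  define I where "I h = (if h \<in> carr ?W then h else zer ?W)" for h
  have I: "I \<in> fpops p (lp_space p) (lp_space p)"
  proof -
    have "I \<in> bop ?W ?W"
      by (rule bopI[where C = 1]) (auto simp: I_def bs_add[OF W] bs_smul[OF W])
    moreover have "fprop p (lp_space p) (lp_space p) 0 I"
      unfolding fprop_def by (auto simp: I_def)
    ultimately show ?thesis by (auto simp: fpops_def)
  qed
  define e0 where "e0 = colop p (\<lambda>_ :: 'a. \<delta>)"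
  define f0 where "f0 = rowop p (\<lambda>_ :: 'a. \<lambda>v. v 0) I"
  have e0: "e0 \<in> ?Q" unfolding e0_def by (rule colop_fpops[OF p delta])
  have f0: "f0 \<in> ?R"
    unfolding f0_def
  proof (rule rowop_fpops[OF p I, where K = 1])
    fix h :: "'a \<Rightarrow> nat \<Rightarrow> complex" and x assume h: "h \<in> carr ?W"
    have "h x \<in> carr (lpsum p cspace)" using lpsum_coord[OF h, of x] by (simp add: lp_space_lpsum)
    from lpsum_nrm_coord[OF p this, of 0] h
    show "norm (I h x 0) \<le> 1 * lpnorm p (I h x)"
      by (simp add: I_def lp_space_lpsum[symmetric])
  qed (auto simp: lin_on_def)
  have unit: "f0 (e0 h) = h" if h: "h \<in> carr ?V" for h
  proof -
    have "e0 h \<in> carr ?W" using e0 h bop_carr[of e0 ?V ?W] by (auto simp: fpops_def)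
    then show ?thesis using h by (simp add: f0_def rowop_def I_def e0_def colop_def \<delta>_def single_def)
  qed
  have full: "T \<in> gspan (op_alg ?W (op_closure ?W ?S)) {e \<circ> f |e f. e \<in> ?Q \<and> f \<in> ?R}" if T: "T \<in> ?S" for T
  proof -
    obtain N :: nat and e f where ef: "\<And>i. i < N \<Longrightarrow> e i \<in> ?Q" "\<And>i. i < N \<Longrightarrow> f i \<in> ?R"
      and sum: "\<And>h x k. h \<in> carr ?W \<Longrightarrow> T h x k = (\<Sum>i<N. e i (f i h) x k)"
      using urops_factor[OF p T] by blast
    \<comment> \<open>\<open>sum\<close> covers the carrier only; elsewhere both operators give the
      zero vector, and equality of functions requires this case too.\<close>
    have out: "T h = zer ?W" if "h \<notin> carr ?W" for h
      using T that bop_out[of T ?W ?W h] by (auto simp: urops_def fpops_def)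
    have "lincomb (op_alg ?W (op_closure ?W ?S)) (\<lambda>_. 1) (\<lambda>i. e i \<circ> f i) N = T"
    proof (intro ext)
      fix h x k
      show "lincomb (op_alg ?W (op_closure ?W ?S)) (\<lambda>_. 1) (\<lambda>i. e i \<circ> f i) N h x k = T h x k"
        by (cases "h \<in> carr ?W") (simp_all add: lincomb_op_alg lincomb_lpsum_lp_space sum out)
    qed
    then show ?thesis unfolding gspan_def using ef by blast
  qed
  have "morita_equivalence (op_alg ?V (op_closure ?V ?P)) (op_alg ?W (op_closure ?W ?S))
      (opcl ?V ?W ?Q) (opcl ?W ?V ?R) (\<circ>) (\<circ>) (\<circ>) (\<circ>) (\<circ>) (\<circ>)"
  proof (rule morita_equivalence_opcl[OF V W _ _ _ _ _ _ _ _ _ _ _ _ e0 f0 unit full])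
    show "subspace_in (bops ?V ?V (bop ?V ?V)) ?P" "subspace_in (bops ?V ?W (bop ?V ?W)) ?Q"
      "subspace_in (bops ?W ?V (bop ?W ?V)) ?R" "subspace_in (bops ?W ?W (bop ?W ?W)) ?S"
      by (intro subspace_in_fpops subspace_in_urops p c lp)+
    show "b \<circ> b' \<in> ?S" if "b \<in> ?S" "b' \<in> ?S" for b b'
      using that by (intro urops_comp[OF p lp]) (auto simp: urops_def)
    show "e \<circ> f \<in> ?S" if "e \<in> ?Q" "f \<in> ?R" for e f
      using that by (intro urops_comp[OF p c] row_rank_column[OF bg p])
  qed (use S_sub in \<open>auto intro: fpops_comp[OF p] c lp\<close>)
  moreover have "(Bpu p :: (('a \<Rightarrow> complex) \<Rightarrow> ('a \<Rightarrow> complex)) balg) = op_alg ?V (op_closure ?V ?P)"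
    by (simp add: Bpu_def Cpu_eq[OF p] lp_space_lpsum)
  moreover have "(UBp p :: (('a \<Rightarrow> nat \<Rightarrow> complex) \<Rightarrow> ('a \<Rightarrow> nat \<Rightarrow> complex)) balg) = op_alg ?W (op_closure ?W ?S)"
    by (simp add: UBp_def UCp_eq[OF bg p] lpv_space_lpsum)
  ultimately show ?thesis
    unfolding morita_equivalent_via_def by metis
qed

end
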